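(* Let $(X,d)$, $G$, $o$ be as in the context and let $(\omega_n)_n$ be the random walk generated by a non-elementary probability measure $\mu$ on $G$. Then there exists a constant $\lambda=\lambda(\mu)\in(0,+\infty]$ such that $\lim_{n\to\infty}\frac1n d(o,\omega_n o)=\lambda$ almost surely. Moreover, $\lambda(\mu)$ is finite if and only if $\mu$ has finite first moment, i.e. $\int d(o,go)\,d\mu(g)<\infty$.
   Context: $(X,d)$ is a geodesic metric space, $G$ is a countable group of isometries of $X$ containing two independent contracting isometries, and $o\in X$ a basepoint. For $A\subseteq X$, $\pi_A(x)=\{a\in A: d(x,a)=d(x,A)\}$; $A$ is $K$-contracting if $\pi_A(z)\ne\emptyset$ for all $z$ and $d(x,y)\le d(x,A)-K$ implies $\operatorname{diam}(\pi_A(x)\cup\pi_A(y))\le K$. A $K$-quasigeodesic is a map $\gamma$ from a set of consecutive integers (or an interval) to $X$ with $|s-t|/K-K\le d(\gamma(s),\gamma(t))\le K|s-t|+K$. An isometry $g$ is contracting if $n\in\mathbb Z\mapsto g^no$ is a $K$-quasigeodesic with $K$-contracting image for some $K$. $g,h$ are independent if $\{(n,m):d(g^no,h^mo)<M\}$ is bounded for each $M>0$. $\mu$ is non-elementary if the semigroup generated by $\operatorname{supp}\mu$ contains two independent contracting isometries. $\omega_n=g_1\cdots g_n$ with $(g_i)$ i.i.d. of law $\mu$. *)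

theory Defs
  imports "HOL-Probability.Probability"
begin

definition geodesic_space :: "'x::metric_space itself \<Rightarrow> bool" where
  "geodesic_space _ \<longleftrightarrow>
     (\<forall>x y::'x. \<exists>\<gamma>::real \<Rightarrow> 'x. \<gamma> 0 = x \<and> \<gamma> (dist x y) = y \<and>
        (\<forall>s\<in>{0..dist x y}. \<forall>t\<in>{0..dist x y}. dist (\<gamma> s) (\<gamma> t) = \<bar>s - t\<bar>))"

definition isometry :: "('x::metric_space \<Rightarrow> 'x) \<Rightarrow> bool" where
  "isometry g \<longleftrightarrow> bij g \<and> (\<forall>x y. dist (g x) (g y) = dist x y)"

definition isometry_group :: "('x::metric_space \<Rightarrow> 'x) set \<Rightarrow> bool" where
  "isometry_group G \<longleftrightarrow> countable G \<and> (\<forall>g\<in>G. isometry g) \<and> id \<in> G \<and>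
     (\<forall>g\<in>G. \<forall>h\<in>G. g \<circ> h \<in> G) \<and> (\<forall>g\<in>G. inv g \<in> G)"

definition proj :: "'x::metric_space set \<Rightarrow> 'x \<Rightarrow> 'x set" where
  "proj A x = {a \<in> A. dist x a = infdist x A}"

definition contracting_set :: "real \<Rightarrow> 'x::metric_space set \<Rightarrow> bool" where
  "contracting_set K A \<longleftrightarrow> (\<forall>z. proj A z \<noteq> {}) \<and>
     (\<forall>x y. dist x y \<le> infdist x A - K \<longrightarrow>
        (\<forall>a\<in>proj A x \<union> proj A y. \<forall>b\<in>proj A x \<union> proj A y. dist a b \<le> K))"

definition quasigeodesic_int :: "real \<Rightarrow> (int \<Rightarrow> 'x::metric_space) \<Rightarrow> bool" where
  "quasigeodesic_int K \<gamma> \<longleftrightarrow> (\<forall>s t.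
     \<bar>real_of_int (s - t)\<bar> / K - K \<le> dist (\<gamma> s) (\<gamma> t) \<and>
     dist (\<gamma> s) (\<gamma> t) \<le> K * \<bar>real_of_int (s - t)\<bar> + K)"

definition ipow :: "('x \<Rightarrow> 'x) \<Rightarrow> int \<Rightarrow> ('x \<Rightarrow> 'x)" where
  "ipow g n = (if 0 \<le> n then g ^^ nat n else (inv g) ^^ nat (- n))"

definition contracting_isom :: "'x::metric_space \<Rightarrow> ('x \<Rightarrow> 'x) \<Rightarrow> bool" where
  "contracting_isom x0 g \<longleftrightarrow> (\<exists>K. quasigeodesic_int K (\<lambda>n. ipow g n x0) \<and>
      contracting_set K (range (\<lambda>n. ipow g n x0)))"

definition independent_isom :: "'x::metric_space \<Rightarrow> ('x \<Rightarrow> 'x) \<Rightarrow> ('x \<Rightarrow> 'x) \<Rightarrow> bool" where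
  "independent_isom x0 g h \<longleftrightarrow> (\<forall>M>0. \<exists>N. \<forall>n m.
      dist (ipow g n x0) (ipow h m x0) < M \<longrightarrow> \<bar>n\<bar> \<le> N \<and> \<bar>m\<bar> \<le> N)"

inductive_set gen_semigroup :: "('x \<Rightarrow> 'x) set \<Rightarrow> ('x \<Rightarrow> 'x) set" for S where
  base: "s \<in> S \<Longrightarrow> s \<in> gen_semigroup S"
| mult: "a \<in> gen_semigroup S \<Longrightarrow> b \<in> gen_semigroup S \<Longrightarrow> a \<circ> b \<in> gen_semigroup S"

definition non_elementary :: "'x::metric_space \<Rightarrow> ('x \<Rightarrow> 'x) pmf \<Rightarrow> bool" where
  "non_elementary x0 \<mu> \<longleftrightarrow> (\<exists>g\<in>gen_semigroup (set_pmf \<mu>). \<exists>h\<in>gen_semigroup (set_pmf \<mu>).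
      contracting_isom x0 g \<and> contracting_isom x0 h \<and> independent_isom x0 g h)"

text \<open>Random walk: walk xi n = xi 0 \<circ> ... \<circ> xi (n-1), i.e. g_1 ... g_n.\<close>
primrec walk :: "(nat \<Rightarrow> ('x \<Rightarrow> 'x)) \<Rightarrow> nat \<Rightarrow> ('x \<Rightarrow> 'x)" where
  "walk xi 0 = id"
| "walk xi (Suc n) = walk xi n \<circ> xi n"

end

theory Submission
  imports Defs
begin

text \<open>
  Fix independent contracting isometries \<open>a\<close>, \<open>b\<close> in the semigroup of \<open>\<mu>\<close>. The elements
  \<open>s k = b^(m (k + 1)) a^r b^(m (N - k))\<close> act as gates: every point lies behind at most one of
  them, and two gates that are aligned at their end points shield each other. A convolution power of \<open>\<mu>\<close> is a
  mixture that inserts a uniformly random gate with positive probability. If \<open>c\<close> bounds the probability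
  that the walk ever returns behind a random gate, the strong Markov property, applied to the first
  return behind the next gate, yields \<open>c \<le> 3/N + c\<^sup>2\<close>, so \<open>c\<close> stays below \<open>4/N\<close>. Hence a given
  position is, with probability bounded below, a gate that separates all earlier gates from all later ones.

  Distances add up along such separating gates. The (truncated) distances between neighbouring ones
  form a subadditive process up to a constant, so by Kingman's theorem they yield an almost sure linear lower bound
  for \<open>d(o, \<omega>\<^sub>n o)\<close> at gate times; the first bad time is followed by a gate with a fixed probability, so the bound
  holds at all times. The bound is positive, and it is arbitrarily large if the first moment is infinite.
  If the first moment is finite, Kingman's theorem gives the limit.
\<close>

section \<open>Contracting sets and orbits\<close>

text \<open>The inequality \<open>c \<le> 3/N + c\<^sup>2\<close> holds for \<open>c\<close> near 1
  as well. The smallness of \<open>c\<close> therefore comes from an induction on a finite time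
  horizon, which starts at probability 0 and never leaves the range of the smaller root. The bound
  concerns the average over a uniform gate, expressed as a sum of at most 4 over all
  \<open>N\<close> gates; a single gate carries no such bound. Returns are counted only at times
  when the next letter is a gate, so that every loss is compensated by a fresh random gate. Without
  a moment assumption, neither the distance process nor its increments are integrable. The ergodic
  theorem is therefore applied to a bounded process built from truncated steps between gates, and
  truncation levels tending to infinity recover the infinite first moment. For the same reason the
  passage from multiples of the block length to all times cannot estimate the steps in between; it
  drops a short initial piece of the walk instead.\<close>

lemma geodesic_spaceE:
  fixes x y :: "'x::metric_space"
  assumes "geodesic_space TYPE('x)"
  obtains \<gamma> :: "real \<Rightarrow> 'x" where "\<gamma> 0 = x" "\<gamma> (dist x y) = y"
    "\<And>s t. 0 \<le> s \<Longrightarrow> s \<le> dist x y \<Longrightarrow> 0 \<le> t \<Longrightarrow> t \<le> dist x y \<Longrightarrow> dist (\<gamma> s) (\<gamma> t) = \<bar>s - t\<bar>"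
  using assms unfolding geodesic_space_def by (metis atLeastAtMost_iff)

lemma proj_self: "c \<in> A \<Longrightarrow> c \<in> proj A c"
  by (simp add: proj_def infdist_zero)

lemma projD: "a \<in> proj A x \<Longrightarrow> a \<in> A \<and> infdist x A = dist x a"
  by (simp add: proj_def)

lemma proj_le: "a \<in> proj A x \<Longrightarrow> c \<in> A \<Longrightarrow> dist x a \<le> dist x c"
  by (simp add: proj_def infdist_le)

text \<open>The radius \<open>max 0 (infdist x A - K)\<close> may degenerate: within
  \<open>K\<close> of \<open>A\<close> it forces \<open>z = x\<close>, and two closest points of
  such an \<open>x\<close> are at most \<open>2 * K\<close> apart. This avoids later case
  distinctions on the distance to \<open>A\<close>.\<close>

lemma contracting_proj_near:
  assumes A: "contracting_set K A" and "0 \<le> K"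
    and "dist x z \<le> max 0 (infdist x A - K)" "a \<in> proj A x" "c \<in> proj A z"
  shows "dist a c \<le> 2 * K"
proof (cases "infdist x A \<ge> K")
  case True
  then have "dist x z \<le> infdist x A - K" using assms(3) by simp
  then have "dist a c \<le> K" using A assms(4,5) unfolding contracting_set_def by blast
  then show ?thesis using \<open>0 \<le> K\<close> by simp
next
  case False
  then have "z = x" using assms(3) by simp
  then have "dist x a \<le> K" "dist x c \<le> K" using False assms(4,5) by (auto simp: proj_def)
  then show ?thesis using dist_triangle3[of a c x] by (simp add: dist_commute)
qed

text \<open>The balls around \<open>x\<close> and \<open>y\<close> of these two radii project to
  within \<open>2 * K\<close> of \<open>a\<close> and of \<open>b\<close>. If they met on the
  geodesic, a common point would bring \<open>a\<close> and \<open>b\<close> within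
  \<open>4 * K\<close>. Hence both ends of the geodesic can be cut off.\<close>

lemma contracting_shrink:
  fixes A :: "'x::metric_space set"
  assumes geo: "geodesic_space TYPE('x)" and A: "contracting_set K A" and K: "0 \<le> K"
    and a: "a \<in> proj A x" and b: "b \<in> proj A y" and ab: "dist a b > 4 * K"
  obtains x' y' a' b' where "a' \<in> proj A x'" "b' \<in> proj A y'" "dist a a' \<le> 2 * K" "dist b b' \<le> 2 * K"
    "dist x y = max 0 (infdist x A - K) + dist x' y' + max 0 (infdist y A - K)"
proof -
  obtain \<gamma> where \<gamma>: "\<gamma> 0 = x" "\<gamma> (dist x y) = y"
    "\<And>s t. 0 \<le> s \<Longrightarrow> s \<le> dist x y \<Longrightarrow> 0 \<le> t \<Longrightarrow> t \<le> dist x y \<Longrightarrow> dist (\<gamma> s) (\<gamma> t) = \<bar>s - t\<bar>"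
    using geodesic_spaceE[OF geo] by metis
  define r s where "r = max 0 (infdist x A - K)" and "s = max 0 (infdist y A - K)"
  have ne: "\<exists>c. c \<in> proj A z" for z using A unfolding contracting_set_def by blast
  have rs: "r \<ge> 0" "s \<ge> 0" by (auto simp: r_def s_def)
  have le: "r + s \<le> dist x y"
  proof (rule ccontr)
    assume gt: "\<not> ?thesis"
    define t where "t = min r (dist x y)"
    have t: "0 \<le> t" "t \<le> dist x y" "dist x y - t \<le> s" "t \<le> r" using gt rs by (auto simp: t_def)
    have d: "dist x (\<gamma> t) = t" "dist y (\<gamma> t) = dist x y - t"
      using \<gamma>(3)[of 0 t] \<gamma>(3)[of "dist x y" t] \<gamma>(1,2) t by auto
    obtain c where c: "c \<in> proj A (\<gamma> t)" using ne by blast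
    have "dist a c \<le> 2 * K" "dist b c \<le> 2 * K"
      using contracting_proj_near[OF A K _ a c] contracting_proj_near[OF A K _ b c] d t
      by (auto simp: r_def s_def)
    then show False using ab dist_triangle2[of a b c] by simp
  qed
  define x' y' where "x' = \<gamma> r" and "y' = \<gamma> (dist x y - s)"
  have d: "dist x x' = r" "dist y y' = s" "dist x' y' = dist x y - s - r"
    using \<gamma>(3)[of 0 r] \<gamma>(3)[of "dist x y" "dist x y - s"] \<gamma>(3)[of r "dist x y - s"] \<gamma>(1,2) le rs
    by (auto simp: x'_def y'_def)
  obtain a' b' where ab': "a' \<in> proj A x'" "b' \<in> proj A y'" using ne by blast
  have "dist a a' \<le> 2 * K" "dist b b' \<le> 2 * K"
    using contracting_proj_near[OF A K _ a ab'(1)] contracting_proj_near[OF A K _ b ab'(2)] d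
    by (auto simp: r_def s_def)
  then show thesis using that ab' d unfolding r_def s_def by auto
qed

text \<open>If \<open>x\<close> or \<open>y\<close> is far from \<open>A\<close>, then the previous lemma shortens \<open>[x,y]\<close> by at least
  as much as it moves the projections; hence induction on the length of \<open>[x,y]\<close>.\<close>
lemma contracting_proj_lipschitz:
  fixes A :: "'x::metric_space set"
  assumes geo: "geodesic_space TYPE('x)" and A: "contracting_set K A" and K: "0 < K"
    and a: "a \<in> proj A x" and b: "b \<in> proj A y"
  shows "dist a b \<le> dist x y + 6 * K"
proof -
  have "dist a b \<le> dist x y + 6 * K"
    if "dist x y \<le> 4 * K * real n" "a \<in> proj A x" "b \<in> proj A y" for n x y a b
    using that
  proof (induction n arbitrary: x y a b rule: less_induct)
    case (less n)
    show ?case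
    proof (cases "dist a b > 4 * K \<and> max 0 (infdist x A - K) + max 0 (infdist y A - K) \<ge> 4 * K")
      case True
      then obtain x' y' a' b' where *: "a' \<in> proj A x'" "b' \<in> proj A y'" "dist a a' \<le> 2 * K" "dist b b' \<le> 2 * K"
        "dist x y = max 0 (infdist x A - K) + dist x' y' + max 0 (infdist y A - K)"
        using contracting_shrink[OF geo A _ less.prems(2,3)] K by (metis less_imp_le)
      then have le: "dist x' y' \<le> dist x y - 4 * K" using True by linarith
      have "n \<noteq> 0"
      proof
        assume "n = 0"
        then have "dist x y \<le> 0" using less.prems(1) by simp
        then show False using le zero_le_dist[of x' y'] K by linarith
      qed
      then obtain m where m: "n = Suc m" by (cases n) auto
      have "dist x' y' \<le> 4 * K * real m" using le less.prems(1) m by (simp add: algebra_simps)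
      then have "dist a' b' \<le> dist x' y' + 6 * K" using less.IH[of m] m *(1,2) by simp
      moreover have "dist a b \<le> dist a a' + dist a' b' + dist b b'"
        by (smt (verit) dist_commute dist_triangle)
      ultimately show ?thesis using * le by linarith
    next
      case False
      \<comment> \<open>If the second condition fails, then
        \<open>(infdist x A - K) + (infdist y A - K) < 4 * K\<close>; this is the origin of
        \<open>6 * K\<close>.\<close>
      then consider "dist a b \<le> 4 * K" | "infdist x A + infdist y A \<le> 6 * K" using K by fastforce
      then show ?thesis
      proof cases
        case 1 then show ?thesis using K zero_le_dist[of x y] by linarith
      next
        case 2
        then have "dist x a + dist y b \<le> 6 * K" using projD[OF less.prems(2)] projD[OF less.prems(3)] by simp
        moreover have "dist a b \<le> dist x a + dist x y + dist y b"
          by (smt (verit) dist_commute dist_triangle)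
        ultimately show ?thesis by linarith
      qed
    qed
  qed
  moreover obtain n where "dist x y / (4 * K) \<le> real n" using real_arch_simple by blast
  then have "dist x y \<le> 4 * K * real n" using K by (simp add: field_simps)
  ultimately show ?thesis using a b by blast
qed

text \<open>After the ends are cut off, the middle part is bounded below by the Lipschitz estimate.
  The cost is \<open>2 * K\<close> for the two radii, \<open>4 * K\<close> for the moved projections
  and \<open>6 * K\<close> for the Lipschitz estimate.\<close>

lemma contracting_proj_detour:
  fixes A :: "'x::metric_space set"
  assumes geo: "geodesic_space TYPE('x)" and A: "contracting_set K A" and K: "0 < K"
    and a: "a \<in> proj A x" and b: "b \<in> proj A y" and ab: "dist a b > 4 * K"
  shows "dist x a + dist a b + dist b y \<le> dist x y + 12 * K"
proof -
  obtain x' y' a' b' where *: "a' \<in> proj A x'" "b' \<in> proj A y'" "dist a a' \<le> 2 * K" "dist b b' \<le> 2 * K"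
    "dist x y = max 0 (infdist x A - K) + dist x' y' + max 0 (infdist y A - K)"
    using contracting_shrink[OF geo A _ a b ab] K by (metis less_imp_le)
  have "dist a' b' \<le> dist x' y' + 6 * K" by (rule contracting_proj_lipschitz[OF geo A K *(1,2)])
  moreover have "dist a b \<le> dist a a' + dist a' b' + dist b b'"
    by (smt (verit) dist_commute dist_triangle)
  moreover have "dist x a = infdist x A" "dist b y = infdist y A"
    using projD[OF a] projD[OF b] by (auto simp: dist_commute)
  ultimately show ?thesis using * by linarith
qed

lemma contracting_proj_detour_mem:
  fixes A :: "'x::metric_space set"
  assumes geo: "geodesic_space TYPE('x)" and A: "contracting_set K A" and K: "0 < K"
    and a: "a \<in> proj A x" and c: "c \<in> A"
  shows "dist x a + dist a c \<le> dist x c + 12 * K"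
proof (cases "dist a c > 4 * K")
  case True
  then show ?thesis using contracting_proj_detour[OF geo A K a proj_self[OF c] True] by simp
next
  case False
  then show ?thesis using proj_le[OF a c] K by simp
qed

section \<open>Orbits indexed by the integers and projection indices\<close>

definition contracting_orbit :: "real \<Rightarrow> (int \<Rightarrow> 'x::metric_space) \<Rightarrow> bool" where
  "contracting_orbit K p \<longleftrightarrow> 0 < K \<and> quasigeodesic_int K p \<and> contracting_set K (range p)"

text \<open>Indices are kept instead of points because the order along the orbit matters. The value
  is a set, since closest points need not be unique and \<open>p\<close> need not be
  injective.\<close>

definition pidx :: "(int \<Rightarrow> 'x::metric_space) \<Rightarrow> 'x \<Rightarrow> int set" where
  "pidx p x = {n. p n \<in> proj (range p) x}"

lemma pidx_ne: "contracting_orbit K p \<Longrightarrow> \<exists>n. n \<in> pidx p x"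
  unfolding contracting_orbit_def contracting_set_def pidx_def proj_def by blast

lemma orbit_dist_le: "contracting_orbit K p \<Longrightarrow> dist (p s) (p t) \<le> K * \<bar>s - t\<bar> + K"
  unfolding contracting_orbit_def quasigeodesic_int_def by auto

lemma orbit_idx_le:
  assumes "contracting_orbit K p" shows "\<bar>s - t\<bar> \<le> K * dist (p s) (p t) + K * K"
proof -
  have "K > 0" "\<bar>s - t\<bar> / K - K \<le> dist (p s) (p t)"
    using assms unfolding contracting_orbit_def quasigeodesic_int_def by auto
  then show ?thesis by (simp add: field_simps)
qed

lemma pidx_detour:
  fixes p :: "int \<Rightarrow> 'x::metric_space"
  assumes "geodesic_space TYPE('x)" "contracting_orbit K p" "m \<in> pidx p x" "n \<in> pidx p y" "dist (p m) (p n) > 4 * K"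
  shows "dist x (p m) + dist (p m) (p n) + dist (p n) y \<le> dist x y + 12 * K"
  using contracting_proj_detour[of K "range p" "p m" x "p n" y] assms
  by (auto simp: contracting_orbit_def pidx_def)

lemma pidx_detour_orbit:
  fixes p :: "int \<Rightarrow> 'x::metric_space"
  assumes "geodesic_space TYPE('x)" "contracting_orbit K p" "m \<in> pidx p x"
  shows "dist x (p m) + dist (p m) (p n) \<le> dist x (p n) + 12 * K"
  using contracting_proj_detour_mem[of K "range p" "p m" x "p n"] assms
  by (auto simp: contracting_orbit_def pidx_def)

text \<open>Along a geodesic from \<open>p i\<close> to \<open>p k\<close> the projection index changes by bounded jumps, so
  some point of the geodesic projects close to \<open>p j\<close>.\<close>
lemma orbit_between:
  fixes p :: "int \<Rightarrow> 'x::metric_space"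
  assumes geo: "geodesic_space TYPE('x)" and p: "contracting_orbit K p"
  obtains C where "C \<ge> 0"
    "\<And>i j k. i \<le> j \<Longrightarrow> j \<le> k \<Longrightarrow> dist (p i) (p j) + dist (p j) (p k) \<le> dist (p i) (p k) + C"
proof -
  have K: "K > 0" using p by (simp add: contracting_orbit_def)
  define R where "R = K * (K * (6 * K + 1) + K * K) + K"
  have R: "R > 0" using K by (simp add: R_def add_pos_pos)
  have "dist (p i) (p j) + dist (p j) (p k) \<le> dist (p i) (p k) + (24 * K + 2 * R)" if ijk: "i \<le> j" "j \<le> k" for i j k
  proof -
    obtain \<gamma> where \<gamma>: "\<gamma> 0 = p i" "\<gamma> (dist (p i) (p k)) = p k"
      "\<And>s t. 0 \<le> s \<Longrightarrow> s \<le> dist (p i) (p k) \<Longrightarrow> 0 \<le> t \<Longrightarrow> t \<le> dist (p i) (p k) \<Longrightarrow> dist (\<gamma> s) (\<gamma> t) = \<bar>s - t\<bar>"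
      using geodesic_spaceE[OF geo] by metis
    define l where "l = dist (p i) (p k)"
    obtain M :: nat where M: "l \<le> real M" using real_arch_simple by blast
    \<comment> \<open>Unit samples of the geodesic; \<open>min\<close> makes the last sample its end
      point.\<close>
    define t where "t n = min l (real n)" for n :: nat
    define P where "P n \<longleftrightarrow> (\<exists>m\<in>pidx p (\<gamma> (t n)). j \<le> m)" for n
    have t: "0 \<le> t n" "t n \<le> l" "\<bar>t (Suc n) - t n\<bar> \<le> 1" for n
      by (auto simp: t_def l_def min_def)
    have self: "m \<in> pidx p (p m)" for m by (auto simp: pidx_def intro: proj_self)
    have "t M = l" "t 0 = 0" using M by (auto simp: t_def l_def)
    then have PM: "P M" using self[of k] ijk \<gamma>(2) by (auto simp: P_def l_def)
    \<comment> \<open>The first sample with a projection index at least \<open>j\<close>: all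
      indices of the preceding sample are below \<open>j\<close>, so one jump straddles
      \<open>j\<close>.\<close>
    obtain n m where nm: "m \<in> pidx p (\<gamma> (t n))" "dist (p m) (p j) \<le> R"
    proof -
      define n where "n = (LEAST n. P n)"
      have Pn: "P n" and least: "\<And>n'. n' < n \<Longrightarrow> \<not> P n'"
        unfolding n_def using PM by (auto intro: LeastI dest: not_less_Least)
      obtain m where m: "m \<in> pidx p (\<gamma> (t n))" "j \<le> m" using Pn by (auto simp: P_def)
      show thesis
      proof (cases n)
        case 0
        then have "p i \<in> range p" "\<gamma> (t n) = p i" using \<gamma>(1) \<open>t 0 = 0\<close> by auto
        then have "i \<in> pidx p (\<gamma> (t n))" using self by auto
        show thesis
        proof (cases "i = j")
          case True then show thesis using that \<open>i \<in> pidx p (\<gamma> (t n))\<close> R by force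
        next
          case False
          \<comment> \<open>At the starting point \<open>m\<close> may differ from \<open>i\<close>
            although \<open>p m = p i\<close>; the lower quasigeodesic bound limits this gap to
            \<open>K * K\<close>.\<close>
          have "dist (p m) (p i) \<le> 0" using m(1) \<open>\<gamma> (t n) = p i\<close> proj_le[of "p m" "range p" "p i" "p i"]
            by (auto simp: pidx_def dist_commute)
          then have "p m = p i" by simp
          then have "\<bar>m - i\<bar> \<le> K * K" using orbit_idx_le[OF p, of m i] by simp
          then have "\<bar>m - j\<bar> \<le> K * K" using m(2) ijk by linarith
          then have "dist (p m) (p j) \<le> K * (K * K) + K"
            using orbit_dist_le[OF p, of m j] K by (smt (verit) mult_left_mono)
          also have "\<dots> \<le> R" using K by (simp add: R_def algebra_simps)
          finally show thesis using that m(1) by blast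
        qed
      next
        case (Suc n')
        obtain m' where m': "m' \<in> pidx p (\<gamma> (t n'))" using pidx_ne[OF p] by blast
        have "m' < j" using least[of n'] Suc m' by (force simp: P_def)
        have "dist (\<gamma> (t n)) (\<gamma> (t n')) \<le> 1"
          using \<gamma>(3)[of "t n" "t n'"] t[of n] t[of n'] Suc by (simp add: l_def)
        then have "dist (p m) (p m') \<le> 6 * K + 1"
          using contracting_proj_lipschitz[OF geo, of K "range p" "p m" _ "p m'"] m m' p
          by (fastforce simp: pidx_def contracting_orbit_def)
        then have "K * dist (p m) (p m') \<le> K * (6 * K + 1)" using K by simp
        then have "\<bar>m - m'\<bar> \<le> K * (6 * K + 1) + K * K" using orbit_idx_le[OF p, of m m'] by linarith
        then have "\<bar>m - j\<bar> \<le> K * (6 * K + 1) + K * K" using m(2) \<open>m' < j\<close> by linarith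
        then have "dist (p m) (p j) \<le> R"
          using orbit_dist_le[OF p, of m j] K unfolding R_def by (smt (verit) mult_left_mono)
        then show thesis using that m(1) by blast
      qed
    qed
    have 1: "dist (\<gamma> (t n)) (p m) + dist (p m) (p i) \<le> dist (\<gamma> (t n)) (p i) + 12 * K"
      and 2: "dist (\<gamma> (t n)) (p m) + dist (p m) (p k) \<le> dist (\<gamma> (t n)) (p k) + 12 * K"
      using pidx_detour_orbit[OF geo p nm(1)] by auto
    have "dist (\<gamma> (t n)) (p i) = t n" "dist (\<gamma> (t n)) (p k) = l - t n"
      using \<gamma>(3)[of "t n" 0] \<gamma>(3)[of "t n" l] \<gamma>(1,2) t[of n] by (auto simp: l_def)
    moreover have "dist (p i) (p j) \<le> dist (p m) (p i) + dist (p m) (p j)"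
      "dist (p j) (p k) \<le> dist (p m) (p j) + dist (p m) (p k)"
      by (smt (verit) dist_commute dist_triangle)+
    ultimately show ?thesis using 1 2 nm(2) zero_le_dist[of "\<gamma> (t n)" "p m"] unfolding l_def by linarith
  qed
  moreover have "24 * K + 2 * R \<ge> 0" using K R by simp
  ultimately show thesis using that by blast
qed

text \<open>A large index gap separates the projections by more than \<open>4 * K\<close>, so going
  from \<open>x\<close> to \<open>y\<close> via both projections is no real detour. The intermediate
  orbit points \<open>p j\<close> and \<open>p k\<close> are then inserted with
  \<open>orbit_between\<close>, at cost \<open>C\<close> each.\<close>

lemma pidx_gate:
  fixes p :: "int \<Rightarrow> 'x::metric_space"
  assumes geo: "geodesic_space TYPE('x)" and p: "contracting_orbit K p"
  obtains C R where "C \<ge> 0" "R > 0"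
    "\<And>x y i j k l. i \<in> pidx p x \<Longrightarrow> l \<in> pidx p y \<Longrightarrow> i \<le> j \<Longrightarrow> j \<le> k \<Longrightarrow> k \<le> l \<Longrightarrow> i + R \<le> l \<Longrightarrow>
      dist x (p j) + dist (p j) (p k) + dist (p k) y \<le> dist x y + C"
proof -
  have K: "K > 0" using p by (simp add: contracting_orbit_def)
  obtain C where C: "C \<ge> 0"
    "\<And>i j k. i \<le> j \<Longrightarrow> j \<le> k \<Longrightarrow> dist (p i) (p j) + dist (p j) (p k) \<le> dist (p i) (p k) + C"
    using orbit_between[OF geo p] by blast
  \<comment> \<open>An index gap above \<open>K * (4 * K) + K * K\<close> forces a distance above
    \<open>4 * K\<close>.\<close>
  define R where "R = nat \<lceil>5 * K * K + K * K\<rceil> + 1"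
  have R: "real_of_int (int R) > 5 * K * K + K * K" unfolding R_def by linarith
  have "dist x (p j) + dist (p j) (p k) + dist (p k) y \<le> dist x y + (2 * C + 12 * K)"
    if *: "i \<in> pidx p x" "l \<in> pidx p y" "i \<le> j" "j \<le> k" "k \<le> l" "i + int R \<le> l" for x y i j k l
  proof -
    have "dist (p i) (p l) > 4 * K"
    proof (rule ccontr)
      assume "\<not> ?thesis"
      then have "K * dist (p i) (p l) \<le> K * (4 * K)" using K by (simp add: mult_left_mono)
      then have "\<bar>i - l\<bar> \<le> K * (4 * K) + K * K" using orbit_idx_le[OF p, of i l] by linarith
      moreover have "real_of_int (int R) \<le> \<bar>i - l\<bar>" using *(6) by linarith
      moreover have "K * K \<ge> 0" by simp
      ultimately show False using R by linarith
    qed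
    then have "dist x (p i) + dist (p i) (p l) + dist (p l) y \<le> dist x y + 12 * K"
      using pidx_detour[OF geo p *(1,2)] by blast
    moreover have "dist (p i) (p j) + dist (p j) (p k) \<le> dist (p i) (p k) + C"
      "dist (p i) (p k) + dist (p k) (p l) \<le> dist (p i) (p l) + C" using C(2) * by auto
    moreover have "dist x (p j) \<le> dist x (p i) + dist (p i) (p j)"
      "dist (p k) y \<le> dist (p k) (p l) + dist (p l) y" by (rule dist_triangle)+
    ultimately show ?thesis by linarith
  qed
  moreover have "2 * C + 12 * K \<ge> 0" "int R > 0" using C(1) K unfolding R_def by linarith+
  ultimately show thesis using that[of "2 * C + 12 * K" "int R"] by blast
qed

section \<open>Gates along contracting orbits\<close>

lemma isometryD: "isometry f \<Longrightarrow> bij f" "isometry f \<Longrightarrow> dist (f x) (f y) = dist x y"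
  by (auto simp: isometry_def)

lemma isometry_comp: "isometry f \<Longrightarrow> isometry g \<Longrightarrow> isometry (f \<circ> g)"
  by (auto simp: isometry_def bij_comp)

lemma isometry_id: "isometry id"
  by (auto simp: isometry_def)

lemma isometry_inv: "isometry f \<Longrightarrow> isometry (inv f)"
  unfolding isometry_def by (metis bij_imp_bij_inv bij_inv_eq_iff)

lemma isometry_inv_cancel: "isometry f \<Longrightarrow> inv f (f x) = x" "isometry f \<Longrightarrow> f (inv f x) = x"
  by (auto simp: isometry_def bij_def surj_f_inv_f)

lemma isometry_funpow: "isometry f \<Longrightarrow> isometry (f ^^ n)"
  by (induction n) (auto intro: isometry_comp isometry_id)

lemma ipow_0 [simp]: "ipow g 0 = id"
  by (simp add: ipow_def id_def)

lemma ipow_Suc: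
  assumes "bij g" shows "g (ipow g n x) = ipow g (n + 1) x"
proof (cases "n \<ge> 0")
  case True
  then have "nat (n + 1) = Suc (nat n)" by simp
  then show ?thesis using True by (simp add: ipow_def)
next
  case False
  then have "nat (- n) = Suc (nat (- (n + 1)))" by simp
  then show ?thesis using False assms by (auto simp: ipow_def bij_is_surj surj_f_inv_f)
qed

lemma ipow_funpow:
  assumes "bij g" shows "(g ^^ k) (ipow g n x) = ipow g (n + int k) x"
  by (induction k) (simp_all add: ipow_Suc[OF assms] add.commute add.left_commute)

lemma inv_funpow_ipow:
  assumes "isometry g" shows "inv (g ^^ k) (ipow g n x) = ipow g (n - int k) x"
  using ipow_funpow[of g k "n - int k" x] assms isometry_inv_cancel(1)[OF isometry_funpow[OF assms]]
  by (metis diff_add_cancel isometryD(1))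

lemma infdist_isometry: "isometry f \<Longrightarrow> infdist (f x) (f ` A) = infdist x A"
  by (simp add: infdist_def isometryD image_image)

lemma proj_isometry: "isometry f \<Longrightarrow> proj (f ` A) (f x) = f ` proj A x"
  by (auto simp: proj_def infdist_isometry isometryD(2))

lemma pidx_translate:
  assumes f: "isometry f" and p: "\<And>n. f (p n) = p (n + r)"
  shows "n + r \<in> pidx p (f x) \<longleftrightarrow> n \<in> pidx p x"
proof -
  have "f ` range p = range p"
  proof -
    have "p n = f (p (n - r))" for n by (simp add: p)
    then have "range p \<subseteq> f ` range p" by blast
    then show ?thesis using p by auto
  qed
  then have "proj (range p) (f x) = f ` proj (range p) x" using proj_isometry[OF f, of "range p" x] by simp
  moreover have "inj f" using f by (simp add: isometry_def bij_is_inj)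
  ultimately show ?thesis by (simp add: pidx_def p[symmetric] inj_image_mem_iff)
qed

lemma range_reflect: "range (\<lambda>n::int. p (- n)) = range p"
proof -
  have "p n \<in> range (\<lambda>n. p (- n))" for n by (rule range_eqI[of _ _ "- n"]) simp
  then show ?thesis by auto
qed

text \<open>Reversing the orbit exchanges its two ends and replaces a translation by its inverse.
  One nesting lemma thus serves both the future and the past of a gate.\<close>

lemma contracting_orbit_reflect: "contracting_orbit K p \<Longrightarrow> contracting_orbit K (\<lambda>n. p (- n))"
proof -
  have "range (\<lambda>n. p (- n)) = range p" by (rule range_reflect)
  moreover assume "contracting_orbit K p"
  moreover have "quasigeodesic_int K (\<lambda>n. p (- n))" if "quasigeodesic_int K p"
    unfolding quasigeodesic_int_def
  proof (intro allI)
    fix s t :: int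
    have "\<bar>real_of_int (s - t)\<bar> = \<bar>real_of_int (- s - - t)\<bar>" by simp
    then show "\<bar>real_of_int (s - t)\<bar> / K - K \<le> dist (p (- s)) (p (- t)) \<and>
       dist (p (- s)) (p (- t)) \<le> K * \<bar>real_of_int (s - t)\<bar> + K"
      using that unfolding quasigeodesic_int_def by metis
  qed
  ultimately show ?thesis by (simp add: contracting_orbit_def)
qed

lemma pidx_reflect: "n \<in> pidx (\<lambda>n. p (- n)) x \<longleftrightarrow> - n \<in> pidx p x"
proof -
  have "range (\<lambda>n. p (- n)) = range p" by (rule range_reflect)
  then show ?thesis by (simp add: pidx_def)
qed

text \<open>A geodesic that crosses at least \<open>R\<close> orbit points in projection fellow travels with the
  orbit, up to an additive error \<open>C\<close>.\<close>

definition gate_const :: "(int \<Rightarrow> 'x::metric_space) \<Rightarrow> real \<Rightarrow> int \<Rightarrow> bool" where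
  "gate_const p C R \<longleftrightarrow> C \<ge> 0 \<and> R > 0 \<and>
    (\<forall>x y i j k l. i \<in> pidx p x \<longrightarrow> l \<in> pidx p y \<longrightarrow> i \<le> j \<longrightarrow> j \<le> k \<longrightarrow> k \<le> l \<longrightarrow> i + R \<le> l \<longrightarrow>
      dist x (p j) + dist (p j) (p k) + dist (p k) y \<le> dist x y + C)"

lemma gate_constD:
  "gate_const p C R \<Longrightarrow> i \<in> pidx p x \<Longrightarrow> l \<in> pidx p y \<Longrightarrow> i \<le> j \<Longrightarrow> j \<le> k \<Longrightarrow> k \<le> l \<Longrightarrow> i + R \<le> l \<Longrightarrow>
      dist x (p j) + dist (p j) (p k) + dist (p k) y \<le> dist x y + C"
  unfolding gate_const_def by blast

lemma gate_const_reflect: 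
  assumes g: "gate_const p C R" shows "gate_const (\<lambda>n. p (- n)) C R"
  unfolding gate_const_def
proof (intro conjI allI impI)
  fix x y i j k l
  assume "i \<in> pidx (\<lambda>n. p (- n)) x" "l \<in> pidx (\<lambda>n. p (- n)) y" "i \<le> j" "j \<le> k" "k \<le> l" "i + R \<le> l"
  then have "dist y (p (- k)) + dist (p (- k)) (p (- j)) + dist (p (- j)) x \<le> dist y x + C"
    using gate_constD[OF g, of "- l" y "- i" x "- k" "- j"] by (simp add: pidx_reflect)
  then show "dist x (p (- j)) + dist (p (- j)) (p (- k)) + dist (p (- k)) y \<le> dist x y + C"
    by (simp add: dist_commute)
qed (use g in \<open>auto simp: gate_const_def\<close>)

section \<open>Points near the two ends of an axis, and long gates\<close>

definition left_end :: "(int \<Rightarrow> 'x::metric_space) \<Rightarrow> int \<Rightarrow> 'x set" where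
  "left_end p L = {x. \<exists>n\<in>pidx p x. n \<le> - L}"

definition right_end :: "(int \<Rightarrow> 'x::metric_space) \<Rightarrow> int \<Rightarrow> 'x set" where
  "right_end p L = {x. \<exists>n\<in>pidx p x. L \<le> n}"

lemma left_end_reflect: "left_end (\<lambda>n. p (- n)) L = right_end p L"
proof -
  have "(\<exists>n. - n \<in> pidx p x \<and> n \<le> - L) \<longleftrightarrow> (\<exists>n. n \<in> pidx p x \<and> L \<le> n)" for x
  proof
    assume "\<exists>n. - n \<in> pidx p x \<and> n \<le> - L"
    then obtain n where "- n \<in> pidx p x" "n \<le> - L" by blast
    then show "\<exists>n. n \<in> pidx p x \<and> L \<le> n" by (intro exI[of _ "- n"]) auto
  next
    assume "\<exists>n. n \<in> pidx p x \<and> L \<le> n"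
    then obtain n where "n \<in> pidx p x" "L \<le> n" by blast
    then show "\<exists>n. - n \<in> pidx p x \<and> n \<le> - L" by (intro exI[of _ "- n"]) auto
  qed
  then show ?thesis by (simp add: left_end_def right_end_def pidx_reflect Bex_def)
qed

lemma right_end_reflect: "right_end (\<lambda>n. p (- n)) L = left_end p L"
  using left_end_reflect[of "\<lambda>n. p (- n)" L] by simp

lemma not_left_end: "contracting_orbit K p \<Longrightarrow> x \<notin> left_end p L \<Longrightarrow> \<exists>n\<in>pidx p x. - L < n"
  by (auto simp: left_end_def not_le dest!: pidx_ne[of K p x])

lemma not_right_end: "contracting_orbit K p \<Longrightarrow> x \<notin> right_end p L \<Longrightarrow> \<exists>n\<in>pidx p x. n < L"
  by (auto simp: right_end_def not_le dest!: pidx_ne[of K p x])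

text \<open>Applying \<open>F\<close> moves the index of \<open>y\<close> by \<open>r\<close>, so
  the way from \<open>x\<close> to \<open>F y\<close> crosses the stretch from \<open>p L1\<close>
  to \<open>p (r - L1)\<close>. Its length pays for the error \<open>C\<close>, for replacing orbit
  points by \<open>c\<close> and \<open>c'\<close>, and for the additional 1.\<close>

lemma gate_far:
  assumes p: "contracting_orbit K p" and g: "gate_const p C R"
    and F: "isometry F" "\<And>n. F (p n) = p (n + r)"
    and x: "x \<notin> right_end p L1" and y: "y \<notin> left_end p L1"
    and r: "2 * L1 + R \<le> r" and c: "dist (p 0) c \<le> E" "dist (p 0) c' \<le> E"
    and E': "dist (p 0) (p L1) \<le> E'" "dist (p 0) (p (- L1)) \<le> E'" 
    and big: "dist (p L1) (p (r - L1)) \<ge> C + 2 * E + 2 * E' + 1"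
  shows "dist x c + dist c' y + 1 \<le> dist x (F y)"
proof -
  have "R > 0" using g by (simp add: gate_const_def)
  obtain i l where il: "i \<in> pidx p x" "i < L1" "l \<in> pidx p y" "- L1 < l"
    using not_right_end[OF p x] not_left_end[OF p y] by blast
  then have "l + r \<in> pidx p (F y)" using pidx_translate[of F p r] F by blast
  then have 1: "dist x (p L1) + dist (p L1) (p (r - L1)) + dist (p (r - L1)) (F y) \<le> dist x (F y) + C"
    by (intro gate_constD[OF g il(1)]) (use il r \<open>R > 0\<close> in auto)
  have "dist (p (r - L1)) (F y) = dist (p (- L1)) y"
    using F(2)[of "- L1"] isometryD(2)[OF F(1), of "p (- L1)" y] by (simp add: add.commute)
  moreover have "dist c' y \<le> dist (p 0) c' + dist (p 0) (p (- L1)) + dist (p (- L1)) y"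
    "dist x c \<le> dist x (p L1) + dist (p 0) (p L1) + dist (p 0) c"
    by (smt (verit) dist_commute dist_triangle)+
  ultimately show ?thesis using 1 c E' big by linarith
qed

text \<open>Compare two estimates of the distance from \<open>e\<close> to
  \<open>z = u (F y)\<close>. Since \<open>z\<close> lies behind the first gate and
  \<open>u (F c)\<close> does not, the distance exceeds \<open>dist y c\<close> by a bounded amount
  at most. If \<open>y\<close> did not lie behind the second gate, the way from
  \<open>inv u e\<close> to \<open>F y\<close> would cross this whole gate, which makes the distance
  too large.\<close>

lemma gate_nested:
  assumes p: "contracting_orbit K p" and g: "gate_const p C R"
    and F: "isometry F" "\<And>n. F (p n) = p (n + r)" and u: "isometry u"
    and c: "dist (p 0) e \<le> E" "dist (p 0) c \<le> E"
    and h1: "u (F c) \<notin> left_end p L0" and h2: "inv u e \<notin> right_end p L0" and h3: "u (F y) \<in> left_end p L1"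
    and L: "0 < L0" "L0 + R \<le> L1" and r: "2 * L1 + R \<le> r"
    and E': "dist (p 0) (p (- L1)) \<le> E'"
    and big: "dist (p L1) (p (r - L1)) \<ge> 2 * C + 2 * E + 2 * E' + 1"
  shows "y \<in> left_end p L1"
proof (rule ccontr)
  assume "y \<notin> left_end p L1"
  then obtain l where l: "l \<in> pidx p y" "- L1 < l" using not_left_end[OF p] by blast
  have "R > 0" using g by (simp add: gate_const_def)
  define z f where "z = u (F y)" and "f = u (F c)"
  obtain n m i where nmi: "n \<in> pidx p z" "n \<le> - L1" "m \<in> pidx p f" "- L0 < m" "i \<in> pidx p (inv u e)" "i < L0"
    using not_left_end[OF p h1] not_right_end[OF p h2] h3 by (auto simp: left_end_def z_def f_def)
  have 1: "dist z (p (- L1)) + dist (p (- L1)) (p (- L1)) + dist (p (- L1)) f \<le> dist z f + C"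
    by (rule gate_constD[OF g nmi(1,3)]) (use nmi L \<open>R > 0\<close> in auto)
  have "l + r \<in> pidx p (F y)" using pidx_translate[of F p r] F l by blast
  then have 2: "dist (inv u e) (p L1) + dist (p L1) (p (r - L1)) + dist (p (r - L1)) (F y) \<le> dist (inv u e) (F y) + C"
    by (intro gate_constD[OF g nmi(5)]) (use nmi l L r \<open>R > 0\<close> in auto)
  have "dist (inv u e) (F y) = dist e z"
    using isometryD(2)[OF u, of "inv u e" "F y"] isometry_inv_cancel(2)[OF u] by (simp add: z_def)
  moreover have "dist (p (r - L1)) (F y) = dist (p (- L1)) y"
    using F(2)[of "- L1"] isometryD(2)[OF F(1), of "p (- L1)" y] by (simp add: add.commute)
  moreover have "dist z f = dist y c" using isometryD(2)[OF u] isometryD(2)[OF F(1)] by (simp add: z_def f_def)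
  moreover have "dist y c \<le> dist (p (- L1)) y + dist (p 0) (p (- L1)) + dist (p 0) c"
    "dist e z \<le> dist z (p (- L1)) + dist (p 0) (p (- L1)) + dist (p 0) e"
    by (smt (verit) dist_commute dist_triangle)+
  ultimately show False using 1 2 c E' big zero_le_dist[of "inv u e" "p L1"] zero_le_dist[of "p (- L1)" f]
    by (simp del: zero_le_dist)
qed

text \<open>All of \<open>p\<close> projects to a bounded part of \<open>q\<close>. If
  \<open>x\<close> projects far out to \<open>p n\<close> but its projection to \<open>q\<close> is
  far from that of \<open>p n\<close>, then the way from \<open>x\<close> to \<open>p n\<close>
  passes near the common base point. The way from \<open>x\<close> to the base point also passes
  near \<open>p n\<close>, so \<open>p n\<close> would be near the base point.\<close>

lemma independent_pidx:
  fixes p q :: "int \<Rightarrow> 'x::metric_space"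
  assumes geo: "geodesic_space TYPE('x)" and p: "contracting_orbit K p" and q: "contracting_orbit K' q"
    and o: "p 0 = q 0"
    and ind: "\<And>M. M > 0 \<Longrightarrow> \<exists>N. \<forall>n m. dist (p n) (q m) < M \<longrightarrow> \<bar>n\<bar> \<le> N \<and> \<bar>m\<bar> \<le> (N::int)"
  obtains D L :: int where "\<And>x n j. n \<in> pidx p x \<Longrightarrow> L \<le> \<bar>n\<bar> \<Longrightarrow> j \<in> pidx q x \<Longrightarrow> \<bar>j\<bar> \<le> D"
proof -
  have K: "K > 0" "K' > 0" using p q by (auto simp: contracting_orbit_def)
  \<comment> \<open>Adding the three detour estimates below gives
    \<open>dist (q j) (p i) \<le> 12 * K + 6 * K'\<close>; independence then bounds
    \<open>j\<close>.\<close>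
  obtain N where N: "\<And>n m. dist (p n) (q m) < 12 * K + 6 * K' + 1 \<Longrightarrow> \<bar>m\<bar> \<le> N"
    using ind[of "12 * K + 6 * K' + 1"] K by auto
  have 1: "\<bar>j\<bar> \<le> N" if j: "j \<in> pidx q (p n)" for j n
  proof -
    obtain i where i: "i \<in> pidx p (q j)" using pidx_ne[OF p] by blast
    have "dist (q j) (p i) + dist (p i) (p 0) \<le> dist (q j) (p 0) + 12 * K"
      "dist (q j) (p i) + dist (p i) (p n) \<le> dist (q j) (p n) + 12 * K"
      using pidx_detour_orbit[OF geo p i] by auto
    moreover have "dist (p n) (q j) + dist (q j) (q 0) \<le> dist (p n) (q 0) + 12 * K'"
      using pidx_detour_orbit[OF geo q j] by auto
    moreover have "dist (p n) (p 0) \<le> dist (p i) (p 0) + dist (p i) (p n)"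
      by (smt (verit) dist_commute dist_triangle)
    ultimately have "2 * dist (q j) (p i) \<le> 24 * K + 12 * K'" using o dist_commute[of "q j" "p n"] by simp
    then show ?thesis using N[of i j] by (simp add: dist_commute)
  qed
  define D1 where "D1 = K' * N + K'"
  \<comment> \<open>An index of size at least \<open>L\<close> is incompatible with
    \<open>dist (p n) (p 0) \<le> 6 * K + 6 * K' + D1\<close>, the estimate obtained if the
    projections to \<open>q\<close> are far apart.\<close>
  define L where "L = \<lceil>K * (6 * K + 6 * K' + D1) + K * K\<rceil> + 1"
  define D where "D = N + \<lceil>K' * (4 * K') + K' * K'\<rceil>"
  have "\<bar>j\<bar> \<le> D" if n: "n \<in> pidx p x" "L \<le> \<bar>n\<bar>" and j: "j \<in> pidx q x" for x n j
  proof -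
    obtain j' where j': "j' \<in> pidx q (p n)" using pidx_ne[OF q] by blast
    have "\<bar>j'\<bar> \<le> N" using 1 j' by blast
    have "K' * \<bar>j' - 0\<bar> \<le> K' * N" using \<open>\<bar>j'\<bar> \<le> N\<close> K by (intro mult_left_mono) auto
    then have D1: "dist (q j') (q 0) \<le> D1"
      using orbit_dist_le[OF q, of j' 0] unfolding D1_def by simp
    have a: "dist x (p n) + dist (p n) (p 0) \<le> dist x (p 0) + 12 * K" by (rule pidx_detour_orbit[OF geo p n(1)])
    have "dist (q j) (q j') \<le> 4 * K'"
    proof (rule ccontr)
      assume "\<not> ?thesis"
      then have "dist x (q j) + dist (q j) (q j') + dist (q j') (p n) \<le> dist x (p n) + 12 * K'"
        using pidx_detour[OF geo q j j'] by simp
      moreover have "dist x (p 0) \<le> dist x (q j) + dist (q j) (q j') + dist (q j') (q 0)"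
        "dist (p n) (p 0) \<le> dist (q j') (p n) + dist (q j') (q 0)"
        unfolding o by (smt (verit) dist_commute dist_triangle)+
      ultimately have "dist (p n) (p 0) \<le> 6 * K + 6 * K' + D1" using a D1 by linarith
      then have "K * dist (p n) (p 0) \<le> K * (6 * K + 6 * K' + D1)" using K by simp
      then have "\<bar>n - 0\<bar> \<le> K * (6 * K + 6 * K' + D1) + K * K" using orbit_idx_le[OF p, of n 0] by linarith
      moreover have "real_of_int L \<le> real_of_int \<bar>n\<bar>" using n(2) by (simp only: of_int_le_iff)
      ultimately show False unfolding L_def by simp linarith
    qed
    then have "K' * dist (q j) (q j') \<le> K' * (4 * K')" using K by simp
    then have "\<bar>j - j'\<bar> \<le> K' * (4 * K') + K' * K'" using orbit_idx_le[OF q, of j j'] by linarith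
    then have "\<bar>j - j'\<bar> \<le> \<lceil>K' * (4 * K') + K' * K'\<rceil>" by linarith
    then show ?thesis using \<open>\<bar>j'\<bar> \<le> N\<close> unfolding D_def by linarith
  qed
  then show thesis using that by blast
qed


text \<open>In the coordinates of the end of the gate \<open>s k\<close>, \<open>Bp k\<close> is the set of points that do not lie
  beyond the gate; in the coordinates of its start, \<open>Bm k\<close> is the set of points that do not lie before it. The larger sets
  \<open>Dp k\<close> and \<open>Dm k\<close> have stricter thresholds, which leaves room for additive errors.\<close>

locale gates =
  fixes x0 :: "'x::metric_space" and N :: nat and s :: "nat \<Rightarrow> 'x \<Rightarrow> 'x"
    and Bp Bm Dp Dm :: "nat \<Rightarrow> 'x set"
  assumes iso: "isometry (s k)"
    and sub: "Bp k \<subseteq> Dp k" "Bm k \<subseteq> Dm k"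
    and uniq_p: "j < N \<Longrightarrow> k < N \<Longrightarrow> x \<in> Dp j \<Longrightarrow> x \<in> Dp k \<Longrightarrow> j = k"
    and uniq_m: "j < N \<Longrightarrow> k < N \<Longrightarrow> x \<in> Dm j \<Longrightarrow> x \<in> Dm k \<Longrightarrow> j = k"
    and nested_p: "j < N \<Longrightarrow> k < N \<Longrightarrow> isometry w \<Longrightarrow> w (s k x0) \<notin> Dp j \<Longrightarrow> inv w x0 \<notin> Dm k \<Longrightarrow>
      w (s k y) \<in> Bp j \<Longrightarrow> y \<in> Bp k"
    and nested_m: "j < N \<Longrightarrow> k < N \<Longrightarrow> isometry w \<Longrightarrow> w x0 \<notin> Dp j \<Longrightarrow> inv w (inv (s j) x0) \<notin> Dm k \<Longrightarrow>
      inv w (inv (s j) x) \<in> Bm k \<Longrightarrow> x \<in> Bm j"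
    and far: "k < N \<Longrightarrow> x \<notin> Bm k \<Longrightarrow> y \<notin> Bp k \<Longrightarrow> dist x x0 + dist x0 y + 1 \<le> dist x (s k y)"

text \<open>The definition of a contracting isometry admits \<open>K = 0\<close>: division by zero
  makes the lower quasigeodesic bound trivial, and the orbit is then constant. Independence from
  another isometry excludes this.\<close>

lemma contracting_orbit_ipow:
  assumes "contracting_isom x0 a" "independent_isom x0 a b \<or> independent_isom x0 b a"
  obtains K where "contracting_orbit K (\<lambda>n. ipow a n x0)"
proof -
  obtain K where K: "quasigeodesic_int K (\<lambda>n. ipow a n x0)" "contracting_set K (range (\<lambda>n. ipow a n x0))"
    using assms(1) unfolding contracting_isom_def by blast
  have "0 \<le> K" using K(1)[unfolded quasigeodesic_int_def, rule_format, of 0 0] by simp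
  moreover have "K \<noteq> 0"
  proof
    assume "K = 0"
    then have const: "dist (ipow a n x0) x0 = 0" for n
      using K(1)[unfolded quasigeodesic_int_def, rule_format, of n 0] by simp
    from assms(2) show False
    proof
      assume "independent_isom x0 a b"
      then obtain N :: int where N: "\<forall>n m. dist (ipow a n x0) (ipow b m x0) < 1 \<longrightarrow> \<bar>n\<bar> \<le> N \<and> \<bar>m\<bar> \<le> N"
        unfolding independent_isom_def by (meson zero_less_one)
      have "\<bar>N + 1\<bar> \<le> N" using const[of "N + 1"] N[rule_format, of "N + 1" 0] by auto
      then show False by linarith
    next
      assume "independent_isom x0 b a"
      then obtain N :: int where N: "\<forall>n m. dist (ipow b n x0) (ipow a m x0) < 1 \<longrightarrow> \<bar>n\<bar> \<le> N \<and> \<bar>m\<bar> \<le> N"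
        unfolding independent_isom_def by (meson zero_less_one)
      have "\<bar>N + 1\<bar> \<le> N" using const[of "N + 1"] N[rule_format, of 0 "N + 1"] by auto
      then show False by linarith
    qed
  qed
  ultimately have "0 < K" by simp
  then show thesis using that K unfolding contracting_orbit_def by blast
qed

text \<open>All gates run along translates of the axis of \<open>a\<close> by distinct powers of \<open>b\<close>. The exponents of
  \<open>b\<close> before and after add up to a constant, so that the words for all \<open>s k\<close> have equal length.\<close>
lemma gates_exist:
  fixes x0 :: "'x::metric_space"
  assumes geo: "geodesic_space TYPE('x)" and a: "isometry a" "contracting_isom x0 a"
    and b: "isometry b" "contracting_isom x0 b" and ind: "independent_isom x0 a b"
  obtains m r :: nat and Bp Bm Dp Dm
  where "0 < r" "gates x0 N (\<lambda>k. (b ^^ (m * Suc k)) \<circ> (a ^^ r) \<circ> (b ^^ (m * (N - k)))) Bp Bm Dp Dm"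
proof -
  define p q where "p n = ipow a n x0" and "q n = ipow b n x0" for n
  have bij: "bij a" "bij b" using a b by (auto simp: isometry_def)
  obtain K K' where p: "contracting_orbit K p" and q: "contracting_orbit K' q"
    using contracting_orbit_ipow[OF a(2)] contracting_orbit_ipow[OF b(2)] ind
    unfolding p_def[abs_def] q_def[abs_def] by metis
  have K: "K > 0" "K' > 0" using p q by (auto simp: contracting_orbit_def)
  have pq0: "p 0 = x0" "q 0 = x0" by (auto simp: p_def q_def)
  obtain D L where DL: "\<And>x n j. n \<in> pidx p x \<Longrightarrow> L \<le> \<bar>n\<bar> \<Longrightarrow> j \<in> pidx q x \<Longrightarrow> \<bar>j\<bar> \<le> D"
  proof (rule independent_pidx[OF geo p q])
    show "\<exists>N. \<forall>n m. dist (p n) (q m) < M \<longrightarrow> \<bar>n\<bar> \<le> N \<and> \<bar>m\<bar> \<le> N" if "M > 0" for M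
      using ind that unfolding independent_isom_def p_def q_def by blast
  qed (auto simp: pq0)
  obtain C R where CR: "gate_const p C R"
    using pidx_gate[OF geo p] unfolding gate_const_def by metis
  have R: "R > 0" and C: "C \<ge> 0" using CR by (auto simp: gate_const_def)
  \<comment> \<open>The gap \<open>R\<close> between the two thresholds is the room that
    \<open>gate_const\<close> requires between a point in the smaller set and a point outside the
    larger one.\<close>
  define L0 L1 where "L0 = max 1 L" and "L1 = L0 + R"
  \<comment> \<open>A point near an end of the \<open>a\<close>-axis has \<open>b\<close>-index in
    \<open>[- D, D]\<close>. Distinct multiples of \<open>m\<close> differ by more than
    \<open>2 * D\<close>, so no index falls into this interval for two different gates.\<close>
  define m where "m = nat (2 * D + 1)"
  \<comment> \<open>\<open>E\<close> bounds the displacement of the base point by the powers of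
    \<open>b\<close> in a gate, \<open>E'\<close> the distance from the base point to the thresholds
    at \<open>L1\<close> and \<open>- L1\<close>.\<close>
  define E where "E = K' * real (m * (N + 1)) + K'"
  define E' where "E' = K * L1 + K"
  define big where "big = 2 * C + 2 * E + 2 * E' + 1"
  \<comment> \<open>The power of \<open>a\<close> is chosen last: the stretch between the thresholds
    must outweigh all the errors collected in \<open>big\<close>.\<close>
  define r where "r = nat (2 * L1 + R + \<lceil>K * big + K * K\<rceil>)"
  have L: "0 < L0" "L0 + R \<le> L1" "L \<le> L0" "0 < L1" using R by (auto simp: L0_def L1_def)
  have E: "E \<ge> 0" "E' \<ge> 0" using K L by (auto simp: E_def E'_def)
  have big0: "big \<ge> 0" using C E by (auto simp: big_def)
  have "0 \<le> \<lceil>K * big + K * K\<rceil>" using mult_nonneg_nonneg[OF less_imp_le[OF K(1)] big0] zero_le_square[of K] by linarith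
  then have r1: "2 * L1 + R \<le> int r" and r2: "K * big + K * K \<le> real_of_int (int r - 2 * L1)"
    using L R unfolding r_def by (auto simp del: of_int_mult; linarith)+
  have E'1: "dist (p 0) (p L1) \<le> E'" "dist (p 0) (p (- L1)) \<le> E'"
    using orbit_dist_le[OF p, of 0 L1] orbit_dist_le[OF p, of 0 "- L1"] L by (auto simp: E'_def)
  have far: "big \<le> dist (p L1) (p (int r - L1))" "big \<le> dist (p (- L1)) (p (- (int r - L1)))"
  proof -
    have "real_of_int (int r - 2 * L1) \<le> \<bar>real_of_int (L1 - (int r - L1))\<bar>"
      "real_of_int (int r - 2 * L1) \<le> \<bar>real_of_int (- L1 - - (int r - L1))\<bar>" by (simp_all)
    then have "K * big \<le> K * dist (p L1) (p (int r - L1))" "K * big \<le> K * dist (p (- L1)) (p (- (int r - L1)))"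
      using r2 orbit_idx_le[OF p, of L1 "int r - L1"] orbit_idx_le[OF p, of "- L1" "- (int r - L1)"] by auto
    then show "big \<le> dist (p L1) (p (int r - L1))" "big \<le> dist (p (- L1)) (p (- (int r - L1)))" using K by auto
  qed
  have isob: "isometry (b ^^ e)" and isoa: "isometry (a ^^ e)" for e using a b by (auto intro: isometry_funpow)
  have bE: "dist (p 0) ((b ^^ e) x0) \<le> E" "dist (p 0) (inv (b ^^ e) x0) \<le> E" if "e \<le> m * (N + 1)" for e
  proof -
    have "(b ^^ e) x0 = q e" "inv (b ^^ e) x0 = q (- int e)"
      using ipow_funpow[OF bij(2), of e 0 x0] inv_funpow_ipow[OF b(1), of e 0 x0] by (auto simp: q_def)
    moreover have "K' * e \<le> K' * real (m * (N + 1))" using that K by (intro mult_left_mono) (auto simp del: of_nat_mult of_nat_add)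
    ultimately show "dist (p 0) ((b ^^ e) x0) \<le> E" "dist (p 0) (inv (b ^^ e) x0) \<le> E"
      using orbit_dist_le[OF q, of 0 "int e"] orbit_dist_le[OF q, of 0 "- int e"] pq0 by (auto simp: E_def)
  qed
  have Fa: "(a ^^ r) (p n) = p (n + int r)" for n using ipow_funpow[OF bij(1)] by (simp add: p_def)
  have Fa': "inv (a ^^ r) (p (- n)) = p (- (n + int r))" for n using inv_funpow_ipow[OF a(1), of r "- n" x0] by (simp add: p_def)
  have Fb: "(b ^^ e) (q n) = q (n + int e)" for n e using ipow_funpow[OF bij(2)] by (simp add: q_def)
  have tr: "n + int i \<in> pidx q ((b ^^ i) x) \<longleftrightarrow> n \<in> pidx q x" for n i x
    by (intro pidx_translate isob Fb)
  define e e' where "e k = m * Suc k" and "e' k = m * (N - k)" for k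
  have e_le: "e k \<le> m * (N + 1)" "e' k \<le> m * (N + 1)" if "k < N" for k
    using that by (auto simp: e_def e'_def simp del: mult_Suc_right)
  define s where "s k = (b ^^ e k) \<circ> (a ^^ r) \<circ> (b ^^ e' k)" for k
  have s: "s k x = (b ^^ e k) ((a ^^ r) ((b ^^ e' k) x))" for k x by (simp add: s_def)
  have isos: "isometry (s k)" for k unfolding s_def by (intro isometry_comp isoa isob)
  have invs: "inv (s k) x = inv (b ^^ e' k) (inv (a ^^ r) (inv (b ^^ e k) x))" for k x
    using isometryD(1)[OF isos, of k] isometry_inv_cancel[OF isoa] isometry_inv_cancel[OF isob]
    by (intro inv_f_eq) (auto simp: bij_is_inj s)
  \<comment> \<open>\<open>b ^^ e' k\<close> carries the coordinates at the end of the gate to those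
    of the \<open>a\<close>-axis, and \<open>inv (b ^^ e k)\<close> does the same for the
    coordinates at its start.\<close>
  define Dp where "Dp k = {x. (b ^^ e' k) x \<in> left_end p L0}" for k
  define Bp where "Bp k = {x. (b ^^ e' k) x \<in> left_end p L1}" for k
  define Dm where "Dm k = {x. inv (b ^^ e k) x \<in> right_end p L0}" for k
  define Bm where "Bm k = {x. inv (b ^^ e k) x \<in> right_end p L1}" for k
  have near: "\<bar>j\<bar> \<le> D" if "x \<in> left_end p L0 \<or> x \<in> right_end p L0" "j \<in> pidx q x" for x j
    using that DL[of _ x j] L unfolding left_end_def right_end_def by fastforce
  have m: "int m > 2 * D" unfolding m_def by linarith
  have mult_eq: "j = k" if "\<bar>int m * (int j - int k)\<bar> \<le> 2 * D" for j k
  proof (rule ccontr)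
    assume "j \<noteq> k"
    then have "int m * 1 \<le> int m * \<bar>int j - int k\<bar>" by (intro mult_left_mono) auto
    then show False using that m by (simp add: abs_mult)
  qed
  have left: "left_end p L1 \<subseteq> left_end p L0"
    using L(2) R unfolding left_end_def by (auto 0 3 intro: order.trans[of _ "- L1" "- L0"])
  have right: "right_end p L1 \<subseteq> right_end p L0"
    using L(2) R unfolding right_end_def by (auto 0 3 intro: order.trans[of "L0" "L1"])
  have "gates x0 N s Bp Bm Dp Dm"
  proof
    show "isometry (s k)" for k by (rule isos)
    show "Bp k \<subseteq> Dp k" "Bm k \<subseteq> Dm k" for k
      using left right by (auto simp: Bp_def Dp_def Bm_def Dm_def)
  next
    fix j k x assume jk: "j < N" "k < N" "x \<in> Dp j" "x \<in> Dp k"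
    obtain n where n: "n \<in> pidx q x" using pidx_ne[OF q] by blast
    have "\<bar>n + int (e' j)\<bar> \<le> D" "\<bar>n + int (e' k)\<bar> \<le> D"
      using near[of _ "n + int (e' j)"] near[of _ "n + int (e' k)"] n jk(3,4) tr unfolding Dp_def by blast+
    then have "\<bar>int (e' j) - int (e' k)\<bar> \<le> 2 * D" by linarith
    then show "j = k" using mult_eq[of j k] jk(1,2)
      by (simp add: e'_def of_nat_diff algebra_simps)
  next
    fix j k x assume jk: "j < N" "k < N" "x \<in> Dm j" "x \<in> Dm k"
    obtain n where n: "n \<in> pidx q x" using pidx_ne[OF q] by blast
    have "n - int i \<in> pidx q (inv (b ^^ i) x)" for i
      using n tr[of "n - int i" i "inv (b ^^ i) x"] isometry_inv_cancel[OF isob] by simp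
    then have "\<bar>n - int (e j)\<bar> \<le> D" "\<bar>n - int (e k)\<bar> \<le> D"
      using near jk(3,4) by (auto simp: Dm_def)
    then have "\<bar>int (e j) - int (e k)\<bar> \<le> 2 * D" by linarith
    then show "j = k" using mult_eq[of j k]
      by (simp add: e_def algebra_simps)
  next
    fix j k w y assume *: "j < N" "k < N" "isometry w" "w (s k x0) \<notin> Dp j" "inv w x0 \<notin> Dm k" "w (s k y) \<in> Bp j"
    \<comment> \<open>The transition \<open>w\<close> between two gates, rewritten as a transition
      between their \<open>a\<close>-axes by absorbing the adjacent powers of
      \<open>b\<close>.\<close>
    define u where "u = (b ^^ e' j) \<circ> w \<circ> (b ^^ e k)"
    have u: "isometry u" unfolding u_def by (intro isometry_comp isob *)
    have "inv u ((b ^^ e' j) x0) = inv (b ^^ e k) (inv w x0)"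
      using isometryD(1)[OF u] isometry_inv_cancel[OF isob] isometry_inv_cancel[OF *(3)]
      by (intro inv_f_eq) (auto simp: bij_is_inj u_def)
    then have h2: "inv u ((b ^^ e' j) x0) \<notin> right_end p L0" using *(5) by (simp add: Dm_def)
    have h1: "u ((a ^^ r) ((b ^^ e' k) x0)) \<notin> left_end p L0" using *(4) by (simp add: Dp_def u_def s)
    have h3: "u ((a ^^ r) ((b ^^ e' k) y)) \<in> left_end p L1" using *(6) by (simp add: Bp_def u_def s)
    have "(b ^^ e' k) y \<in> left_end p L1"
      by (rule gate_nested[OF p CR isoa Fa u bE(1)[OF e_le(2)[OF *(1)]] bE(1)[OF e_le(2)[OF *(2)]] h1 h2 h3
            L(1,2) r1 E'1(2) far(1)[unfolded big_def]])
    then show "y \<in> Bp k" by (simp add: Bp_def)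
  next
    fix j k w x assume *: "j < N" "k < N" "isometry w" "w x0 \<notin> Dp j" "inv w (inv (s j) x0) \<notin> Dm k"
      "inv w (inv (s j) x) \<in> Bm k"
    \<comment> \<open>The inverse transition. On the reversed orbit \<open>inv (a ^^ r)\<close> is
      again a forward translation, so the same nesting lemma applies.\<close>
    define u where "u = inv (b ^^ e k) \<circ> inv w \<circ> inv (b ^^ e' j)"
    have u: "isometry u" unfolding u_def by (intro isometry_comp isometry_inv isob *)
    have "inv u (inv (b ^^ e k) x0) = (b ^^ e' j) (w x0)"
      using isometryD(1)[OF u] isometry_inv_cancel[OF isob] isometry_inv_cancel[OF *(3)]
      by (intro inv_f_eq) (auto simp: bij_is_inj u_def)
    then have h2: "inv u (inv (b ^^ e k) x0) \<notin> right_end (\<lambda>n. p (- n)) L0"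
      using *(4) by (simp add: Dp_def right_end_reflect)
    have h1: "u (inv (a ^^ r) (inv (b ^^ e j) x0)) \<notin> left_end (\<lambda>n. p (- n)) L0"
      using *(5) by (simp add: Dm_def u_def invs left_end_reflect)
    have h3: "u (inv (a ^^ r) (inv (b ^^ e j) x)) \<in> left_end (\<lambda>n. p (- n)) L1"
      using *(6) by (simp add: Bm_def u_def invs left_end_reflect)
    have E0: "dist (p (- 0)) (inv (b ^^ e k) x0) \<le> E" "dist (p (- 0)) (inv (b ^^ e j) x0) \<le> E"
      using bE(2)[OF e_le(1)] *(1,2) by auto
    have E'2: "dist (p (- 0)) (p (- (- L1))) \<le> E'" using E'1(1) by simp
    have "inv (b ^^ e j) x \<in> left_end (\<lambda>n. p (- n)) L1"
      by (rule gate_nested[OF contracting_orbit_reflect[OF p] gate_const_reflect[OF CR] isometry_inv[OF isoa] Fa' u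
            E0 h1 h2 h3 L(1,2) r1 E'2 far(2)[unfolded big_def]])
    then show "x \<in> Bm j" by (simp add: Bm_def left_end_reflect)
  next
    fix k x y assume *: "k < N" "x \<notin> Bm k" "y \<notin> Bp k"
    have h: "inv (b ^^ e k) x \<notin> right_end p L1" "(b ^^ e' k) y \<notin> left_end p L1" using *(2,3) by (auto simp: Bm_def Bp_def)
    have big: "C + 2 * E + 2 * E' + 1 \<le> dist (p L1) (p (int r - L1))" using far(1) C by (simp add: big_def)
    have "dist (inv (b ^^ e k) x) (inv (b ^^ e k) x0) + dist ((b ^^ e' k) x0) ((b ^^ e' k) y) + 1
        \<le> dist (inv (b ^^ e k) x) ((a ^^ r) ((b ^^ e' k) y))"
      by (rule gate_far[OF p CR isoa Fa h r1 bE(2)[OF e_le(1)[OF *(1)]] bE(1)[OF e_le(2)[OF *(1)]] E'1 big])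
    also have "\<dots> = dist x (s k y)"
      using isometryD(2)[OF isob, of "e k" "inv (b ^^ e k) x"] isometry_inv_cancel(2)[OF isob] by (simp add: s)
    finally show "dist x x0 + dist x0 y + 1 \<le> dist x (s k y)"
      using isometryD(2)[OF isob] isometryD(2)[OF isometry_inv[OF isob]] by simp
  qed
  moreover have "0 < r" using r1 L R by linarith
  ultimately show thesis using that unfolding s_def e_def e'_def by blast
qed

section \<open>Hitting probabilities\<close>

text \<open>A letter \<open>Inl k\<close> is a gate, a letter \<open>Inr b\<close> an ordinary step.\<close>
definition letter_pmf :: "real \<Rightarrow> nat \<Rightarrow> 'b pmf \<Rightarrow> (nat + 'b) pmf" where
  "letter_pmf \<eta> N \<nu> = bind_pmf (bernoulli_pmf \<eta>)
     (\<lambda>f. if f then map_pmf Inl (pmf_of_set {..<N}) else map_pmf Inr \<nu>)"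

text \<open>Only times followed by a gate letter are tested. An immediate hit then always comes
  together with a fresh uniform gate, while ordinary letters do not add to the sum of the hitting
  probabilities.\<close>

primrec hits :: "(nat + 'b \<Rightarrow> 'x \<Rightarrow> 'x) \<Rightarrow> 'x \<Rightarrow> nat \<Rightarrow> 'x set \<Rightarrow> ('x \<Rightarrow> 'x) \<Rightarrow> (nat \<Rightarrow> nat + 'b) \<Rightarrow> bool" where
  "hits act x0 0 R w \<xi> \<longleftrightarrow> False"
| "hits act x0 (Suc n) R w \<xi> \<longleftrightarrow> (isl (\<xi> 0) \<and> w x0 \<in> R) \<or> hits act x0 n R (w \<circ> act (\<xi> 0)) (\<lambda>i. \<xi> (Suc i))"

text \<open>The decomposition by the first letter, taken as a definition: the estimates then need
  only finite sums and one expectation. \<open>emeasure_hits\<close> identifies it with the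
  probability of \<open>hits\<close>.\<close>

primrec hit_prob :: "(nat + 'b \<Rightarrow> 'x \<Rightarrow> 'x) \<Rightarrow> 'x \<Rightarrow> real \<Rightarrow> nat \<Rightarrow> 'b pmf \<Rightarrow> nat \<Rightarrow> 'x set \<Rightarrow> ('x \<Rightarrow> 'x) \<Rightarrow> real" where
  "hit_prob act x0 \<eta> N \<nu> 0 R w = 0"
| "hit_prob act x0 \<eta> N \<nu> (Suc n) R w =
     \<eta> * ((\<Sum>k<N. if w x0 \<in> R then 1 else hit_prob act x0 \<eta> N \<nu> n R (w \<circ> act (Inl k))) / N) +
     (1 - \<eta>) * measure_pmf.expectation \<nu> (\<lambda>b. hit_prob act x0 \<eta> N \<nu> n R (w \<circ> act (Inr b)))"

lemma expectation_sum_mult_le: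
  fixes f :: "'j \<Rightarrow> 'a \<Rightarrow> real" and g :: "'a \<Rightarrow> real"
  assumes "\<And>j b. j \<in> J \<Longrightarrow> \<bar>f j b\<bar> \<le> 1" "\<And>b. \<bar>g b\<bar> \<le> 1" "\<And>b. b \<in> set_pmf p \<Longrightarrow> (\<Sum>j\<in>J. f j b) \<le> c * g b"
  shows "(\<Sum>j\<in>J. measure_pmf.expectation p (f j)) \<le> c * measure_pmf.expectation p g"
proof -
  have i: "integrable (measure_pmf p) h" if "\<And>b. \<bar>h b\<bar> \<le> 1" for h :: "'a \<Rightarrow> real"
    using that by (intro measure_pmf.integrable_const_bound[of _ 1]) auto
  have "(\<Sum>j\<in>J. measure_pmf.expectation p (f j)) = measure_pmf.expectation p (\<lambda>b. \<Sum>j\<in>J. f j b)"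
    using assms(1) by (intro Bochner_Integration.integral_sum[symmetric] i)
  also have "\<dots> \<le> measure_pmf.expectation p (\<lambda>b. c * g b)"
    using assms by (intro integral_mono_AE Bochner_Integration.integrable_sum integrable_mult_right i)
      (auto simp: AE_measure_pmf_iff)
  finally show ?thesis by simp
qed

text \<open>The data are abstract because they are instantiated twice, with the walk and with the
  reversed walk of inverse letters. \<open>Q j w k\<close> expresses that the gate \<open>k\<close>,
  applied after \<open>w\<close>, is aligned with the gate \<open>j\<close>. The bound on
  \<open>N\<close> ensures \<open>3 + 16 / N \<le> 4\<close>.\<close>

locale hitting =
  fixes act :: "nat + 'b \<Rightarrow> 'x \<Rightarrow> 'x" and x0 :: 'x and \<eta> :: real and N :: nat and \<nu> :: "'b pmf"
    and B :: "nat \<Rightarrow> 'x set" and Q :: "nat \<Rightarrow> ('x \<Rightarrow> 'x) \<Rightarrow> nat \<Rightarrow> bool" and W :: "('x \<Rightarrow> 'x) set"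
  assumes \<eta>: "0 \<le> \<eta>" "\<eta> \<le> 1" and N: "16 \<le> N"
    and W_id: "id \<in> W" and W_act: "w \<in> W \<Longrightarrow> w \<circ> act l \<in> W"
    and B_card: "card {j. j < N \<and> x \<in> B j} \<le> 1"
    and Q_card: "w \<in> W \<Longrightarrow> card {(j, k). j < N \<and> k < N \<and> \<not> Q j w k} \<le> 2 * N"
    and Q_nested: "j < N \<Longrightarrow> k < N \<Longrightarrow> w \<in> W \<Longrightarrow> Q j w k \<Longrightarrow> w (act (Inl k) y) \<in> B j \<Longrightarrow> y \<in> B k"
begin

abbreviation "\<phi> \<equiv> hit_prob act x0 \<eta> N \<nu>"

text \<open>The hitting probability conditioned on the first letter being a gate.\<close>

definition \<psi> :: "nat \<Rightarrow> 'x set \<Rightarrow> ('x \<Rightarrow> 'x) \<Rightarrow> real" where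
  "\<psi> n R w = (\<Sum>k<N. if w x0 \<in> R then 1 else \<phi> n R (w \<circ> act (Inl k))) / N"

lemma \<phi>_Suc: "\<phi> (Suc n) R w = \<eta> * \<psi> n R w + (1 - \<eta>) * measure_pmf.expectation \<nu> (\<lambda>b. \<phi> n R (w \<circ> act (Inr b)))"
  by (simp add: \<psi>_def)

declare hit_prob.simps(2) [simp del]

lemma \<psi>_bounds: "(\<And>w. 0 \<le> \<phi> n R w \<and> \<phi> n R w \<le> 1) \<Longrightarrow> 0 \<le> \<psi> n R w \<and> \<psi> n R w \<le> 1"
  unfolding \<psi>_def using N
    sum_mono[of "{..<N}" "\<lambda>k. if w x0 \<in> R then 1 else \<phi> n R (w \<circ> act (Inl k))" "\<lambda>_. 1"]
  by (auto intro!: divide_nonneg_nonneg sum_nonneg simp: divide_le_eq)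

lemma \<phi>_bounds: "0 \<le> \<phi> n R w" "\<phi> n R w \<le> 1"
proof -
  have "0 \<le> \<phi> n R w \<and> \<phi> n R w \<le> 1"
  proof (induction n arbitrary: w)
    case (Suc n)
    have "\<bar>\<phi> n R (w \<circ> act (Inr b))\<bar> \<le> 1" for b using Suc by auto
    then have "integrable (measure_pmf \<nu>) (\<lambda>b. \<phi> n R (w \<circ> act (Inr b)))"
      by (intro measure_pmf.integrable_const_bound[of _ 1]) auto
    then have "measure_pmf.expectation \<nu> (\<lambda>b. \<phi> n R (w \<circ> act (Inr b))) \<le> 1"
      using Suc by (intro measure_pmf.integral_le_const) auto
    moreover have "0 \<le> measure_pmf.expectation \<nu> (\<lambda>b. \<phi> n R (w \<circ> act (Inr b)))"
      using Suc by (intro integral_nonneg_AE) auto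
    moreover have "0 \<le> \<psi> n R w \<and> \<psi> n R w \<le> 1" using Suc by (intro \<psi>_bounds) auto
    ultimately show ?case unfolding \<phi>_Suc using \<eta> by (auto intro!: add_nonneg_nonneg convex_bound_le)
  qed simp
  then show "0 \<le> \<phi> n R w" "\<phi> n R w \<le> 1" by auto
qed

text \<open>Strong Markov property: to reach \<open>B j\<close> the walk first has to reach \<open>R\<close>, and from there on
  it starts afresh.\<close>
lemma \<phi>_sum_le_mult:
  assumes \<psi>: "\<And>m w. m < n \<Longrightarrow> w \<in> W \<Longrightarrow> (\<Sum>j<N. \<psi> m (B j) w) \<le> 4"
    and "v \<in> W" and J: "J \<subseteq> {..<N}" and "\<And>j y. j \<in> J \<Longrightarrow> v y \<in> B j \<Longrightarrow> u y \<in> R"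
  shows "(\<Sum>j\<in>J. \<phi> n (B j) v) \<le> 4 * \<phi> n R u"
  using assms
proof (induction n arbitrary: u v)
  case (Suc n)
  have IH: "(\<Sum>j\<in>J. \<phi> n (B j) (v \<circ> act l)) \<le> 4 * \<phi> n R (u \<circ> act l)" for l
    using Suc.prems by (intro Suc.IH W_act) auto
  have 1: "(\<Sum>j\<in>J. \<psi> n (B j) v) \<le> 4 * \<psi> n R u"
  \<comment> \<open>The moment of the first entrance to \<open>R\<close>: here
    \<open>\<psi> n R u = 1\<close>, and the hypothesis bounds everything that follows by 4.\<close>
  proof (cases "u x0 \<in> R")
    case True
    have "(\<Sum>j\<in>J. \<psi> n (B j) v) \<le> (\<Sum>j<N. \<psi> n (B j) v)"
      using J \<psi>_bounds[OF conjI] \<phi>_bounds by (intro sum_mono2) auto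
    also have "\<dots> \<le> 4" using Suc.prems by simp
    also have "4 = 4 * \<psi> n R u" using True N by (simp add: \<psi>_def)
    finally show ?thesis .
  next
    case False
    then have "v x0 \<notin> B j" if "j \<in> J" for j using Suc.prems(4) that by blast
    then have "(\<Sum>j\<in>J. \<psi> n (B j) v) = (\<Sum>j\<in>J. (\<Sum>k<N. \<phi> n (B j) (v \<circ> act (Inl k))) / N)"
      by (simp add: \<psi>_def)
    also have "\<dots> = (\<Sum>k<N. \<Sum>j\<in>J. \<phi> n (B j) (v \<circ> act (Inl k))) / N"
      by (subst sum.swap) (simp add: sum_divide_distrib)
    also have "\<dots> \<le> (\<Sum>k<N. 4 * \<phi> n R (u \<circ> act (Inl k))) / N"
      by (intro divide_right_mono sum_mono IH) auto
    also have "\<dots> = 4 * \<psi> n R u" using False by (simp add: \<psi>_def sum_distrib_left)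
    finally show ?thesis .
  qed
  have 2: "(\<Sum>j\<in>J. measure_pmf.expectation \<nu> (\<lambda>b. \<phi> n (B j) (v \<circ> act (Inr b))))
      \<le> 4 * measure_pmf.expectation \<nu> (\<lambda>b. \<phi> n R (u \<circ> act (Inr b)))"
    using IH \<phi>_bounds by (intro expectation_sum_mult_le) auto
  have "(\<Sum>j\<in>J. \<phi> (Suc n) (B j) v) = \<eta> * (\<Sum>j\<in>J. \<psi> n (B j) v) +
      (1 - \<eta>) * (\<Sum>j\<in>J. measure_pmf.expectation \<nu> (\<lambda>b. \<phi> n (B j) (v \<circ> act (Inr b))))"
    by (simp add: \<phi>_Suc sum.distrib sum_distrib_left)
  also have "\<dots> \<le> \<eta> * (4 * \<psi> n R u) + (1 - \<eta>) * (4 * measure_pmf.expectation \<nu> (\<lambda>b. \<phi> n R (u \<circ> act (Inr b))))"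
    using 1 2 \<eta> by (intro add_mono mult_left_mono) auto
  also have "\<dots> = 4 * \<phi> (Suc n) R u" by (simp add: \<phi>_Suc algebra_simps)
  finally show ?case .
qed simp

text \<open>The sum runs over \<open>N * N\<close> pairs of a target \<open>j\<close> and a first
  gate \<open>k\<close>. Immediate hits account for at most \<open>N\<close> pairs and misaligned
  pairs for at most \<open>2 * N\<close>. An aligned pair requires the walk after gate
  \<open>k\<close> to reach \<open>B k\<close>; by the Markov estimate these contribute at most 4
  times a sum that is itself at most 4. Dividing by \<open>N\<close> gives
  \<open>3 + 16 / N\<close>.\<close>

lemma \<psi>_sum_le:
  assumes \<psi>: "\<And>m w. m < n \<Longrightarrow> w \<in> W \<Longrightarrow> (\<Sum>j<N. \<psi> m (B j) w) \<le> 4"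
    and \<phi>: "\<And>w. w \<in> W \<Longrightarrow> (\<Sum>j<N. \<phi> n (B j) w) \<le> 4" and w: "w \<in> W"
  shows "(\<Sum>j<N. \<psi> n (B j) w) \<le> 4"
proof -
  let ?f = "\<lambda>j k. if w x0 \<in> B j then 1 else \<phi> n (B j) (w \<circ> act (Inl k))"
  have split: "?f j k \<le> of_bool (w x0 \<in> B j) + of_bool (\<not> Q j w k) + (if Q j w k then \<phi> n (B j) (w \<circ> act (Inl k)) else 0)" for j k
    using \<phi>_bounds by auto
  \<comment> \<open>By alignment, every visit to some \<open>B j\<close> is a visit of the walk
    started at \<open>id\<close>, just after the gate, to the single set \<open>B k\<close>.\<close>
  have good: "(\<Sum>j<N. if Q j w k then \<phi> n (B j) (w \<circ> act (Inl k)) else 0) \<le> 4 * \<phi> n (B k) id" if "k < N" for k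
  proof -
    have "(\<Sum>j<N. if Q j w k then \<phi> n (B j) (w \<circ> act (Inl k)) else 0)
        = (\<Sum>j\<in>{j. j < N \<and> Q j w k}. \<phi> n (B j) (w \<circ> act (Inl k)))"
      by (rule sum.mono_neutral_cong_right) auto
    also have "\<dots> \<le> 4 * \<phi> n (B k) id"
      using that w Q_nested by (intro \<phi>_sum_le_mult \<psi> W_act) auto
    finally show ?thesis .
  qed
  have "(\<Sum>j<N. of_bool (w x0 \<in> B j)) = real (card {j. j < N \<and> w x0 \<in> B j})"
    by (simp add: of_bool_def sum.If_cases Collect_conj_eq lessThan_def)
  then have c1: "(\<Sum>j<N. of_bool (w x0 \<in> B j)) \<le> (1::real)" using B_card[of "w x0"] by simp
  have "(\<Sum>j<N. \<Sum>k<N. of_bool (\<not> Q j w k)) = (\<Sum>(j,k)\<in>{..<N}\<times>{..<N}. if \<not> Q j w k then 1 else (0::real))"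
    by (simp add: sum.cartesian_product of_bool_def)
  also have "\<dots> = (\<Sum>(j,k)\<in>{(j, k). j < N \<and> k < N \<and> \<not> Q j w k}. 1)"
    by (rule sum.mono_neutral_cong_right) auto
  also have "\<dots> = real (card {(j, k). j < N \<and> k < N \<and> \<not> Q j w k})" by (simp add: split_def)
  also have "\<dots> \<le> real (2 * N)" using Q_card[OF w] by (rule of_nat_mono)
  finally have c2: "(\<Sum>j<N. \<Sum>k<N. of_bool (\<not> Q j w k)) \<le> 2 * real N" by simp
  have g: "(\<Sum>k<N. \<Sum>j<N. if Q j w k then \<phi> n (B j) (w \<circ> act (Inl k)) else 0) \<le> (\<Sum>k<N. 4 * \<phi> n (B k) id)"
    by (intro sum_mono good) simp
  have "(\<Sum>j<N. \<psi> n (B j) w) = (\<Sum>j<N. \<Sum>k<N. ?f j k) / N"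
    by (simp add: \<psi>_def sum_divide_distrib)
  also have "\<dots> \<le> (\<Sum>j<N. \<Sum>k<N. of_bool (w x0 \<in> B j) + of_bool (\<not> Q j w k) +
      (if Q j w k then \<phi> n (B j) (w \<circ> act (Inl k)) else 0)) / N"
    by (intro divide_right_mono sum_mono split) auto
  also have "\<dots> = (real N * (\<Sum>j<N. of_bool (w x0 \<in> B j)) + (\<Sum>j<N. \<Sum>k<N. of_bool (\<not> Q j w k)) +
      (\<Sum>k<N. \<Sum>j<N. if Q j w k then \<phi> n (B j) (w \<circ> act (Inl k)) else 0)) / N"
    by (simp add: sum.distrib sum_distrib_left sum.swap[where A = "{..<N}" and g = "\<lambda>j k. if Q j w k then \<phi> n (B j) (w \<circ> act (Inl k)) else 0"] del: sum_of_bool_eq)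
  also have "\<dots> \<le> (real N * 1 + 2 * real N + (\<Sum>k<N. 4 * \<phi> n (B k) id)) / N"
  proof (rule divide_right_mono)
    show "real N * (\<Sum>j<N. of_bool (w x0 \<in> B j)) + (\<Sum>j<N. \<Sum>k<N. of_bool (\<not> Q j w k)) +
        (\<Sum>k<N. \<Sum>j<N. if Q j w k then \<phi> n (B j) (w \<circ> act (Inl k)) else 0)
        \<le> real N * 1 + 2 * real N + (\<Sum>k<N. 4 * \<phi> n (B k) id)"
      using mult_left_mono[OF c1 of_nat_0_le_iff[of N]] c2 g by linarith
  qed simp
  also have "\<dots> \<le> (real N * 1 + 2 * real N + 4 * 4) / N"
    using \<phi>[OF W_id] by (intro divide_right_mono add_mono) (auto simp: sum_distrib_left[symmetric])
  also have "\<dots> \<le> 4" using N by (simp add: field_simps)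
  finally show ?thesis .
qed

text \<open>The two bounds are proved together: \<open>\<phi>\<close> at horizon \<open>n\<close>
  needs \<open>\<psi>\<close> at the preceding horizon, and \<open>\<psi>\<close> at
  \<open>n\<close> needs \<open>\<phi>\<close> at \<open>n\<close> and \<open>\<psi>\<close> at all
  smaller horizons, because the first entrance may occur at any time.\<close>

lemma hit_bounds: "w \<in> W \<Longrightarrow> (\<Sum>j<N. \<phi> n (B j) w) \<le> 4"
proof -
  have "\<forall>w\<in>W. (\<Sum>j<N. \<phi> n (B j) w) \<le> 4 \<and> (\<Sum>j<N. \<psi> n (B j) w) \<le> 4"
  proof (induction n rule: less_induct)
    case (less n)
    have A: "(\<Sum>j<N. \<phi> n (B j) w) \<le> 4" if w: "w \<in> W" for w
    proof (cases n)
      case (Suc m)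
      have "(\<Sum>j<N. measure_pmf.expectation \<nu> (\<lambda>b. \<phi> m (B j) (w \<circ> act (Inr b)))) \<le> 4 * measure_pmf.expectation \<nu> (\<lambda>_. 1)"
        using less[of m] Suc w W_act \<phi>_bounds by (intro expectation_sum_mult_le) auto
      then have 2: "(\<Sum>j<N. measure_pmf.expectation \<nu> (\<lambda>b. \<phi> m (B j) (w \<circ> act (Inr b)))) \<le> 4" by simp
      have "(\<Sum>j<N. \<phi> n (B j) w) = \<eta> * (\<Sum>j<N. \<psi> m (B j) w) +
          (1 - \<eta>) * (\<Sum>j<N. measure_pmf.expectation \<nu> (\<lambda>b. \<phi> m (B j) (w \<circ> act (Inr b))))"
        by (simp add: Suc \<phi>_Suc sum.distrib sum_distrib_left)
      also have "\<dots> \<le> 4" using 2 less[of m] Suc w \<eta> by (intro convex_bound_le) auto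
      finally show ?thesis .
    qed simp
    then show ?case using \<psi>_sum_le[of n] less by blast
  qed
  then show "w \<in> W \<Longrightarrow> (\<Sum>j<N. \<phi> n (B j) w) \<le> 4" by blast
qed

end

section \<open>Kingman's theorem for functionals of an i.i.d. sequence\<close>

abbreviation iid :: "'a pmf \<Rightarrow> (nat \<Rightarrow> 'a) measure" where
  "iid p \<equiv> PiM UNIV (\<lambda>_. measure_pmf p)"

definition shift :: "nat \<Rightarrow> (nat \<Rightarrow> 'a) \<Rightarrow> nat \<Rightarrow> 'a" where
  "shift k \<xi> = (\<lambda>i. \<xi> (i + k))"

lemma shift_shift [simp]: "shift k (shift l \<xi>) = shift (k + l) \<xi>"
  by (simp add: shift_def add.assoc)

lemma shift_0 [simp]: "shift 0 \<xi> = \<xi>"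
  by (simp add: shift_def)

lemma space_iid [simp]: "space (iid p) = UNIV"
  by (simp add: space_PiM)

lemma prob_space_iid: "prob_space (iid p)"
  by (intro prob_space_PiM) (rule measure_pmf.prob_space_axioms)

lemma sequence_space_iid: "sequence_space (measure_pmf p)"
  by unfold_locales

lemma measurable_shift [measurable]: "shift k \<in> measurable (iid p) (iid p)"
  unfolding shift_def by (rule measurable_PiM_single') auto

lemma emeasure_iid_UNIV [simp]: "emeasure (iid p) UNIV = 1"
  using prob_space.emeasure_space_1[OF prob_space_iid, of p] by simp

lemma distr_shift: "distr (iid p) (iid p) (shift k) = iid p"
proof -
  have "distr (PiM UNIV (\<lambda>_. measure_pmf p)) (PiM UNIV (\<lambda>_. measure_pmf p)) (\<lambda>\<omega>. \<lambda>n\<in>UNIV. \<omega> (n + k)) = PiM UNIV (\<lambda>_. measure_pmf p)"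
    by (rule distr_PiM_reindex) (auto simp: inj_on_def intro: measure_pmf.prob_space_axioms)
  then show ?thesis by (simp add: shift_def[abs_def] restrict_def)
qed

lemma nn_integral_shift:
  "f \<in> borel_measurable (iid p) \<Longrightarrow> (\<integral>\<^sup>+ \<xi>. f (shift k \<xi>) \<partial>iid p) = (\<integral>\<^sup>+ \<xi>. f \<xi> \<partial>iid p)"
  using nn_integral_distr[of "shift k" "iid p" "iid p" f] by (simp add: distr_shift)

lemma AE_shift: "AE \<xi> in iid p. P \<xi> \<Longrightarrow> AE \<xi> in iid p. P (shift k \<xi>)"
  using AE_distrD[OF measurable_shift[of k p], of P] unfolding distr_shift .

text \<open>A countable alphabet has countably many finite words, so every set of prefixes has a
  measurable preimage. This is why the increments of the random walk are encoded by natural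
  numbers.\<close>

lemma measurable_prefix [measurable]:
  fixes p :: "'a::countable pmf"
  shows "(\<lambda>\<xi>. map \<xi> [0..<n]) \<in> measurable (iid p) (count_space UNIV)"
proof (rule measurableI)
  have c: "{\<xi>\<in>space (iid p). \<xi> i = a} \<in> sets (iid p)" for i a
  proof -
    have "(\<lambda>\<xi>. \<xi> i) \<in> measurable (iid p) (measure_pmf p)" by (rule measurable_component_singleton) simp
    from measurable_sets[OF this, of "{a}"] show ?thesis by (simp add: vimage_def)
  qed
  have s: "(\<lambda>\<xi>. map \<xi> [0..<n]) -` {xs} \<in> sets (iid p)" for xs :: "'a list"
  proof -
    have "{\<xi>\<in>space (iid p). \<forall>i\<in>{..<n}. \<xi> i = xs ! i} \<in> sets (iid p)"
      by (intro sets.sets_Collect_finite_All c) simp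
    moreover have "map \<xi> [0..<n] = xs \<longleftrightarrow> length xs = n \<and> (\<forall>i<n. \<xi> i = xs ! i)" for \<xi>
      by (subst list_eq_iff_nth_eq) auto
    then have "(\<lambda>\<xi>. map \<xi> [0..<n]) -` {xs} = (if length xs = n then {\<xi>\<in>space (iid p). \<forall>i\<in>{..<n}. \<xi> i = xs ! i} else {})"
      by (simp add: vimage_def lessThan_def)
    ultimately show ?thesis by simp
  qed
  fix X :: "'a list set"
  have "(\<lambda>\<xi>. map \<xi> [0..<n]) -` X = (\<Union>xs\<in>X. (\<lambda>\<xi>. map \<xi> [0..<n]) -` {xs})" by auto
  also have "\<dots> \<in> sets (iid p)" using s by (intro sets.countable_UN'') auto
  finally show "(\<lambda>\<xi>. map \<xi> [0..<n]) -` X \<inter> space (iid p) \<in> sets (iid p)" by simp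
qed simp

lemma measurable_iid_finite:
  fixes p :: "'a::countable pmf"
  assumes "\<And>\<xi> \<xi>'. (\<And>i. i < n \<Longrightarrow> \<xi> i = \<xi>' i) \<Longrightarrow> f \<xi> = f \<xi>'" "\<And>\<xi>. f \<xi> \<in> space M"
  shows "f \<in> measurable (iid p) M"
proof -
  define g where "g xs = f (\<lambda>i. if i < n then xs ! i else undefined)" for xs
  have "f = (\<lambda>\<xi>. g (map \<xi> [0..<n]))" unfolding g_def by (intro ext assms(1)) auto
  moreover have "g \<in> measurable (count_space UNIV) M" using assms(2) by (auto simp: g_def)
  ultimately show ?thesis using measurable_compose[OF measurable_prefix[of n p], of g M] by simp
qed

text \<open>Places shifted events into the sigma-algebra of the coordinates from \<open>k\<close>
  on, in the form in which tail events are defined.\<close>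

lemma sets_shift_vimage:
  assumes "A \<in> sets (iid p)"
  shows "shift k -` A \<in> sigma_sets UNIV (\<Union>i\<in>{k..}. {(\<lambda>\<xi>. \<xi> i) -` B | B. B \<in> sets (measure_pmf p)})"
    (is "_ \<in> sigma_sets UNIV ?G")
proof -
  define N where "N = sigma UNIV ?G"
  have N: "space N = UNIV" "sets N = sigma_sets UNIV ?G" unfolding N_def by (auto intro: sets_measure_of)
  have "(\<lambda>\<xi>. \<xi> (i + k)) \<in> measurable N (measure_pmf p)" for i
  proof (rule measurableI)
    fix B assume "B \<in> sets (measure_pmf p)"
    then have "(\<lambda>\<xi>. \<xi> (i + k)) -` B \<in> {(\<lambda>\<xi>. \<xi> (i + k)) -` B | B. B \<in> sets (measure_pmf p)}" by blast
    then have "(\<lambda>\<xi>. \<xi> (i + k)) -` B \<in> ?G" by (intro UN_I[of "i + k"]) simp_all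
    then show "(\<lambda>\<xi>. \<xi> (i + k)) -` B \<inter> space N \<in> sets N" by (simp add: N(2) N(1) sigma_sets.Basic)
  qed simp
  then have "shift k \<in> measurable N (iid p)"
    unfolding shift_def by (intro measurable_PiM_single') (auto simp: N)
  from measurable_sets[OF this assms] show ?thesis by (simp add: N)
qed

lemma indep_vars_iid:
  "prob_space.indep_vars (iid p) (\<lambda>_. measure_pmf p) (\<lambda>i \<xi>. \<xi> i) UNIV"
proof -
  interpret prob_space "iid p" by (rule prob_space_iid)
  show ?thesis
  proof (subst indep_vars_iff_distr_eq_PiM')
    show "distr (iid p) (iid p) (\<lambda>x. \<lambda>i\<in>UNIV. x i) = PiM UNIV (\<lambda>i. distr (iid p) (measure_pmf p) (\<lambda>\<xi>. \<xi> i))"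
      by (subst distr_PiM_component) (auto simp: restrict_def distr_id measure_pmf.prob_space_axioms)
  qed auto
qed

text \<open>The preimages of \<open>A\<close> under the shifts decrease, and each has the
  probability of \<open>A\<close>. Hence their intersection has this probability too, and it is a
  tail event.\<close>

lemma zero_one_shift:
  assumes A: "A \<in> sets (iid p)" and mono: "\<And>\<xi> k. shift k \<xi> \<in> A \<Longrightarrow> \<xi> \<in> A"
  shows "measure (iid p) A = 0 \<or> measure (iid p) A = 1"
proof -
  interpret prob_space "iid p" by (rule prob_space_iid)
  define F where "F i = {(\<lambda>\<xi>. \<xi> i) -` B | B. B \<in> sets (measure_pmf p)}" for i :: nat
  define T where "T = (\<Inter>k. shift k -` A)"
  have sub: "shift (k + l) -` A \<subseteq> shift k -` A" for k l
    using mono[of l "shift k _"] by (auto simp: add.commute)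
  have Ak: "shift k -` A \<in> sets (iid p)" for k using measurable_sets[OF measurable_shift A, of k] by simp
  have "T \<in> tail_events F"
    unfolding tail_events_def
  proof (intro INT_I)
    fix n
    have "T = (\<Inter>k. shift (n + k) -` A)" unfolding T_def
    proof (intro equalityI)
      show "(\<Inter>k. shift (n + k) -` A) \<subseteq> (\<Inter>k. shift k -` A)"
      proof (intro subsetI INT_I)
        fix \<xi> k assume "\<xi> \<in> (\<Inter>k. shift (n + k) -` A)"
        then have "\<xi> \<in> shift (k + n) -` A" by (metis INT_D UNIV_I add.commute)
        then show "\<xi> \<in> shift k -` A" using sub[of k n] by blast
      qed
    qed auto
    moreover have "shift (n + k) -` A \<in> sigma_sets UNIV (\<Union>(F ` {n..}))" for k
    proof -
      have "sigma_sets UNIV (\<Union>(F ` {n+k..})) \<subseteq> sigma_sets UNIV (\<Union>(F ` {n..}))"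
        by (intro sigma_sets_subseteq UN_mono) auto
      moreover have "shift (n + k) -` A \<in> sigma_sets UNIV (\<Union>(F ` {n+k..}))"
        using sets_shift_vimage[OF A, of "n + k"] unfolding F_def .
      ultimately show ?thesis by blast
    qed
    ultimately show "T \<in> sigma_sets (space (iid p)) (\<Union>(F ` {n..}))"
      by (auto intro!: sigma_sets_INTER)
  qed
  moreover have "indep_sets F UNIV"
    using indep_vars_iid[of p] unfolding indep_vars_def2 F_def by (simp add: vimage_def)
  moreover have "sigma_algebra (space (iid p)) (F i)" for i
  proof -
    have "F i = sets (vimage_algebra UNIV (\<lambda>\<xi>. \<xi> i) (measure_pmf p))"
      unfolding F_def by (subst sets_vimage_algebra2) auto
    then show ?thesis using sets.sigma_algebra_axioms[of "vimage_algebra UNIV (\<lambda>\<xi>. \<xi> i) (measure_pmf p)"] by simp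
  qed
  ultimately have "prob T = 0 \<or> prob T = 1" by (intro kolmogorov_0_1_law)
  moreover have "(\<lambda>k. prob (shift k -` A)) \<longlonglongrightarrow> prob T"
    unfolding T_def
  proof (rule finite_Lim_measure_decseq)
    show "decseq (\<lambda>k. shift k -` A)" using sub by (fastforce simp: decseq_def dest: le_Suc_ex)
  qed (use Ak in auto)
  moreover have "prob (shift k -` A) = prob A" for k
    using measure_distr[OF measurable_shift A, of k] by (simp add: distr_shift)
  ultimately show ?thesis by (simp add: LIMSEQ_const_iff)
qed

section \<open>Almost sure bounds for superadditive processes\<close>

locale superadditive =
  fixes p :: "'a::countable pmf" and y :: "nat \<Rightarrow> (nat \<Rightarrow> 'a) \<Rightarrow> real"
  assumes meas [measurable]: "y n \<in> borel_measurable (iid p)"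
    and nonneg: "0 \<le> y n \<xi>"
    and super: "y m \<xi> + y n (shift m \<xi>) \<le> y (m + n) \<xi>"
begin

lemma y_mono: "m \<le> n \<Longrightarrow> y m \<xi> \<le> y n \<xi>"
  using super[of m \<xi> "n - m"] nonneg[of "n - m" "shift m \<xi>"] by simp

lemma y_shift_le: "y n (shift k \<xi>) \<le> y (k + n) \<xi>"
  using super[of k \<xi> n] nonneg[of k \<xi>] by simp

text \<open>Greedy partition of \<open>[0,n)\<close>: at a point where some block of length
  \<open>m \<le> L\<close> has value above \<open>a * m\<close>, jump over this block; elsewhere
  move by one and pay \<open>a\<close> through \<open>B\<close>. Only a rest of length at most
  \<open>L\<close> is lost.\<close>

lemma block_bound:
  fixes L :: nat and a :: real
  assumes "0 < a" "1 \<le> L"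
  defines "B \<equiv> \<lambda>\<xi>. of_bool (\<forall>m. 1 \<le> m \<and> m \<le> L \<longrightarrow> y m \<xi> \<le> a * m) :: real"
  shows "a * (real n - L) \<le> y n \<xi> + a * (\<Sum>i<n. B (shift i \<xi>))"
proof (induction n arbitrary: \<xi> rule: less_induct)
  case (less n)
  have S: "(\<Sum>i<n. B (shift i \<xi>)) = (\<Sum>i<m. B (shift i \<xi>)) + (\<Sum>i<n-m. B (shift i (shift m \<xi>)))" if "m \<le> n" for m
    using sum.atLeastLessThan_concat[of 0 m n "\<lambda>i. B (shift i \<xi>)"]
      sum.shift_bounds_nat_ivl[of "\<lambda>i. B (shift i \<xi>)" 0 m "n - m"] that
    by (simp add: atLeast0LessThan)
  have B0: "0 \<le> (\<Sum>i<k. B (shift i \<xi>))" for k by (auto simp: B_def intro: sum_nonneg)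
  show ?case
  proof (cases "n \<le> L")
    case True
    then have "a * (real n - L) \<le> 0" using assms by (simp add: mult_nonneg_nonpos)
    moreover have "0 \<le> a * (\<Sum>i<n. B (shift i \<xi>))" using assms B0 by simp
    ultimately show ?thesis using nonneg[of n \<xi>] by linarith
  next
    case False
    show ?thesis
    proof (cases "\<forall>m. 1 \<le> m \<and> m \<le> L \<longrightarrow> y m \<xi> \<le> a * m")
      case True
      then have "B \<xi> = 1" by (simp add: B_def)
      moreover have "a * (real (n - 1) - L) \<le> y (n - 1) (shift 1 \<xi>) + a * (\<Sum>i<n-1. B (shift i (shift 1 \<xi>)))"
        using False by (intro less.IH) auto
      moreover have "y (n - 1) (shift 1 \<xi>) \<le> y n \<xi>" using y_shift_le[of "n - 1" 1 \<xi>] False by simp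
      moreover have "a * (\<Sum>i<n. B (shift i \<xi>)) = a * B \<xi> + a * (\<Sum>i<n-1. B (shift i (shift 1 \<xi>)))"
        using S[of 1] False by (simp add: distrib_left)
      moreover have "a * (real (n - 1) - L) = a * (real n - L) - a" using False by (simp add: of_nat_diff algebra_simps)
      ultimately show ?thesis by simp
    next
      case b: False
      then obtain m where m: "1 \<le> m" "m \<le> L" "a * m < y m \<xi>" by force
      then have "a * (real (n - m) - L) \<le> y (n - m) (shift m \<xi>) + a * (\<Sum>i<n-m. B (shift i (shift m \<xi>)))"
        using False by (intro less.IH) auto
      moreover have "y m \<xi> + y (n - m) (shift m \<xi>) \<le> y n \<xi>" using super[of m \<xi> "n - m"] m False by simp
      moreover have "0 \<le> a * (\<Sum>i<m. B (shift i \<xi>))" using assms B0 by simp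
      moreover have "a * (\<Sum>i<n. B (shift i \<xi>)) = a * (\<Sum>i<m. B (shift i \<xi>)) + a * (\<Sum>i<n-m. B (shift i (shift m \<xi>)))"
        using S[of m] m False by (simp add: distrib_left)
      moreover have "a * (real (n - m) - L) = a * (real n - L) - a * m"
        using m False by (simp add: of_nat_diff algebra_simps)
      ultimately show ?thesis using m(3) by linarith
    qed
  qed
qed

text \<open>The Katznelson--Weiss argument: if \<open>y m > a m\<close> for some \<open>m\<close> almost surely, then for most
  starting points \<open>m\<close> is bounded by some \<open>L\<close>, and \<open>[0,n)\<close> splits into such blocks up to few points.\<close>
lemma AE_exceeds_imp_le:
  fixes a g :: real
  assumes a: "0 < a" and g: "\<And>n. (\<integral>\<^sup>+ \<xi>. y n \<xi> \<partial>iid p) \<le> ennreal (g * n)" "0 \<le> g"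
    and AE: "AE \<xi> in iid p. \<exists>m\<ge>1. a * m < y m \<xi>"
  shows "a \<le> g"
proof -
  interpret prob_space "iid p" by (rule prob_space_iid)
  define C where "C L = {\<xi>\<in>space (iid p). \<forall>m. 1 \<le> m \<and> m \<le> L \<longrightarrow> y m \<xi> \<le> a * m}" for L :: nat
  have [measurable]: "C L \<in> sets (iid p)" for L unfolding C_def by measurable
  have main: "a * (real n - L) \<le> g * n + a * (n * prob (C L))" if L: "1 \<le> L" for n L
  proof -
    have *: "of_bool (\<forall>m. 1 \<le> m \<and> m \<le> L \<longrightarrow> y m \<xi> \<le> a * m) = (indicator (C L) \<xi> :: real)" for \<xi>
      by (simp add: C_def indicator_def)
    have bb: "a * (real n - L) \<le> y n \<xi> + a * (\<Sum>i<n. indicator (C L) (shift i \<xi>))" for \<xi>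
      using block_bound[OF a L, of n \<xi>] unfolding * .
    have "ennreal (a * (real n - L)) = (\<integral>\<^sup>+ \<xi>. ennreal (a * (real n - L)) \<partial>iid p)"
      by simp
    also have "\<dots> \<le> (\<integral>\<^sup>+ \<xi>. ennreal (y n \<xi>) + ennreal a * (\<Sum>i<n. indicator (C L) (shift i \<xi>)) \<partial>iid p)"
    proof (intro nn_integral_mono)
      fix \<xi>
      have "ennreal (a * (real n - L)) \<le> ennreal (y n \<xi> + a * (\<Sum>i<n. indicator (C L) (shift i \<xi>)))"
        by (rule ennreal_leI[OF bb])
      also have "\<dots> = ennreal (y n \<xi>) + ennreal a * (\<Sum>i<n. ennreal (indicator (C L) (shift i \<xi>)))"
        using a nonneg by (simp add: ennreal_plus ennreal_mult sum_nonneg sum_ennreal)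
      finally show "ennreal (a * (real n - L)) \<le> ennreal (y n \<xi>) + ennreal a * (\<Sum>i<n. indicator (C L) (shift i \<xi>))"
        by (simp add: ennreal_indicator)
    qed
    also have "\<dots> = (\<integral>\<^sup>+ \<xi>. y n \<xi> \<partial>iid p) + ennreal a * (\<Sum>i<n. \<integral>\<^sup>+ \<xi>. indicator (C L) (shift i \<xi>) \<partial>iid p)"
      by (subst nn_integral_add, simp, simp) (simp add: nn_integral_cmult nn_integral_sum)
    also have "(\<Sum>i<n. \<integral>\<^sup>+ \<xi>. indicator (C L) (shift i \<xi>) \<partial>iid p) = (\<Sum>i<n. ennreal (prob (C L)))"
      by (intro sum.cong refl, subst nn_integral_shift) (auto simp: emeasure_eq_measure)
    also have "ennreal a * \<dots> = ennreal (a * (n * prob (C L)))"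
      using a by (simp add: ennreal_mult ennreal_of_nat_eq_real_of_nat)
    finally have "ennreal (a * (real n - L)) \<le> ennreal (g * n) + ennreal (a * (n * prob (C L)))"
      using g(1)[of n] by (meson add_right_mono order.trans)
    also have "\<dots> = ennreal (g * n + a * (n * prob (C L)))" using g a by (simp add: ennreal_plus)
    finally show ?thesis using g a by (subst (asm) ennreal_le_iff) auto
  qed
  \<comment> \<open>Let \<open>n\<close> tend to infinity with \<open>L\<close> fixed; afterwards
    \<open>L\<close> tends to infinity, and the exceptional sets \<open>C L\<close> decrease to a
    null set.\<close>
  have le: "a * (1 - prob (C L)) \<le> g" if L: "1 \<le> L" for L
  proof -
    have l: "(\<lambda>n. a * (1 - L / real n) - a * prob (C L)) \<longlonglongrightarrow> a * (1 - 0) - a * prob (C L)"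
      by (intro tendsto_intros lim_const_over_n)
    have e: "eventually (\<lambda>n. a * (1 - L / real n) - a * prob (C L) \<le> g) sequentially"
      using eventually_gt_at_top[of 0]
    proof eventually_elim
      case (elim n)
      have "(a * (1 - L / real n) - a * prob (C L)) * n = a * (real n - L) - a * (n * prob (C L))"
        using elim by (simp add: algebra_simps)
      then have "(a * (1 - L / real n) - a * prob (C L)) * n \<le> g * n" using main[OF L, of n] by linarith
      then show ?case using elim by simp
    qed
    show ?thesis using tendsto_upperbound[OF l e] by (simp add: algebra_simps)
  qed
  have "(\<lambda>L. prob (C L)) \<longlonglongrightarrow> prob (\<Inter>L. C L)"
  proof (rule finite_Lim_measure_decseq)
    show "decseq C" by (auto simp: decseq_def C_def)
  qed auto
  moreover have "prob (\<Inter>L. C L) = 0"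
  proof (rule prob_eq_0[THEN iffD2])
    show "AE \<xi> in iid p. \<xi> \<notin> (\<Inter>L. C L)" using AE
    proof eventually_elim
      case (elim \<xi>)
      then obtain m where "m \<ge> 1" "a * m < y m \<xi>" by blast
      then have "\<xi> \<notin> C m" by (force simp: C_def)
      then show ?case by blast
    qed
  qed auto
  ultimately have l: "(\<lambda>L. a * (1 - prob (C L))) \<longlonglongrightarrow> a * (1 - 0)" by (intro tendsto_intros) simp
  have e: "eventually (\<lambda>L. a * (1 - prob (C L)) \<le> g) sequentially"
    using eventually_ge_at_top[of 1] le by (rule eventually_mono)
  show ?thesis using tendsto_upperbound[OF l e] by simp
qed

text \<open>By the zero-one law, the alternative is that \<open>y n > a * n\<close> infinitely often
  almost surely for some \<open>a\<close> strictly between \<open>g\<close> and \<open>c\<close>,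
  and \<open>AE_exceeds_imp_le\<close> excludes this.\<close>

lemma AE_eventually_le:
  fixes c g :: real
  assumes g: "\<And>n. (\<integral>\<^sup>+ \<xi>. y n \<xi> \<partial>iid p) \<le> ennreal (g * n)" "0 \<le> g" and c: "g < c"
  shows "AE \<xi> in iid p. eventually (\<lambda>n. y n \<xi> \<le> c * n) sequentially"
proof -
  interpret prob_space "iid p" by (rule prob_space_iid)
  define a where "a = (g + c) / 2"
  have a: "g < a" "a < c" "0 < a" using c g by (auto simp: a_def)
  \<comment> \<open>This encodes that the upper limit of \<open>y n / n\<close> exceeds
    \<open>a\<close>. The margin \<open>1 / (j + 1)\<close> makes the event compatible with shifts:
    a shift by \<open>k\<close> is absorbed by passing from \<open>j\<close> to
    \<open>j + 1\<close>.\<close>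
  define A where "A = {\<xi>\<in>space (iid p). \<exists>j::nat. \<forall>M. \<exists>n\<ge>M. (a + 1 / (j + 1)) * n < y n \<xi>}"
  have A [measurable]: "A \<in> sets (iid p)" unfolding A_def by measurable
  have "prob A = 0 \<or> prob A = 1"
  proof (rule zero_one_shift[OF A])
    fix \<xi> k assume "shift k \<xi> \<in> A"
    then obtain j :: nat where j: "\<And>M. \<exists>n\<ge>M. (a + 1 / (j + 1)) * n < y n (shift k \<xi>)" unfolding A_def by blast
    have "\<exists>n\<ge>M. (a + 1 / (real (j + 1) + 1)) * n < y n \<xi>" for M
    proof -
      define d where "d = 1 / (real j + 1) - 1 / (real j + 2)"
      have d: "d > 0" unfolding d_def by (simp add: field_simps add_pos_nonneg)
      \<comment> \<open>From \<open>q\<close> on, the difference \<open>d\<close> of the two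
        margins, multiplied by \<open>n\<close>, outweighs the \<open>k\<close> additional
        indices.\<close>
      obtain q :: nat where q: "(a + 1 / (real j + 2)) * k / d < q" using reals_Archimedean2 by blast
      obtain n where n: "n \<ge> max M q" "(a + 1 / (j + 1)) * n < y n (shift k \<xi>)" using j by blast
      have "(a + 1 / (real j + 2)) * k < d * n" using q n(1) d
      proof -
        have "(a + 1 / (real j + 2)) * k < real q * d" using q d by (simp add: pos_divide_less_eq)
        also have "\<dots> \<le> real n * d" using n(1) d by (intro mult_right_mono) auto
        finally show ?thesis by (simp add: mult.commute)
      qed
      then have "(a + 1 / (real j + 2)) * (k + n) < (a + 1 / (real j + 1)) * n"
        unfolding d_def by (simp add: algebra_simps add_divide_distrib)
      also have "\<dots> < y (k + n) \<xi>" using n(2) y_shift_le[of n k \<xi>] by (simp add: add.commute)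
      finally show ?thesis using n(1) by (intro exI[of _ "k + n"]) (simp add: add.commute)
    qed
    then have "\<forall>M. \<exists>n\<ge>M. (a + 1 / real (Suc j + 1)) * real n < y n \<xi>" by (simp add: add.commute)
    then have "\<exists>j::nat. \<forall>M. \<exists>n\<ge>M. (a + 1 / real (j + 1)) * real n < y n \<xi>" by (rule exI)
    then show "\<xi> \<in> A" unfolding A_def mem_Collect_eq space_iid by (intro conjI UNIV_I)
  qed
  moreover have "prob A \<noteq> 1"
  proof
    assume "prob A = 1"
    then have "AE \<xi> in iid p. \<xi> \<in> A" by (simp add: prob_eq_1)
    then have "AE \<xi> in iid p. \<exists>m\<ge>1. a * m < y m \<xi>"
    proof eventually_elim
      case (elim \<xi>)
      then obtain j :: nat where "\<forall>M. \<exists>n\<ge>M. (a + 1 / (j + 1)) * n < y n \<xi>" unfolding A_def mem_Collect_eq by (elim conjE exE)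
      then obtain n where n: "n \<ge> 1" "(a + 1 / real (j + 1)) * n < y n \<xi>" by (elim allE[of _ 1] exE conjE)
      have "a * n \<le> (a + 1 / real (j + 1)) * n" by (intro mult_right_mono) auto
      then show ?case using n(1) le_less_trans[OF _ n(2)] by blast
    qed
    from AE_exceeds_imp_le[OF a(3) g this] show False using a by simp
  qed
  ultimately have "prob A = 0" by simp
  then have "AE \<xi> in iid p. \<xi> \<notin> A" using prob_eq_0[of A] by simp
  then show ?thesis
  proof eventually_elim
    case (elim \<xi>)
    obtain j :: nat where j: "1 / (real j + 1) < c - a"
      using nat_approx_posE[of "c - a"] a by (auto simp: add.commute)
    have "\<not> (\<forall>M. \<exists>n\<ge>M. (a + 1 / real (j + 1)) * real n < y n \<xi>)"
      using elim unfolding A_def mem_Collect_eq space_iid by (metis UNIV_I)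
    then have "\<exists>M. \<forall>n\<ge>M. y n \<xi> \<le> (a + 1 / real (j + 1)) * real n" by (simp only: not_all not_ex not_less de_Morgan_conj) (metis not_le)
    then obtain M where M: "\<And>n. n \<ge> M \<Longrightarrow> y n \<xi> \<le> (a + 1 / (j + 1)) * n" by blast
    have "y n \<xi> \<le> c * n" if "n \<ge> M" for n
    proof -
      have "(a + 1 / (real j + 1)) * n \<le> c * n" using j by (intro mult_right_mono) auto
      then show ?thesis using M[OF that] by (simp add: add.commute)
    qed
    then show ?case unfolding eventually_sequentially by blast
  qed
qed

end


lemma nn_integral_truncate:
  fixes f :: "'a \<Rightarrow> real"
  assumes [measurable]: "f \<in> borel_measurable M"
  shows "(\<integral>\<^sup>+ x. f x \<partial>M) = (SUP i::nat. \<integral>\<^sup>+ x. ennreal (min (f x) (real i)) \<partial>M)"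
proof -
  have "(\<integral>\<^sup>+ x. f x \<partial>M) = (\<integral>\<^sup>+ x. (SUP i::nat. ennreal (min (f x) (real i))) \<partial>M)"
  proof (rule nn_integral_cong)
    fix x
    obtain i :: nat where i: "f x \<le> real i" using real_arch_simple by blast
    show "ennreal (f x) = (SUP i::nat. ennreal (min (f x) (real i)))"
    proof (rule antisym)
      show "ennreal (f x) \<le> (SUP i::nat. ennreal (min (f x) (real i)))"
        using i by (intro SUP_upper2[of i]) auto
      show "(SUP i::nat. ennreal (min (f x) (real i))) \<le> ennreal (f x)"
        by (intro SUP_least ennreal_leI) auto
    qed
  qed
  also have "\<dots> = (SUP i::nat. \<integral>\<^sup>+ x. ennreal (min (f x) (real i)) \<partial>M)"
    by (intro nn_integral_monotone_convergence_SUP) (auto simp: incseq_def le_fun_def intro!: ennreal_leI)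
  finally show ?thesis .
qed

text \<open>The lower bound for \<open>\<phi>\<close> is the upper bound for the nonnegative
  additive process formed from \<open>M - \<phi>\<close>.\<close>

lemma AE_birkhoff_ge:
  fixes p :: "'a::countable pmf" and \<phi> :: "(nat \<Rightarrow> 'a) \<Rightarrow> real" and c M :: real
  assumes [measurable]: "\<phi> \<in> borel_measurable (iid p)" and \<phi>: "\<And>\<xi>. 0 \<le> \<phi> \<xi>" "\<And>\<xi>. \<phi> \<xi> \<le> M"
    and c: "ennreal c < (\<integral>\<^sup>+ \<xi>. \<phi> \<xi> \<partial>iid p)" "0 \<le> c"
  shows "AE \<xi> in iid p. eventually (\<lambda>n. c * n \<le> (\<Sum>i<n. \<phi> (shift i \<xi>))) sequentially"
proof -
  define z where "z n \<xi> = (\<Sum>i<n. M - \<phi> (shift i \<xi>))" for n \<xi>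
  have M: "0 \<le> M" using \<phi>[of undefined] by linarith
  interpret superadditive p z
  proof
    show "z n \<in> borel_measurable (iid p)" for n unfolding z_def by measurable
    show "0 \<le> z n \<xi>" for n \<xi> unfolding z_def using \<phi> by (intro sum_nonneg) auto
    show "z m \<xi> + z n (shift m \<xi>) \<le> z (m + n) \<xi>" for m n \<xi>
      unfolding z_def
      using sum.atLeastLessThan_concat[of 0 m "m + n" "\<lambda>i. M - \<phi> (shift i \<xi>)"]
        sum.shift_bounds_nat_ivl[of "\<lambda>i. M - \<phi> (shift i \<xi>)" 0 m n]
      by (simp add: atLeast0LessThan add.commute)
  qed
  define J where "J = (\<integral>\<^sup>+ \<xi>. ennreal (M - \<phi> \<xi>) \<partial>iid p)"
  define I where "I = (\<integral>\<^sup>+ \<xi>. ennreal (\<phi> \<xi>) \<partial>iid p)"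
  have "J + I = (\<integral>\<^sup>+ \<xi>. ennreal M \<partial>iid p)"
    unfolding I_def J_def using \<phi> by (subst nn_integral_add[symmetric]) (auto simp: ennreal_plus[symmetric] simp del: ennreal_plus)
  then have JI: "J + I = ennreal M" by simp
  then have fin: "J < \<infinity>" "I < \<infinity>" by (auto simp: less_top[symmetric] dest: arg_cong[where f = "\<lambda>x. x = \<infinity>"])
  then obtain i j where ij: "I = ennreal i" "J = ennreal j" "0 \<le> i" "0 \<le> j" by (cases I; cases J) auto
  then have "j + i = M" using JI M by (simp add: ennreal_plus[symmetric] del: ennreal_plus)
  have "c < i" using c ij unfolding I_def[symmetric] by (simp add: ennreal_less_iff)
  have "AE \<xi> in iid p. eventually (\<lambda>n. z n \<xi> \<le> (M - c) * n) sequentially"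
  proof (rule AE_eventually_le)
    fix n
    have "(\<integral>\<^sup>+ \<xi>. z n \<xi> \<partial>iid p) = (\<Sum>i<n. \<integral>\<^sup>+ \<xi>. ennreal (M - \<phi> (shift i \<xi>)) \<partial>iid p)"
      unfolding z_def using \<phi>
      by (subst nn_integral_sum[symmetric]) (auto intro!: nn_integral_cong simp: sum_ennreal)
    also have "\<dots> = (\<Sum>i<n. J)"
      unfolding J_def by (intro sum.cong refl nn_integral_shift[of "\<lambda>\<xi>. ennreal (M - \<phi> \<xi>)"]) measurable
    also have "\<dots> = ennreal (j * n)" using ij by (simp add: ennreal_mult'' ennreal_of_nat_eq_real_of_nat mult.commute)
    finally show "(\<integral>\<^sup>+ \<xi>. z n \<xi> \<partial>iid p) \<le> ennreal (j * n)" by simp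
  qed (use ij \<open>j + i = M\<close> \<open>c < i\<close> in auto)
  then show ?thesis
    by eventually_elim (simp add: z_def sum_subtractf algebra_simps)
qed

context superadditive
begin

text \<open>Sort the starting points by residue modulo \<open>k\<close>. Within a class the blocks
  of length \<open>k\<close> are adjacent and disjoint, so superadditivity bounds their sum by one
  long term, and there are \<open>k\<close> classes.\<close>

lemma sum_blocks:
  assumes k: "1 \<le> k"
  shows "(\<Sum>i<n. y k (shift i \<xi>)) \<le> k * y (n + k) \<xi>"
proof -
  \<comment> \<open>The right-hand side keeps the exact interval available to each residue
    \<open>r\<close>, as the induction needs; monotonicity enlarges the intervals only at the
    end.\<close>
  have "(\<Sum>i<n. y k (shift i \<xi>)) \<le> (\<Sum>r<k. y (n + k - r) (shift r \<xi>))"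
  proof (induction n arbitrary: \<xi> rule: less_induct)
    case (less n)
    show ?case
    proof (cases "n < k")
      case True
      have "(\<Sum>i<n. y k (shift i \<xi>)) \<le> (\<Sum>i<n. y (n + k - i) (shift i \<xi>))" by (intro sum_mono y_mono) auto
      also have "\<dots> \<le> (\<Sum>i<k. y (n + k - i) (shift i \<xi>))" using True nonneg by (intro sum_mono2) auto
      finally show ?thesis .
    next
      case False
      have "(\<Sum>i<n. y k (shift i \<xi>)) = (\<Sum>i<k. y k (shift i \<xi>)) + (\<Sum>i<n - k. y k (shift i (shift k \<xi>)))"
        using sum.atLeastLessThan_concat[of 0 k n "\<lambda>i. y k (shift i \<xi>)"]
          sum.shift_bounds_nat_ivl[of "\<lambda>i. y k (shift i \<xi>)" 0 k "n - k"] False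
        by (simp add: atLeast0LessThan)
      also have "\<dots> \<le> (\<Sum>i<k. y k (shift i \<xi>)) + (\<Sum>r<k. y (n - k + k - r) (shift r (shift k \<xi>)))"
        using less[of "n - k" "shift k \<xi>"] k False by simp
      also have "\<dots> = (\<Sum>r<k. y k (shift r \<xi>) + y (n - r) (shift k (shift r \<xi>)))"
        using False by (simp add: sum.distrib add.commute)
      also have "\<dots> \<le> (\<Sum>r<k. y (n + k - r) (shift r \<xi>))"
      proof (rule sum_mono)
        fix r assume "r \<in> {..<k}"
        then have "k + (n - r) = n + k - r" using False by simp
        then show "y k (shift r \<xi>) + y (n - r) (shift k (shift r \<xi>)) \<le> y (n + k - r) (shift r \<xi>)"
          using super[of k "shift r \<xi>" "n - r"] by simp
      qed
      finally show ?thesis .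
    qed
  qed
  also have "\<dots> \<le> (\<Sum>r<k. y (n + k) \<xi>)"
  proof (rule sum_mono)
    fix r assume "r \<in> {..<k}"
    then show "y (n + k - r) (shift r \<xi>) \<le> y (n + k) \<xi>" using y_shift_le[of "n + k - r" r \<xi>] by simp
  qed
  finally show ?thesis by simp
qed

text \<open>A truncation of \<open>y k\<close> at a high level still has mean above
  \<open>c * k\<close>, so the bounded ergodic bound applies even if \<open>y k\<close> is not
  integrable. Dividing by \<open>k\<close> through \<open>sum_blocks\<close> loses only
  \<open>k\<close> terms.\<close>

lemma AE_eventually_ge:
  fixes c :: real
  assumes c: "ennreal (c * k) < (\<integral>\<^sup>+ \<xi>. y k \<xi> \<partial>iid p)" "0 \<le> c" and k: "1 \<le> k"
  shows "AE \<xi> in iid p. eventually (\<lambda>n. c * n \<le> y n \<xi>) sequentially"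
proof -
  obtain d where d: "ennreal (c * k) < d" "d < (\<integral>\<^sup>+ \<xi>. y k \<xi> \<partial>iid p)" using c dense by blast
  then have "d \<noteq> \<infinity>" by auto
  then obtain d' where d': "d = ennreal d'" "0 \<le> d'" by (cases d) auto
  have cd: "c * k < d'" using d(1) d' c(2) by (simp add: ennreal_less_iff)
  obtain i :: nat where i: "ennreal d' < (\<integral>\<^sup>+ \<xi>. ennreal (min (y k \<xi>) (real i)) \<partial>iid p)"
    using d(2) d' nn_integral_truncate[of "y k" "iid p"] by (auto simp: less_SUP_iff)
  have "AE \<xi> in iid p. eventually (\<lambda>n. d' * n \<le> (\<Sum>j<n. min (y k (shift j \<xi>)) (real i))) sequentially"
    using AE_birkhoff_ge[of "\<lambda>\<xi>. min (y k \<xi>) (real i)" p "real i" d'] i d' nonneg by simp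
  then show ?thesis
  proof eventually_elim
    case (elim \<xi>)
    then obtain n0 where n0: "\<And>n. n \<ge> n0 \<Longrightarrow> d' * n \<le> (\<Sum>j<n. min (y k (shift j \<xi>)) (real i))"
      unfolding eventually_sequentially by blast
    obtain q :: nat where q: "d' * k / (d' - c * k) < q" using reals_Archimedean2 by blast
    have "c * n \<le> y n \<xi>" if n: "n \<ge> max (n0 + k) q" for n
    proof -
      have "d' * (n - k) \<le> (\<Sum>j<n-k. min (y k (shift j \<xi>)) (real i))" using n0[of "n - k"] n by (simp add: le_diff_conv2)
      also have "\<dots> \<le> (\<Sum>j<n-k. y k (shift j \<xi>))" by (intro sum_mono) auto
      also have "\<dots> \<le> k * y n \<xi>" using sum_blocks[OF k, where n = "n - k" and \<xi> = \<xi>] n by simp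
      finally have 1: "d' * (n - k) \<le> k * y n \<xi>" .
      have "d' * k < q * (d' - c * k)" using q cd by (simp add: pos_divide_less_eq)
      also have "\<dots> \<le> n * (d' - c * k)" using n cd by (intro mult_right_mono) auto
      finally have "real k * (c * n) \<le> d' * (real n - k)" by (simp add: algebra_simps)
      also have "\<dots> \<le> k * y n \<xi>" using 1 n by (simp add: of_nat_diff)
      finally show ?thesis using k by simp
    qed
    then show ?case unfolding eventually_sequentially by blast
  qed
qed

end

section \<open>Kingman's theorem for subadditive processes\<close>

locale subadditive =
  fixes p :: "'a::countable pmf" and x :: "nat \<Rightarrow> (nat \<Rightarrow> 'a) \<Rightarrow> real"
  assumes meas [measurable]: "x n \<in> borel_measurable (iid p)"
    and nonneg: "0 \<le> x n \<xi>"
    and zero: "x 0 \<xi> = 0"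
    and subadd: "x (m + n) \<xi> \<le> x m \<xi> + x n (shift m \<xi>)"
    and integrable: "(\<integral>\<^sup>+ \<xi>. x 1 \<xi> \<partial>iid p) < \<infinity>"
begin

definition "partial_sum n \<xi> = (\<Sum>i<n. x 1 (shift i \<xi>))"

lemma partial_sum_add: "partial_sum (m + n) \<xi> = partial_sum m \<xi> + partial_sum n (shift m \<xi>)"
  unfolding partial_sum_def
  using sum.atLeastLessThan_concat[of 0 m "m + n" "\<lambda>i. x 1 (shift i \<xi>)"]
    sum.shift_bounds_nat_ivl[of "\<lambda>i. x 1 (shift i \<xi>)" 0 m n]
  by (simp add: atLeast0LessThan add.commute)

lemma x_le_partial_sum: "x n \<xi> \<le> partial_sum n \<xi>"
proof (induction n)
  case (Suc n)
  then show ?case using subadd[of n 1 \<xi>] by (simp add: partial_sum_def)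
qed (simp add: zero partial_sum_def)

sublocale S: superadditive p partial_sum
proof
  show "partial_sum n \<in> borel_measurable (iid p)" for n unfolding partial_sum_def[abs_def] by measurable
  show "0 \<le> partial_sum n \<xi>" for n \<xi> unfolding partial_sum_def using nonneg by (intro sum_nonneg) auto
qed (simp add: partial_sum_add)

text \<open>The defect of \<open>x\<close> from additivity is nonnegative and superadditive, so the
  preceding bounds control it from both sides.\<close>

sublocale D: superadditive p "\<lambda>n \<xi>. partial_sum n \<xi> - x n \<xi>"
proof
  show "(\<lambda>\<xi>. partial_sum n \<xi> - x n \<xi>) \<in> borel_measurable (iid p)" for n by measurable
  show "0 \<le> partial_sum n \<xi> - x n \<xi>" for n \<xi> using x_le_partial_sum[of n \<xi>] by simp
  show "partial_sum m \<xi> - x m \<xi> + (partial_sum n (shift m \<xi>) - x n (shift m \<xi>)) \<le> partial_sum (m + n) \<xi> - x (m + n) \<xi>" for m n \<xi>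
    using subadd[of m n \<xi>] by (simp add: partial_sum_add)
qed

definition "mean n = enn2real (\<integral>\<^sup>+ \<xi>. x n \<xi> \<partial>iid p)"

lemma nn_integral_partial_sum: "(\<integral>\<^sup>+ \<xi>. partial_sum n \<xi> \<partial>iid p) = ennreal (mean 1 * n)"
proof -
  have "(\<integral>\<^sup>+ \<xi>. partial_sum n \<xi> \<partial>iid p) = (\<Sum>i<n. \<integral>\<^sup>+ \<xi>. ennreal (x 1 (shift i \<xi>)) \<partial>iid p)"
    unfolding partial_sum_def using nonneg
    by (subst nn_integral_sum[symmetric]) (auto intro!: nn_integral_cong simp: sum_ennreal)
  also have "\<dots> = (\<Sum>i<n. ennreal (mean 1))"
  proof (intro sum.cong refl)
    fix i
    have "(\<integral>\<^sup>+ \<xi>. ennreal (x 1 (shift i \<xi>)) \<partial>iid p) = (\<integral>\<^sup>+ \<xi>. ennreal (x 1 \<xi>) \<partial>iid p)"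
      by (rule nn_integral_shift) measurable
    then show "(\<integral>\<^sup>+ \<xi>. ennreal (x 1 (shift i \<xi>)) \<partial>iid p) = ennreal (mean 1)"
      using integrable by (simp add: mean_def)
  qed
  finally show ?thesis by (simp add: mean_def ennreal_mult'' ennreal_of_nat_eq_real_of_nat mult.commute)
qed

lemma nn_integral_x: "(\<integral>\<^sup>+ \<xi>. x n \<xi> \<partial>iid p) = ennreal (mean n)"
proof -
  have "(\<integral>\<^sup>+ \<xi>. x n \<xi> \<partial>iid p) \<le> (\<integral>\<^sup>+ \<xi>. partial_sum n \<xi> \<partial>iid p)"
    by (intro nn_integral_mono ennreal_leI x_le_partial_sum)
  also have "\<dots> < \<infinity>" by (simp add: nn_integral_partial_sum)
  finally show ?thesis by (simp add: mean_def)
qed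

lemma mean_nonneg: "0 \<le> mean n" by (simp add: mean_def)

lemma mean_le: "mean n \<le> mean 1 * n"
proof -
  have "ennreal (mean n) \<le> ennreal (mean 1 * n)"
    unfolding nn_integral_x[symmetric] nn_integral_partial_sum[symmetric]
    by (intro nn_integral_mono ennreal_leI x_le_partial_sum)
  then show ?thesis using mean_nonneg by (subst (asm) ennreal_le_iff) auto
qed

lemma nn_integral_D: "(\<integral>\<^sup>+ \<xi>. partial_sum n \<xi> - x n \<xi> \<partial>iid p) = ennreal (mean 1 * n - mean n)"
proof -
  have "(\<integral>\<^sup>+ \<xi>. partial_sum n \<xi> - x n \<xi> \<partial>iid p) + ennreal (mean n) = ennreal (mean 1 * n)"
    unfolding nn_integral_x[symmetric] nn_integral_partial_sum[symmetric]
    using nonneg x_le_partial_sum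
    by (subst nn_integral_add[symmetric]) (auto simp: ennreal_plus[symmetric] simp del: ennreal_plus)
  moreover have "ennreal (mean 1 * n) = ennreal (mean 1 * n - mean n) + ennreal (mean n)"
    using mean_le[of n] mean_nonneg[of n] by (simp add: ennreal_plus[symmetric] del: ennreal_plus)
  ultimately show ?thesis by simp
qed

definition "rate = (INF n\<in>{1..}. mean n / real n)"

lemma rate_le: "1 \<le> n \<Longrightarrow> rate * n \<le> mean n"
proof -
  assume n: "1 \<le> n"
  have "rate \<le> mean n / n" unfolding rate_def
    using n mean_nonneg by (intro cINF_lower bdd_belowI2[of _ 0]) auto
  then show ?thesis using n by (simp add: field_simps)
qed

lemma rate_greatest: "(\<And>n. 1 \<le> n \<Longrightarrow> c * n \<le> mean n) \<Longrightarrow> c \<le> rate"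
  unfolding rate_def by (intro cINF_greatest) (auto simp: field_simps)

lemma AE_partial_sum_bounds:
  fixes \<delta> :: real
  assumes "\<delta> > 0"
  shows "AE \<xi> in iid p. eventually (\<lambda>n. \<bar>partial_sum n \<xi> - mean 1 * n\<bar> \<le> \<delta> * n) sequentially"
proof -
  have 1: "AE \<xi> in iid p. eventually (\<lambda>n. partial_sum n \<xi> \<le> (mean 1 + \<delta>) * n) sequentially"
    using assms mean_nonneg by (intro S.AE_eventually_le[of "mean 1"]) (auto simp: nn_integral_partial_sum)
  have 2: "AE \<xi> in iid p. eventually (\<lambda>n. (mean 1 - \<delta>) * n \<le> partial_sum n \<xi>) sequentially"
  proof (cases "mean 1 - \<delta> \<ge> 0")
    case True
    then show ?thesis using assms
      by (intro S.AE_eventually_ge[of "mean 1 - \<delta>" 1]) (auto simp: nn_integral_partial_sum ennreal_less_iff)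
  next
    case False
    then show ?thesis using S.nonneg by (intro AE_I2 always_eventually allI) (meson mult_nonpos_nonneg nle_le of_nat_0_le_iff order.trans)
  qed
  from 1 2 show ?thesis
  proof eventually_elim
    case (elim \<xi>)
    then show ?case by eventually_elim (simp add: abs_le_iff algebra_simps)
  qed
qed

text \<open>\<open>x\<close> is the difference of the additive process, which grows at rate
  \<open>mean 1\<close>, and the defect. The means of the defect are at most
  \<open>(mean 1 - rate) * n\<close>, and for some single \<open>k\<close> almost this large, since
  \<open>rate\<close> is an infimum. These are the inputs of the two bounds.\<close>

theorem kingman: "AE \<xi> in iid p. (\<lambda>n. x n \<xi> / n) \<longlonglongrightarrow> rate"
proof -
  have close: "AE \<xi> in iid p. eventually (\<lambda>n. \<bar>x n \<xi> - rate * n\<bar> \<le> \<delta> * n) sequentially" if \<delta>: "\<delta> > 0" for \<delta> :: real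
  proof -
    have "\<not> rate + \<delta> / 4 \<le> rate" using \<delta> by simp
    then obtain k where k: "1 \<le> k" "mean k < (rate + \<delta> / 4) * k"
      using rate_greatest[of "rate + \<delta> / 4"] by (meson not_le)
    have rate0: "rate \<le> mean 1" using rate_le[of 1] by simp
    have 1: "AE \<xi> in iid p. eventually (\<lambda>n. partial_sum n \<xi> - x n \<xi> \<le> (mean 1 - rate + \<delta> / 2) * n) sequentially"
    proof (rule D.AE_eventually_le)
      fix n
      have "mean 1 * n - mean n \<le> (mean 1 - rate) * n" 
        using rate_le[of n] mean_nonneg[of 0] by (cases "n = 0") (auto simp: algebra_simps)
      then show "(\<integral>\<^sup>+ \<xi>. partial_sum n \<xi> - x n \<xi> \<partial>iid p) \<le> ennreal ((mean 1 - rate) * n)"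
        unfolding nn_integral_D by (rule ennreal_leI)
    qed (use \<delta> rate0 in auto)
    have 2: "AE \<xi> in iid p. eventually (\<lambda>n. (mean 1 - rate - \<delta> / 2) * n \<le> partial_sum n \<xi> - x n \<xi>) sequentially"
    proof (cases "mean 1 - rate - \<delta> / 2 \<ge> 0")
      case True
      have "(mean 1 - rate - \<delta> / 2) * k < mean 1 * k - mean k"
      proof -
        have "(\<delta> / 4) * k > 0" using \<delta> k by simp
        then show ?thesis using k(2) by (simp add: algebra_simps)
      qed
      then show ?thesis using True k
        by (intro D.AE_eventually_ge[of _ k]) (auto simp: nn_integral_D ennreal_less_iff)
    next
      case False
      then show ?thesis using D.nonneg by (intro AE_I2 always_eventually allI) (meson mult_nonpos_nonneg nle_le of_nat_0_le_iff order.trans)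
    qed
    have 3: "AE \<xi> in iid p. eventually (\<lambda>n. \<bar>partial_sum n \<xi> - mean 1 * n\<bar> \<le> (\<delta> / 2) * n) sequentially"
      using \<delta> by (intro AE_partial_sum_bounds) simp
    from 1 2 3 show ?thesis
    proof eventually_elim
      case (elim \<xi>)
      then show ?case
      proof eventually_elim
        case (elim n)
        then show ?case unfolding abs_le_iff by (simp add: algebra_simps)
      qed
    qed
  qed
  have "AE \<xi> in iid p. \<forall>j::nat. eventually (\<lambda>n. \<bar>x n \<xi> - rate * n\<bar> \<le> (1 / (real j + 1)) * n) sequentially"
    unfolding AE_all_countable by (intro allI close) simp
  then show ?thesis
  proof eventually_elim
    case (elim \<xi>)
    show ?case
    proof (rule tendstoI)
      fix e :: real assume "e > 0"
      then obtain j :: nat where j: "1 / (real j + 1) < e" using nat_approx_posE[of e] by (auto simp: add.commute)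
      have "eventually (\<lambda>n. \<bar>x n \<xi> - rate * n\<bar> \<le> (1 / (real j + 1)) * n) sequentially" using elim by blast
      with eventually_gt_at_top[of 0] show "eventually (\<lambda>n. dist (x n \<xi> / n) rate < e) sequentially"
      proof eventually_elim
        case (elim n)
        have "x n \<xi> / n - rate = (x n \<xi> - rate * n) / n" using elim by (simp add: field_simps)
        then have "dist (x n \<xi> / n) rate = \<bar>x n \<xi> - rate * n\<bar> / n" by (simp add: dist_real_def)
        also have "\<dots> \<le> 1 / (real j + 1)" using elim by (simp add: divide_le_eq)
        finally show ?case using j by simp
      qed
    qed
  qed
qed

end

section \<open>Walks with gates\<close>

lemma nn_integral_letter_pmf:
  assumes "0 \<le> \<eta>" "\<eta> \<le> 1" "0 < N"
  shows "(\<integral>\<^sup>+ l. g l \<partial>letter_pmf \<eta> N \<nu>) =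
    ennreal \<eta> * ((\<Sum>k<N. g (Inl k)) / of_nat N) + ennreal (1 - \<eta>) * (\<integral>\<^sup>+ b. g (Inr b) \<partial>\<nu>)"
proof -
  have "(\<integral>\<^sup>+ l. g l \<partial>letter_pmf \<eta> N \<nu>) =
      (\<integral>\<^sup>+ f. (\<integral>\<^sup>+ l. g l \<partial>(if f then map_pmf Inl (pmf_of_set {..<N}) else map_pmf Inr \<nu>)) \<partial>bernoulli_pmf \<eta>)"
    unfolding letter_pmf_def by (simp add: measure_pmf_bind nn_integral_bind[where B = "count_space UNIV"] measure_pmf_in_subprob_algebra)
  also have "\<dots> = ennreal \<eta> * (\<integral>\<^sup>+ l. g l \<partial>map_pmf Inl (pmf_of_set {..<N})) + ennreal (1 - \<eta>) * (\<integral>\<^sup>+ l. g l \<partial>map_pmf Inr \<nu>)"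
    using assms by (simp add: nn_integral_bernoulli_pmf mult.commute)
  also have "(\<integral>\<^sup>+ l. g l \<partial>map_pmf Inl (pmf_of_set {..<N})) = (\<Sum>k<N. g (Inl k)) / of_nat N"
    using assms by (simp add: nn_integral_map_pmf nn_integral_pmf_of_set lessThan_empty_iff ennreal_of_nat_eq_real_of_nat)
  finally show ?thesis by (simp add: nn_integral_map_pmf)
qed

lemma nn_integral_iid_Suc:
  assumes "f \<in> borel_measurable (iid p)"
  shows "(\<integral>\<^sup>+ \<xi>. f \<xi> \<partial>iid p) = (\<integral>\<^sup>+ a. (\<integral>\<^sup>+ \<omega>. f (case_nat a \<omega>) \<partial>iid p) \<partial>measure_pmf p)"
proof -
  interpret sequence_space "measure_pmf p" by (rule sequence_space_iid)
  have m: "(\<lambda>(s, \<omega>). case_nat s \<omega>) \<in> measurable (measure_pmf p \<Otimes>\<^sub>M iid p) (iid p)"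
    by measurable
  have "(\<integral>\<^sup>+ \<xi>. f \<xi> \<partial>iid p) = (\<integral>\<^sup>+ \<xi>. f \<xi> \<partial>distr (measure_pmf p \<Otimes>\<^sub>M iid p) (iid p) (\<lambda>(s, \<omega>). case_nat s \<omega>))"
    by (simp add: PiM_iter)
  also have "\<dots> = (\<integral>\<^sup>+ z. f (case z of (s, \<omega>) \<Rightarrow> case_nat s \<omega>) \<partial>(measure_pmf p \<Otimes>\<^sub>M iid p))"
    using assms by (subst nn_integral_distr[OF m]) auto
  also have "\<dots> = (\<integral>\<^sup>+ a. (\<integral>\<^sup>+ \<omega>. f (case_nat a \<omega>) \<partial>iid p) \<partial>measure_pmf p)"
    using measurable_compose[OF m assms] by (subst P.nn_integral_fst[symmetric]) (auto simp: split_def)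
  finally show ?thesis .
qed

lemma nn_integral_iid_split:
  assumes "f \<in> borel_measurable (iid p)"
  shows "(\<integral>\<^sup>+ \<xi>. f \<xi> \<partial>iid p) = (\<integral>\<^sup>+ \<omega>. (\<integral>\<^sup>+ \<omega>'. f (comb_seq i \<omega> \<omega>') \<partial>iid p) \<partial>iid p)"
proof -
  interpret sequence_space "measure_pmf p" by (rule sequence_space_iid)
  have m: "(\<lambda>(s, \<omega>). comb_seq i s \<omega>) \<in> measurable (iid p \<Otimes>\<^sub>M iid p) (iid p)"
    by (rule measurable_comb_seq)
  have "(\<integral>\<^sup>+ \<xi>. f \<xi> \<partial>iid p) = (\<integral>\<^sup>+ \<xi>. f \<xi> \<partial>distr (iid p \<Otimes>\<^sub>M iid p) (iid p) (\<lambda>(s, \<omega>). comb_seq i s \<omega>))"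
    by (simp add: PiM_comb_seq)
  also have "\<dots> = (\<integral>\<^sup>+ z. f (case z of (s, \<omega>) \<Rightarrow> comb_seq i s \<omega>) \<partial>(iid p \<Otimes>\<^sub>M iid p))"
    using assms by (subst nn_integral_distr[OF m]) auto
  also have "\<dots> = (\<integral>\<^sup>+ \<omega>. (\<integral>\<^sup>+ \<omega>'. f (comb_seq i \<omega> \<omega>') \<partial>iid p) \<partial>iid p)"
    using measurable_compose[OF m assms] by (subst P.nn_integral_fst[symmetric]) (auto simp: split_def)
  finally show ?thesis .
qed

text \<open>Reversing the first \<open>i\<close> letters preserves the law. This turns statements
  about the past of the time \<open>i\<close> into statements about a forward walk.\<close>

lemma nn_integral_iid_reverse:
  assumes f: "f \<in> borel_measurable (iid p)"
  shows "(\<integral>\<^sup>+ \<omega>. f (\<lambda>m. if m < i then \<omega> (i - 1 - m) else \<omega> m) \<partial>iid p) = (\<integral>\<^sup>+ \<omega>. f \<omega> \<partial>iid p)"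
proof -
  define t where "t m = (if m < i then i - 1 - m else m)" for m
  have "inj t" by (auto simp: inj_on_def t_def split: if_splits)
  then have "distr (iid p) (PiM UNIV (\<lambda>_. measure_pmf p)) (\<lambda>\<omega>. \<lambda>n\<in>UNIV. \<omega> (t n)) = PiM UNIV (\<lambda>_. measure_pmf p)"
    by (intro distr_PiM_reindex) (auto intro: measure_pmf.prob_space_axioms)
  then have d: "distr (iid p) (iid p) (\<lambda>\<omega> n. \<omega> (t n)) = iid p" by (simp add: restrict_def)
  have m: "(\<lambda>\<omega> n. \<omega> (t n)) \<in> measurable (iid p) (iid p)" by (rule measurable_PiM_single') auto
  have "(\<integral>\<^sup>+ \<omega>. f \<omega> \<partial>iid p) = (\<integral>\<^sup>+ \<omega>. f (\<lambda>n. \<omega> (t n)) \<partial>iid p)"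
    using nn_integral_distr[OF m, of f] f by (simp add: d)
  moreover have "(\<lambda>n. \<omega> (t n)) = (\<lambda>m. if m < i then \<omega> (i - 1 - m) else \<omega> m)" for \<omega> :: "nat \<Rightarrow> 'a" by (auto simp: t_def)
  ultimately show ?thesis by simp
qed

lemma hits_iff:
  "hits act x0 n R w \<xi> \<longleftrightarrow> (\<exists>m<n. isl (\<xi> m) \<and> w (walk (\<lambda>i. act (\<xi> i)) m x0) \<in> R)"
proof (induction n arbitrary: w \<xi>)
  case (Suc n)
  have W: "walk (\<lambda>i. f i) (Suc m) = f 0 \<circ> walk (\<lambda>i. f (Suc i)) m" for f :: "nat \<Rightarrow> 'b \<Rightarrow> 'b" and m
  proof (induction m)
    case (Suc m)
    have "walk f (Suc (Suc m)) = walk f (Suc m) \<circ> f (Suc m)" by simp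
    then show ?case unfolding Suc by (simp add: comp_assoc)
  qed simp
  show ?case by (simp add: Suc Ex_less_Suc2 W del: walk.simps(2))
qed simp

lemma walk_cong: "(\<And>i. i < n \<Longrightarrow> f i = g i) \<Longrightarrow> walk f n = walk g n"
  by (induction n) simp_all

lemma hits_cong:
  assumes "\<And>i. i < n \<Longrightarrow> \<xi> i = \<xi>' i"
  shows "hits act x0 n R w \<xi> = hits act x0 n R w \<xi>'"
proof -
  have "walk (\<lambda>i. act (\<xi> i)) m = walk (\<lambda>i. act (\<xi>' i)) m" "isl (\<xi> m) = isl (\<xi>' m)" if "m < n" for m
    using assms that by (auto intro: walk_cong)
  then show ?thesis unfolding hits_iff by auto
qed

lemma measurable_hits [measurable]:
  fixes p :: "(nat + 'b::countable) pmf"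
  shows "Measurable.pred (iid p) (hits act x0 n R w)"
  by (rule measurable_iid_finite[of n], rule hits_cong) auto

text \<open>Both sides satisfy the same recursion in the first letter. The locale provides the
  bounds on \<open>hit_prob\<close> needed to pass between integrals in the extended and in the real
  numbers.\<close>

lemma emeasure_hits:
  fixes \<nu> :: "'b::countable pmf"
  assumes h: "hitting act \<eta> N B Q W"
  shows "(\<integral>\<^sup>+ \<xi>. of_bool (hits act x0 n R w \<xi>) \<partial>iid (letter_pmf \<eta> N \<nu>)) = ennreal (hit_prob act x0 \<eta> N \<nu> n R w)"
proof (induction n arbitrary: w)
  case (Suc n)
  interpret hitting act x0 \<eta> N \<nu> B Q W by (rule h)
  let ?p = "letter_pmf \<eta> N \<nu>" and ?h = "hit_prob act x0 \<eta> N \<nu>"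
  have [measurable]: "(\<lambda>\<xi>. of_bool (hits act x0 n R w \<xi>) :: ennreal) \<in> borel_measurable (iid ?p)" for n w
    unfolding of_bool_def by measurable
  have N0: "0 < N" using N by simp
  have 1: "(\<integral>\<^sup>+ \<omega>. of_bool (hits act x0 (Suc n) R w (case_nat l \<omega>)) \<partial>iid ?p) =
      (if isl l \<and> w x0 \<in> R then 1 else ennreal (?h n R (w \<circ> act l)))" for l
  proof (cases "isl l \<and> w x0 \<in> R")
    case False
    then show ?thesis using Suc[of "w \<circ> act l"] by (simp only: hits.simps nat.case simp_thms if_False)
  qed simp
  have int: "(\<integral>\<^sup>+ b. ennreal (?h n R (w \<circ> act (Inr b))) \<partial>\<nu>) = ennreal (measure_pmf.expectation \<nu> (\<lambda>b. ?h n R (w \<circ> act (Inr b))))"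
    using \<phi>_bounds by (intro nn_integral_eq_integral measure_pmf.integrable_const_bound[of _ 1]) auto
  have sum: "(\<Sum>k<N. if isl (Inl k :: nat + 'b) \<and> w x0 \<in> R then 1 else ennreal (?h n R (w \<circ> act (Inl k)))) / of_nat N
      = ennreal ((\<Sum>k<N. if w x0 \<in> R then 1 else ?h n R (w \<circ> act (Inl k))) / N)"
  proof -
    have "(\<Sum>k<N. if isl (Inl k :: nat + 'b) \<and> w x0 \<in> R then 1 else ennreal (?h n R (w \<circ> act (Inl k))))
       = (\<Sum>k<N. ennreal (if w x0 \<in> R then 1 else ?h n R (w \<circ> act (Inl k))))" by (intro sum.cong) auto
    also have "\<dots> = ennreal (\<Sum>k<N. if w x0 \<in> R then 1 else ?h n R (w \<circ> act (Inl k)))"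
      using \<phi>_bounds by (intro sum_ennreal) auto
    finally show ?thesis using N0 \<phi>_bounds
      by (simp add: divide_ennreal[symmetric] sum_nonneg ennreal_of_nat_eq_real_of_nat)
  qed
  have nn: "0 \<le> (\<Sum>k<N. if w x0 \<in> R then 1 else ?h n R (w \<circ> act (Inl k))) / N"
    "0 \<le> measure_pmf.expectation \<nu> (\<lambda>b. ?h n R (w \<circ> act (Inr b)))"
    using \<phi>_bounds by (auto intro!: divide_nonneg_nonneg sum_nonneg integral_nonneg_AE)
  have "(\<integral>\<^sup>+ \<xi>. of_bool (hits act x0 (Suc n) R w \<xi>) \<partial>iid ?p) =
      (\<integral>\<^sup>+ l. (if isl l \<and> w x0 \<in> R then 1 else ennreal (?h n R (w \<circ> act l))) \<partial>?p)"
    by (subst nn_integral_iid_Suc) (simp_all only: 1, measurable)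
  also have "\<dots> = ennreal \<eta> * ennreal ((\<Sum>k<N. if w x0 \<in> R then 1 else ?h n R (w \<circ> act (Inl k))) / N)
      + ennreal (1 - \<eta>) * ennreal (measure_pmf.expectation \<nu> (\<lambda>b. ?h n R (w \<circ> act (Inr b))))"
    by (subst nn_integral_letter_pmf[OF \<eta> N0]) (simp only: sum int[symmetric] sum.disc(2) simp_thms if_False)
  also have "\<dots> = ennreal (?h (Suc n) R w)"
    using \<eta> nn by (simp only: hit_prob.simps ennreal_mult ennreal_plus mult_nonneg_nonneg diff_ge_0_iff_ge)
  finally show ?case .
qed simp

text \<open>At the first time \<open>n \<ge> m\<close> with \<open>P n\<close> the next letter is independent of the past, hence a gate
  with probability \<open>\<eta>\<close>.\<close>
lemma AE_eventually_of_gate_times: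
  fixes \<nu> :: "'b::countable pmf"
  assumes \<eta>: "0 < \<eta>" "\<eta> \<le> 1" "0 < N"
    and P: "\<And>n \<xi> \<xi>'. (\<And>i. i < n \<Longrightarrow> \<xi> i = \<xi>' i) \<Longrightarrow> P n \<xi> = P n \<xi>'"
    and AE: "AE \<xi> in iid (letter_pmf \<eta> N \<nu>). eventually (\<lambda>n. isl (\<xi> n) \<longrightarrow> \<not> P n \<xi>) sequentially"
  shows "AE \<xi> in iid (letter_pmf \<eta> N \<nu>). eventually (\<lambda>n. \<not> P n \<xi>) sequentially"
proof -
  let ?p = "letter_pmf \<eta> N \<nu>"
  interpret prob_space "iid ?p" by (rule prob_space_iid)
  have [measurable]: "Measurable.pred (iid ?p) (P n)" for n by (rule measurable_iid_finite[of n], rule P) auto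
  have [measurable]: "Measurable.pred (iid ?p) (\<lambda>\<xi>. isl (\<xi> n))" for n by (rule measurable_iid_finite[of "Suc n"]) auto
  define E where "E m = {\<xi>\<in>space (iid ?p). \<exists>n\<ge>m. P n \<xi>}" for m
  define H where "H m = {\<xi>\<in>space (iid ?p). \<exists>n\<ge>m. P n \<xi> \<and> isl (\<xi> n)}" for m
  have [measurable]: "E m \<in> sets (iid ?p)" "H m \<in> sets (iid ?p)" for m unfolding E_def H_def by measurable
  have le: "\<eta> * prob (E m) \<le> prob (H m)" for m
  proof -
    \<comment> \<open>\<open>n\<close> is the first time from \<open>m\<close> on at which
      \<open>P\<close> holds. This depends on the first \<open>n\<close> letters only, hence is
      independent of \<open>\<xi> n\<close>, and the events for different \<open>n\<close> are
      disjoint.\<close>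
    define F where "F n \<xi> \<longleftrightarrow> m \<le> n \<and> P n \<xi> \<and> (\<forall>l<n. m \<le> l \<longrightarrow> \<not> P l \<xi>)" for n \<xi>
    have Fc: "F n \<xi> = F n \<xi>'" if "\<And>i. i < n \<Longrightarrow> \<xi> i = \<xi>' i" for n \<xi> \<xi>'
      using P[of n \<xi> \<xi>'] P[of _ \<xi> \<xi>'] that unfolding F_def by (metis order.strict_trans)
    have [measurable]: "Measurable.pred (iid ?p) (F n)" for n by (rule measurable_iid_finite[of n], rule Fc) auto
    define G where "G n = {\<xi>\<in>space (iid ?p). F n \<xi>}" for n
    define G' where "G' n = {\<xi>\<in>space (iid ?p). F n \<xi> \<and> isl (\<xi> n)}" for n
    have [measurable]: "G n \<in> sets (iid ?p)" "G' n \<in> sets (iid ?p)" for n unfolding G_def G'_def by measurable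
    have isl: "(\<integral>\<^sup>+ \<omega>'. of_bool (isl (\<omega>' 0)) \<partial>iid ?p) = ennreal \<eta>"
    proof -
      have "(\<integral>\<^sup>+ \<omega>'. of_bool (isl (\<omega>' 0)) \<partial>iid ?p) = (\<integral>\<^sup>+ a. of_bool (isl a) \<partial>?p)"
        by (subst nn_integral_iid_Suc) auto
      also have "\<dots> = ennreal \<eta>" using \<eta> by (subst nn_integral_letter_pmf) (auto simp: ennreal_of_nat_eq_real_of_nat divide_ennreal)
      finally show ?thesis .
    qed
    have "emeasure (iid ?p) (G' n) = ennreal \<eta> * emeasure (iid ?p) (G n)" for n
    proof -
      have "emeasure (iid ?p) (G' n) = (\<integral>\<^sup>+ \<xi>. of_bool (F n \<xi>) * of_bool (isl (\<xi> n)) \<partial>iid ?p)"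
      proof -
        have "emeasure (iid ?p) (G' n) = (\<integral>\<^sup>+ \<xi>. indicator (G' n) \<xi> \<partial>iid ?p)" by simp
        also have "\<dots> = (\<integral>\<^sup>+ \<xi>. of_bool (F n \<xi>) * of_bool (isl (\<xi> n)) \<partial>iid ?p)"
          by (intro nn_integral_cong) (auto simp: G'_def indicator_def)
        finally show ?thesis .
      qed
      also have "\<dots> = (\<integral>\<^sup>+ \<omega>. (\<integral>\<^sup>+ \<omega>'. of_bool (F n (comb_seq n \<omega> \<omega>')) * of_bool (isl (comb_seq n \<omega> \<omega>' n)) \<partial>iid ?p) \<partial>iid ?p)"
        by (rule nn_integral_iid_split) (simp add: of_bool_def)
      also have "\<dots> = (\<integral>\<^sup>+ \<omega>. (\<integral>\<^sup>+ \<omega>'. of_bool (F n \<omega>) * of_bool (isl (\<omega>' 0)) \<partial>iid ?p) \<partial>iid ?p)"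
      proof -
        have "F n (comb_seq n \<omega> \<omega>') = F n \<omega>" "comb_seq n \<omega> \<omega>' n = \<omega>' 0" for \<omega> \<omega>'
          by (rule Fc) (simp_all add: comb_seq_def)
        then show ?thesis by simp
      qed
      also have "\<dots> = (\<integral>\<^sup>+ \<omega>. ennreal \<eta> * of_bool (F n \<omega>) \<partial>iid ?p)"
      proof (intro nn_integral_cong)
        fix \<omega>
        show "(\<integral>\<^sup>+ \<omega>'. of_bool (F n \<omega>) * of_bool (isl (\<omega>' 0)) \<partial>iid ?p) = ennreal \<eta> * of_bool (F n \<omega>)"
          by (cases "F n \<omega>") (simp_all add: isl)
      qed
      also have "\<dots> = ennreal \<eta> * (\<integral>\<^sup>+ \<omega>. indicator (G n) \<omega> \<partial>iid ?p)"
        by (subst nn_integral_cmult[symmetric]) (auto simp: G_def indicator_def intro!: nn_integral_cong)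
      finally show ?thesis by simp
    qed
    then have G': "prob (G' n) = \<eta> * prob (G n)" for n
      using \<eta> by (simp add: emeasure_eq_measure ennreal_mult[symmetric])
    have disj: "disjoint_family G" "disjoint_family G'"
      unfolding disjoint_family_on_def G_def G'_def F_def by (auto; metis linorder_neqE_nat)+
    have 1: "(\<lambda>n. prob (G n)) sums prob (\<Union>n. G n)" by (rule finite_measure_UNION) (auto simp: disj)
    have 2: "(\<lambda>n. prob (G' n)) sums prob (\<Union>n. G' n)" by (rule finite_measure_UNION) (auto simp: disj)
    have "E m \<subseteq> (\<Union>n. G n)"
    proof
      fix \<xi> assume "\<xi> \<in> E m"
      then have ex: "\<exists>n. m \<le> n \<and> P n \<xi>" by (auto simp: E_def)
      define n where "n = (LEAST n. m \<le> n \<and> P n \<xi>)"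
      have "F n \<xi>" using LeastI_ex[OF ex] not_less_Least unfolding F_def n_def by blast
      then show "\<xi> \<in> (\<Union>n. G n)" by (auto simp: G_def)
    qed
    then have "\<eta> * prob (E m) \<le> \<eta> * prob (\<Union>n. G n)" using \<eta> by (intro mult_left_mono finite_measure_mono) auto
    also have "\<dots> = prob (\<Union>n. G' n)" using sums_unique2[OF sums_mult[OF 1, of \<eta>]] 2 by (simp add: G')
    also have "\<dots> \<le> prob (H m)"
    proof (rule finite_measure_mono)
      show "(\<Union>n. G' n) \<subseteq> H m" by (auto simp: G'_def H_def F_def)
    qed measurable
    finally show ?thesis .
  qed
  \<comment> \<open>As \<open>m\<close> grows, the events decrease to \<open>P\<close> holding
    infinitely often, and to \<open>P\<close> holding at infinitely many gate times; the latter is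
    null by hypothesis.\<close>
  have "(\<lambda>m. \<eta> * prob (E m)) \<longlonglongrightarrow> \<eta> * prob (\<Inter>m. E m)"
  proof (intro tendsto_mult_left finite_Lim_measure_decseq)
    show "decseq E" unfolding decseq_def E_def by (blast intro: order.trans)
  qed auto
  moreover have "(\<lambda>m. prob (H m)) \<longlonglongrightarrow> prob (\<Inter>m. H m)"
  proof (intro finite_Lim_measure_decseq)
    show "decseq H" unfolding decseq_def H_def by (blast intro: order.trans)
  qed auto
  ultimately have "\<eta> * prob (\<Inter>m. E m) \<le> prob (\<Inter>m. H m)" using le by (intro LIMSEQ_le) auto
  moreover have "prob (\<Inter>m. H m) = 0"
  proof (rule prob_eq_0[THEN iffD2])
    show "AE \<xi> in iid ?p. \<xi> \<notin> (\<Inter>m. H m)" using AE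
      by eventually_elim (auto simp: H_def eventually_sequentially)
  qed auto
  ultimately have "\<eta> * prob (\<Inter>m. E m) \<le> 0" by simp
  then have "prob (\<Inter>m. E m) = 0" using \<eta> by (simp add: mult_le_0_iff measure_le_0_iff)
  moreover have "(\<Inter>m. E m) \<in> sets (iid ?p)" by measurable
  ultimately have "AE \<xi> in iid ?p. \<xi> \<notin> (\<Inter>m. E m)" by (simp only: prob_eq_0)
  then show ?thesis by eventually_elim (auto simp: E_def eventually_sequentially)
qed


text \<open>For \<open>i \<le> j\<close> this is the increment
  \<open>\<omega>\<^sub>i\<^sup>-\<^sup>1 \<omega>\<^sub>j\<close> of the walk.\<close>

definition seg :: "('l \<Rightarrow> 'x \<Rightarrow> 'x) \<Rightarrow> (nat \<Rightarrow> 'l) \<Rightarrow> nat \<Rightarrow> nat \<Rightarrow> 'x \<Rightarrow> 'x" where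
  "seg act \<xi> i j = walk (\<lambda>m. act (\<xi> (m + i))) (j - i)"

lemma seg_self [simp]: "seg act \<xi> i i = id"
  by (simp add: seg_def)

lemma seg_Suc: "i \<le> j \<Longrightarrow> seg act \<xi> i (Suc j) = seg act \<xi> i j \<circ> act (\<xi> j)"
  by (simp add: seg_def Suc_diff_le)

lemma seg_comp:
  assumes "i \<le> j" "j \<le> k"
  shows "seg act \<xi> i k = seg act \<xi> i j \<circ> seg act \<xi> j k"
  using assms(2)
proof (induction k rule: dec_induct)
  case (step k)
  then show ?case using assms(1) by (simp add: seg_Suc comp_assoc)
qed (simp add: fun_eq_iff)

lemma seg_one: "seg act \<xi> i (Suc i) = act (\<xi> i)"
  by (simp add: seg_Suc)

lemma seg_cong: "(\<And>m. i \<le> m \<Longrightarrow> m < j \<Longrightarrow> \<xi> m = \<xi>' m) \<Longrightarrow> seg act \<xi> i j = seg act \<xi>' i j"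
  unfolding seg_def by (rule walk_cong) simp

lemma seg_shift: "seg act (shift m \<xi>) i j = seg act \<xi> (i + m) (j + m)"
  by (simp add: seg_def shift_def add.assoc)

lemma seg_0: "seg act \<xi> 0 n = walk (\<lambda>i. act (\<xi> i)) n"
  by (simp add: seg_def)

lemma isometry_seg: "(\<And>l. isometry (act l)) \<Longrightarrow> isometry (seg act \<xi> i j)"
proof -
  assume a: "\<And>l. isometry (act l)"
  have "isometry (walk (\<lambda>m. act (f m)) n)" for f n
  proof (induction n)
    case (Suc n)
    show ?case unfolding walk.simps by (intro isometry_comp Suc a)
  qed (unfold walk.simps, rule isometry_id)
  then show ?thesis by (simp add: seg_def)
qed

lemma inv_comp_isometry: "isometry f \<Longrightarrow> isometry g \<Longrightarrow> inv (f \<circ> g) = inv g \<circ> inv f"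
  by (simp add: o_inv_distrib isometryD(1))

text \<open>Looking back from the time \<open>i\<close>, the increments form a walk whose letters
  are the inverses of the earlier letters in reversed order.\<close>

lemma walk_reverse:
  assumes "\<And>l. isometry (act l)" "r \<le> i"
  shows "walk (\<lambda>m. inv (act (\<xi> (i - 1 - m)))) r = inv (seg act \<xi> (i - r) i)"
  using assms(2)
proof (induction r)
  case (Suc r)
  have e: "i - 1 - r = i - Suc r" "Suc (i - Suc r) = i - r" using Suc.prems by auto
  have "seg act \<xi> (i - Suc r) i = act (\<xi> (i - Suc r)) \<circ> seg act \<xi> (i - r) i"
    using seg_comp[of "i - Suc r" "i - r" i act \<xi>] seg_one[of act \<xi> "i - Suc r"] Suc.prems e by simp
  then have "inv (seg act \<xi> (i - Suc r) i) = inv (seg act \<xi> (i - r) i) \<circ> inv (act (\<xi> (i - Suc r)))"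
    by (simp only: inv_comp_isometry[OF assms(1) isometry_seg[OF assms(1)]])
  then show ?case unfolding walk.simps(2) Suc.IH[OF Suc_leD[OF Suc.prems]] e(1) by simp
qed (simp add: fun_eq_iff)

section \<open>Gates that separate the past of the walk from its future\<close>

locale gate_walk = gates x0 N s Bp Bm Dp Dm
  for x0 :: "'x::metric_space" and N :: nat and s Bp Bm Dp Dm +
  fixes act :: "nat + 'b::countable \<Rightarrow> 'x \<Rightarrow> 'x" and \<eta> :: real and \<nu> :: "'b pmf"
  assumes act_gate: "act (Inl k) = s k" and act_iso: "isometry (act l)"
    and \<eta>: "0 < \<eta>" "\<eta> < 1" and N: "24 \<le> N"
begin

abbreviation "\<kappa> \<equiv> letter_pmf \<eta> N \<nu>"

lemma N_pos: "0 < N" using N by simp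

lemma card_pairs1:
  fixes P :: "nat \<Rightarrow> nat \<Rightarrow> bool"
  assumes "\<And>i j k. i < N \<Longrightarrow> j < N \<Longrightarrow> k < N \<Longrightarrow> P i k \<Longrightarrow> P j k \<Longrightarrow> i = j"
  shows "card {(j, k). j < N \<and> k < N \<and> P j k} \<le> N"
proof -
  have "inj_on snd {(j, k). j < N \<and> k < N \<and> P j k}" using assms by (auto simp: inj_on_def)
  then have "card {(j, k). j < N \<and> k < N \<and> P j k} = card (snd ` {(j, k). j < N \<and> k < N \<and> P j k})"
    by (simp add: card_image)
  also have "\<dots> \<le> card {..<N}" by (intro card_mono) auto
  finally show ?thesis by simp
qed

lemma card_pairs2:
  fixes P :: "nat \<Rightarrow> nat \<Rightarrow> bool"
  assumes "\<And>i j k. i < N \<Longrightarrow> j < N \<Longrightarrow> k < N \<Longrightarrow> P k i \<Longrightarrow> P k j \<Longrightarrow> i = j"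
  shows "card {(j, k). j < N \<and> k < N \<and> P j k} \<le> N"
proof -
  have "inj_on fst {(j, k). j < N \<and> k < N \<and> P j k}" using assms by (auto simp: inj_on_def)
  then have "card {(j, k). j < N \<and> k < N \<and> P j k} = card (fst ` {(j, k). j < N \<and> k < N \<and> P j k})"
    by (simp add: card_image)
  also have "\<dots> \<le> card {..<N}" by (intro card_mono) auto
  finally show ?thesis by simp
qed

lemma card_union_pairs:
  fixes P Q :: "nat \<Rightarrow> nat \<Rightarrow> bool"
  assumes "card {(j, k). j < N \<and> k < N \<and> P j k} \<le> a" "card {(j, k). j < N \<and> k < N \<and> Q j k} \<le> b"
  shows "card {(j, k). j < N \<and> k < N \<and> (P j k \<or> Q j k)} \<le> a + b"
proof -
  have "{(j, k). j < N \<and> k < N \<and> (P j k \<or> Q j k)} = {(j, k). j < N \<and> k < N \<and> P j k} \<union> {(j, k). j < N \<and> k < N \<and> Q j k}"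
    by auto
  then show ?thesis using card_Un_le[of "{(j, k). j < N \<and> k < N \<and> P j k}" "{(j, k). j < N \<and> k < N \<and> Q j k}"] assms by simp
qed

lemma card_le_1: "(\<And>i j. i < N \<Longrightarrow> j < N \<Longrightarrow> P i \<Longrightarrow> P j \<Longrightarrow> i = j) \<Longrightarrow> card {j. j < N \<and> P j} \<le> 1"
  by (subst One_nat_def, subst card_le_Suc0_iff_eq) auto

text \<open>\<open>Q\<close> is the part of alignment that \<open>nested_p\<close> requires. For
  each \<open>k\<close> at most one \<open>j\<close> violates the first condition, and for each
  \<open>j\<close> at most one \<open>k\<close> violates the second, hence at most
  \<open>2 * N\<close> bad pairs.\<close>

lemma hitting_forward:
  "hitting act \<eta> N Bp (\<lambda>j w k. \<not> (w (s k x0) \<in> Dp j \<or> inv w x0 \<in> Dm k)) (Collect isometry)"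
proof
  show "card {j. j < N \<and> x \<in> Bp j} \<le> 1" for x
    using sub uniq_p by (intro card_le_1) blast
  show "card {(j, k). j < N \<and> k < N \<and> \<not> \<not> (w (s k x0) \<in> Dp j \<or> inv w x0 \<in> Dm k)} \<le> 2 * N" for w
    unfolding not_not mult_2
    by (intro card_union_pairs card_pairs1[of "\<lambda>j k. w (s k x0) \<in> Dp j"] card_pairs2[of "\<lambda>j k. inv w x0 \<in> Dm k"])
      (auto intro: uniq_p uniq_m)
  show "y \<in> Bp k" if "j < N" "k < N" "w \<in> Collect isometry" "\<not> (w (s k x0) \<in> Dp j \<or> inv w x0 \<in> Dm k)"
    "w (act (Inl k) y) \<in> Bp j" for j k w y
    using that nested_p[of j k w y] by (simp add: act_gate)
qed (use \<eta> N act_iso isometry_comp isometry_id in auto)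

text \<open>The same with start and end exchanged: \<open>nested_m\<close> is applied to
  \<open>inv w\<close>, because the backward walk composes inverse letters.\<close>

lemma hitting_backward:
  "hitting (\<lambda>l. inv (act l)) \<eta> N Bm (\<lambda>j w k. \<not> (w (inv (s k) x0) \<in> Dm j \<or> inv w x0 \<in> Dp k)) (Collect isometry)"
proof
  show "card {j. j < N \<and> x \<in> Bm j} \<le> 1" for x
    using sub uniq_m by (intro card_le_1) blast
  show "card {(j, k). j < N \<and> k < N \<and> \<not> \<not> (w (inv (s k) x0) \<in> Dm j \<or> inv w x0 \<in> Dp k)} \<le> 2 * N" for w
    unfolding not_not mult_2
    by (intro card_union_pairs card_pairs1[of "\<lambda>j k. w (inv (s k) x0) \<in> Dm j"] card_pairs2[of "\<lambda>j k. inv w x0 \<in> Dp k"])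
      (auto intro: uniq_p uniq_m)
  show "y \<in> Bm k" if "j < N" "k < N" "w \<in> Collect isometry" "\<not> (w (inv (s k) x0) \<in> Dm j \<or> inv w x0 \<in> Dp k)"
    "w (inv (act (Inl k)) y) \<in> Bm j" for j k w y
    using that nested_m[of k j "inv w" y] by (simp add: act_gate isometry_inv inv_inv_eq isometryD(1))
qed (use \<eta> N act_iso isometry_comp isometry_inv isometry_id in auto)

lemma sum_hits_forward:
  "(\<Sum>k<N. \<integral>\<^sup>+ \<xi>. of_bool (hits act x0 n (Bp k) id \<xi>) \<partial>iid \<kappa>) \<le> 4"
proof -
  interpret h: hitting act x0 \<eta> N \<nu> Bp "\<lambda>j w k. \<not> (w (s k x0) \<in> Dp j \<or> inv w x0 \<in> Dm k)" "Collect isometry"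
    by (rule hitting_forward)
  have "(\<Sum>k<N. \<integral>\<^sup>+ \<xi>. of_bool (hits act x0 n (Bp k) id \<xi>) \<partial>iid \<kappa>) = ennreal (\<Sum>k<N. h.\<phi> n (Bp k) id)"
    using h.\<phi>_bounds by (subst emeasure_hits[OF hitting_forward]) (simp add: sum_ennreal)
  also have "\<dots> \<le> ennreal 4" using h.hit_bounds[of id n] by (intro ennreal_leI) (simp add: isometry_id)
  finally show ?thesis by simp
qed

text \<open>Earlier gates are tested at their ends and later gates at their starts. Since these conditions get
  weaker when the time interval is shortened, the number of cuts is almost subadditive.\<close>

definition past_bad :: "nat \<Rightarrow> nat \<Rightarrow> (nat \<Rightarrow> nat + 'b) \<Rightarrow> bool" where
  "past_bad i k \<xi> \<longleftrightarrow> (\<exists>j<i. isl (\<xi> j) \<and> inv (seg act \<xi> (Suc j) i) x0 \<in> Bm k)"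

definition future_bad :: "nat \<Rightarrow> nat \<Rightarrow> nat \<Rightarrow> (nat \<Rightarrow> nat + 'b) \<Rightarrow> bool" where
  "future_bad i n k \<xi> \<longleftrightarrow> (\<exists>j<n. i < j \<and> isl (\<xi> j) \<and> seg act \<xi> (Suc i) j x0 \<in> Bp k)"

definition cut :: "(nat \<Rightarrow> nat + 'b) \<Rightarrow> nat \<Rightarrow> nat \<Rightarrow> bool" where
  "cut \<xi> i n \<longleftrightarrow> (\<exists>k<N. \<xi> i = Inl k \<and> \<not> past_bad i k \<xi> \<and> \<not> future_bad i n k \<xi>)"

lemma past_bad_hits:
  "past_bad i k \<xi> \<longleftrightarrow> hits (\<lambda>l. inv (act l)) x0 i (Bm k) id (\<lambda>m. if m < i then \<xi> (i - 1 - m) else \<xi> m)"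
proof -
  have w: "walk (\<lambda>j. inv (act (if j < i then \<xi> (i - 1 - j) else \<xi> j))) m = inv (seg act \<xi> (i - m) i)" if "m \<le> i" for m
  proof -
    have "walk (\<lambda>j. inv (act (if j < i then \<xi> (i - 1 - j) else \<xi> j))) m = walk (\<lambda>j. inv (act (\<xi> (i - 1 - j)))) m"
      using that by (intro walk_cong) simp
    then show ?thesis using walk_reverse[of act m i \<xi>, OF act_iso that] by simp
  qed
  have "hits (\<lambda>l. inv (act l)) x0 i (Bm k) id (\<lambda>m. if m < i then \<xi> (i - 1 - m) else \<xi> m) \<longleftrightarrow>
    (\<exists>m<i. isl (\<xi> (i - 1 - m)) \<and> inv (seg act \<xi> (i - m) i) x0 \<in> Bm k)"
    unfolding hits_iff using w by (auto simp: less_imp_le)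
  also have "\<dots> \<longleftrightarrow> past_bad i k \<xi>" unfolding past_bad_def
  proof safe
    fix m assume "m < i" "isl (\<xi> (i - 1 - m))" "inv (seg act \<xi> (i - m) i) x0 \<in> Bm k"
    then show "\<exists>j<i. isl (\<xi> j) \<and> inv (seg act \<xi> (Suc j) i) x0 \<in> Bm k"
      by (intro exI[of _ "i - 1 - m"]) (simp add: Suc_diff_Suc)
  next
    fix j assume "j < i" "isl (\<xi> j)" "inv (seg act \<xi> (Suc j) i) x0 \<in> Bm k"
    then show "\<exists>m<i. isl (\<xi> (i - 1 - m)) \<and> inv (seg act \<xi> (i - m) i) x0 \<in> Bm k"
      by (intro exI[of _ "i - 1 - j"]) (simp add: Suc_diff_Suc)
  qed
  finally show ?thesis by simp
qed

lemma sum_past_bad: "(\<Sum>k<N. \<integral>\<^sup>+ \<xi>. of_bool (past_bad i k \<xi>) \<partial>iid \<kappa>) \<le> 4"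
proof -
  interpret h: hitting "\<lambda>l. inv (act l)" x0 \<eta> N \<nu> Bm "\<lambda>j w k. \<not> (w (inv (s k) x0) \<in> Dm j \<or> inv w x0 \<in> Dp k)" "Collect isometry"
    by (rule hitting_backward)
  have [measurable]: "(\<lambda>\<xi>. of_bool (hits (\<lambda>l. inv (act l)) x0 n (Bm k) id \<xi>) :: ennreal) \<in> borel_measurable (iid \<kappa>)" for n k
    unfolding of_bool_def by measurable
  have "(\<integral>\<^sup>+ \<xi>. of_bool (past_bad i k \<xi>) \<partial>iid \<kappa>) = ennreal (h.\<phi> i (Bm k) id)" for k
    unfolding past_bad_hits emeasure_hits[OF hitting_backward, symmetric]
    by (rule nn_integral_iid_reverse) measurable
  then have "(\<Sum>k<N. \<integral>\<^sup>+ \<xi>. of_bool (past_bad i k \<xi>) \<partial>iid \<kappa>) = ennreal (\<Sum>k<N. h.\<phi> i (Bm k) id)"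
    using h.\<phi>_bounds by (simp add: sum_ennreal)
  also have "\<dots> \<le> ennreal 4" using h.hit_bounds[of id i] by (intro ennreal_leI) (simp add: isometry_id)
  finally show ?thesis by simp
qed

text \<open>The summand 1 is what each separating gate gains in \<open>far\<close>; it keeps the
  lower bound positive even if the ordinary steps fix \<open>x0\<close>. The truncation keeps the
  process bounded.\<close>

definition step_len :: "real \<Rightarrow> 'b \<Rightarrow> real" where
  "step_len M b = 1 + min M (dist x0 (act (Inr b) x0))"

text \<open>Two cuts with exactly one ordinary letter between them. This letter has law
  \<open>\<nu>\<close> independently of the rest, so the expected term is comparable to the mean of
  \<open>step_len M\<close>.\<close>

definition cut_term :: "real \<Rightarrow> (nat \<Rightarrow> nat + 'b) \<Rightarrow> nat \<Rightarrow> nat \<Rightarrow> real" where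
  "cut_term M \<xi> i n = (if cut \<xi> i n \<and> cut \<xi> (Suc (Suc i)) n \<and> Suc (Suc i) < n
     then (case \<xi> (Suc i) of Inl k \<Rightarrow> 0 | Inr b \<Rightarrow> step_len M b) else 0)"

definition cut_sum :: "real \<Rightarrow> nat \<Rightarrow> (nat \<Rightarrow> nat + 'b) \<Rightarrow> real" where
  "cut_sum M n \<xi> = (\<Sum>i<n. cut_term M \<xi> i n)"

lemma step_len_bounds: "0 \<le> M \<Longrightarrow> 1 \<le> step_len M b" "step_len M b \<le> 1 + M"
  by (auto simp: step_len_def)

lemma cut_term_bounds: assumes "0 \<le> M" shows "0 \<le> cut_term M \<xi> i n" "cut_term M \<xi> i n \<le> 1 + M"
  using assms step_len_bounds[of M] by (auto simp: cut_term_def split: sum.split intro: order.trans[of 0 1])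

lemma cut_mono: "cut \<xi> i (m + n) \<Longrightarrow> cut \<xi> i m"
  unfolding cut_def future_bad_def by fastforce

lemma cut_shift: "cut \<xi> (i + m) (m + n) \<Longrightarrow> cut (shift m \<xi>) i n"
proof -
  assume "cut \<xi> (i + m) (m + n)"
  then obtain k where k: "k < N" "\<xi> (i + m) = Inl k" "\<not> past_bad (i + m) k \<xi>" "\<not> future_bad (i + m) (m + n) k \<xi>"
    by (auto simp: cut_def)
  have "\<not> past_bad i k (shift m \<xi>)"
  proof
    assume "past_bad i k (shift m \<xi>)"
    then obtain j where "j < i" "isl (shift m \<xi> j)" "inv (seg act (shift m \<xi>) (Suc j) i) x0 \<in> Bm k"
      by (auto simp: past_bad_def)
    then have "past_bad (i + m) k \<xi>" unfolding past_bad_def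
      by (intro exI[of _ "j + m"]) (simp add: seg_shift, simp add: shift_def)
    then show False using k by simp
  qed
  moreover have "\<not> future_bad i n k (shift m \<xi>)"
  proof
    assume "future_bad i n k (shift m \<xi>)"
    then obtain j where "j < n" "i < j" "isl (shift m \<xi> j)" "seg act (shift m \<xi>) (Suc i) j x0 \<in> Bp k"
      by (auto simp: future_bad_def)
    then have "future_bad (i + m) (m + n) k \<xi>" unfolding future_bad_def
      by (intro exI[of _ "j + m"]) (simp add: seg_shift, simp add: shift_def)
    then show False using k by simp
  qed
  ultimately show ?thesis using k by (auto simp: cut_def shift_def)
qed

lemma cut_term_shift: "0 \<le> M \<Longrightarrow> cut_term M \<xi> (i + m) (m + n) \<le> cut_term M (shift m \<xi>) i n"
  using cut_shift[of \<xi> i m n] cut_shift[of \<xi> "Suc (Suc i)" m n] cut_term_bounds(1)[of M "shift m \<xi>" i n]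
  by (auto simp: cut_term_def shift_def add.commute split: if_splits)

lemma cut_term_mono: "0 \<le> M \<Longrightarrow> Suc (Suc i) < m \<Longrightarrow> cut_term M \<xi> i (m + n) \<le> cut_term M \<xi> i m"
  using cut_mono[of \<xi> i m n] cut_mono[of \<xi> "Suc (Suc i)" m n] cut_term_bounds(1)[of M \<xi> i m]
  by (auto simp: cut_term_def split: if_splits)

text \<open>Only the terms whose pair of gates straddles the time \<open>m\<close> get lost.\<close>
lemma cut_sum_add_le:
  assumes M: "0 \<le> M"
  shows "cut_sum M (m + n) \<xi> \<le> cut_sum M m \<xi> + cut_sum M n (shift m \<xi>) + 2 * (1 + M)"
proof -
  have "cut_sum M (m + n) \<xi> = (\<Sum>i<m. cut_term M \<xi> i (m + n)) + (\<Sum>i<n. cut_term M \<xi> (i + m) (m + n))"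
    unfolding cut_sum_def
    using sum.atLeastLessThan_concat[of 0 m "m + n" "\<lambda>i. cut_term M \<xi> i (m + n)"]
      sum.shift_bounds_nat_ivl[of "\<lambda>i. cut_term M \<xi> i (m + n)" 0 m n]
    by (simp add: atLeast0LessThan add.commute)
  moreover have "(\<Sum>i<n. cut_term M \<xi> (i + m) (m + n)) \<le> cut_sum M n (shift m \<xi>)"
    unfolding cut_sum_def by (intro sum_mono cut_term_shift M)
  moreover have "(\<Sum>i<m. cut_term M \<xi> i (m + n)) \<le> (\<Sum>i<m. cut_term M \<xi> i m + (if m \<le> Suc (Suc i) then 1 + M else 0))"
  proof (rule sum_mono)
    fix i assume "i \<in> {..<m}"
    show "cut_term M \<xi> i (m + n) \<le> cut_term M \<xi> i m + (if m \<le> Suc (Suc i) then 1 + M else 0)"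
      using cut_term_mono[OF M, of i m \<xi> n] cut_term_bounds[OF M, of \<xi> i m] cut_term_bounds[OF M, of \<xi> i "m + n"]
      by (auto simp: not_le)
  qed
  moreover have "\<dots> = cut_sum M m \<xi> + real (card {i. i < m \<and> m \<le> Suc (Suc i)}) * (1 + M)"
    by (simp add: cut_sum_def sum.distrib sum.If_cases Collect_conj_eq lessThan_def)
  moreover have "real (card {i. i < m \<and> m \<le> Suc (Suc i)}) * (1 + M) \<le> 2 * (1 + M)"
  proof (rule mult_right_mono)
    have "card {i. i < m \<and> m \<le> Suc (Suc i)} \<le> card {m - 2..<m}" by (intro card_mono) auto
    then show "real (card {i. i < m \<and> m \<le> Suc (Suc i)}) \<le> 2" by simp
  qed (use M in simp)
  ultimately show ?thesis by linarith
qed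

end


lemma measurable_nn_integral_comb_seq:
  assumes "f \<in> borel_measurable (iid p)"
  shows "(\<lambda>\<omega>. \<integral>\<^sup>+ \<omega>'. f (comb_seq i \<omega> \<omega>') \<partial>iid p) \<in> borel_measurable (iid p)"
proof -
  interpret sequence_space "measure_pmf p" by (rule sequence_space_iid)
  have m: "(\<lambda>(s, \<omega>). comb_seq i s \<omega>) \<in> measurable (iid p \<Otimes>\<^sub>M iid p) (iid p)"
    by (rule measurable_comb_seq)
  have "(\<lambda>(s, \<omega>). f (comb_seq i s \<omega>)) \<in> borel_measurable (iid p \<Otimes>\<^sub>M iid p)"
    using measurable_compose[OF m assms] by (simp add: split_def)
  then show ?thesis by (rule P.borel_measurable_nn_integral)
qed

section \<open>Cuts as a lower bound for the distance, and their expected number\<close>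

context gate_walk
begin

lemma seg_iso: "isometry (seg act \<xi> i j)"
  by (rule isometry_seg) (rule act_iso)

lemma dist_seg:
  assumes "i \<le> j" "j \<le> k"
  shows "dist (seg act \<xi> i j x) (seg act \<xi> i k y) = dist x (seg act \<xi> j k y)"
  unfolding seg_comp[OF assms] comp_apply by (rule isometryD(2)[OF seg_iso])

text \<open>The next cut after \<open>i\<close> separates the end of gate \<open>i\<close> from the
  start of gate \<open>n\<close>, so the distance splits there with a gain of 1. Since cuts are
  tested against gates only, \<open>i\<close> and \<open>n\<close> have to be gates; the horizon
  \<open>Suc n\<close> makes the gate at time \<open>n\<close> one of those tested.\<close>

lemma cut_sum_from_le_dist:
  assumes M: "0 \<le> M" and "isl (\<xi> n)" and "i < n" and "isl (\<xi> i)"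
  shows "(\<Sum>l\<in>{i..<Suc n}. cut_term M \<xi> l (Suc n)) \<le> dist (seg act \<xi> 0 (Suc i) x0) (seg act \<xi> 0 n x0) + 1"
  using assms(3,4)
proof (induction "n - i" arbitrary: i rule: less_induct)
  case less
  let ?F = "\<lambda>i. \<Sum>l\<in>{i..<Suc n}. cut_term M \<xi> l (Suc n)"
  let ?e = "\<lambda>i. seg act \<xi> 0 (Suc i) x0" and ?b = "\<lambda>i. seg act \<xi> 0 i x0"
  show ?case
  proof (cases "\<exists>l. i < l \<and> l \<le> n \<and> cut \<xi> l (Suc n)")
    case False
    then have "cut_term M \<xi> l (Suc n) = 0" if "l \<in> {i..<Suc n}" for l
      using that by (cases "l = i") (auto simp: cut_term_def)
    then have "?F i = 0" by (intro sum.neutral) auto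
    then show ?thesis by simp
  next
    case True
    define i' where "i' = (LEAST l. i < l \<and> l \<le> n \<and> cut \<xi> l (Suc n))"
    have i': "i < i'" "i' \<le> n" "cut \<xi> i' (Suc n)" using LeastI_ex[OF True] by (auto simp: i'_def)
    have least: "\<not> cut \<xi> l (Suc n)" if "i < l" "l < i'" for l
      using not_less_Least[of l "\<lambda>l. i < l \<and> l \<le> n \<and> cut \<xi> l (Suc n)"] that i' by (auto simp: i'_def)
    have "?F i = (\<Sum>l\<in>{i..<i'}. cut_term M \<xi> l (Suc n)) + ?F i'"
      using i' by (intro sum.atLeastLessThan_concat[symmetric]) auto
    also have "(\<Sum>l\<in>{i..<i'}. cut_term M \<xi> l (Suc n)) = (\<Sum>l\<in>{i}. cut_term M \<xi> l (Suc n))"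
      \<comment> \<open>A nonzero term needs cuts at both of its ends, so before \<open>i'\<close>
        only the term at \<open>i\<close> can survive.\<close>
      using i' least by (intro sum.mono_neutral_right) (auto simp: cut_term_def)
    finally have F: "?F i = cut_term M \<xi> i (Suc n) + ?F i'" by simp
    have step: "cut_term M \<xi> i (Suc n) \<le> dist (?e i) (?b i') + 1"
    proof (cases "cut \<xi> (Suc (Suc i)) (Suc n) \<and> Suc (Suc i) < Suc n \<and> \<not> isl (\<xi> (Suc i))")
      case c: True
      then obtain b where b: "\<xi> (Suc i) = Inr b" by (cases "\<xi> (Suc i)") auto
      then have "\<not> cut \<xi> (Suc i) (Suc n)" by (auto simp: cut_def)
      \<comment> \<open>The letter at \<open>Suc i\<close> is ordinary and cannot be a cut, so the
        gap between the two gates is this single letter.\<close>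
      have "i' = Suc (Suc i)"
      proof (rule ccontr)
        assume "i' \<noteq> Suc (Suc i)"
        moreover have "i' \<noteq> Suc i" using i'(3) \<open>\<not> cut \<xi> (Suc i) (Suc n)\<close> by auto
        ultimately have "Suc (Suc i) < i'" using i'(1) by simp
        then show False using least[of "Suc (Suc i)"] c by auto
      qed
      then have "dist (?e i) (?b i') = dist x0 (act (Inr b) x0)"
        using dist_seg[of 0 "Suc i" "Suc (Suc i)" \<xi> x0 x0] b by (simp add: seg_one)
      then show ?thesis using cut_term_bounds(1)[OF M] b by (auto simp: cut_term_def step_len_def)
    next
      case False
      then have "cut_term M \<xi> i (Suc n) = 0" by (auto simp: cut_term_def split: sum.split)
      then show ?thesis by simp
    qed
    show ?thesis
    proof (cases "i' = n")
      case True
      \<comment> \<open>A cut at \<open>n\<close> itself has no later gate to be separated from. The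
        additional 1 in the claim makes up for the gain missing here.\<close>
      then have "?F i' = 0" by (simp add: cut_term_def)
      then show ?thesis using F step True by simp
    next
      case False
      then have "i' < n" using i' by simp
      obtain k where k: "k < N" "\<xi> i' = Inl k" "\<not> past_bad i' k \<xi>" "\<not> future_bad i' (Suc n) k \<xi>"
        using i'(3) by (auto simp: cut_def)
      have IH: "?F i' \<le> dist (?e i') (?b n) + 1" using k(2) i' \<open>i' < n\<close> by (intro less.hyps) auto
      define u v where "u = seg act \<xi> (Suc i) i'" and "v = seg act \<xi> (Suc i') n"
      have u: "isometry u" unfolding u_def by (rule seg_iso)
      have "inv u x0 \<notin> Bm k" using k(3) i' less.prems by (auto simp: past_bad_def u_def)
      moreover have "v x0 \<notin> Bp k" using k(4) \<open>i' < n\<close> assms(2) by (auto simp: future_bad_def v_def)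
      ultimately have far: "dist (inv u x0) x0 + dist x0 (v x0) + 1 \<le> dist (inv u x0) (s k (v x0))"
        using far[OF k(1)] by blast
      have "dist (inv u x0) y = dist x0 (u y)" for y
        using isometryD(2)[OF u, of "inv u x0" y] isometry_inv_cancel(2)[OF u] by simp
      moreover have "seg act \<xi> (Suc i) n = u \<circ> (s k \<circ> v)"
        using seg_comp[of "Suc i" i' n act \<xi>] seg_comp[of i' "Suc i'" n act \<xi>] seg_one[of act \<xi> i'] k(2) i' \<open>i' < n\<close>
        by (simp add: u_def v_def act_gate)
      ultimately have "dist (?e i) (?b i') + dist (?e i') (?b n) + 1 \<le> dist (?e i) (?b n)"
        using far dist_seg[of 0 "Suc i" i' \<xi> x0 x0] dist_seg[of 0 "Suc i" n \<xi> x0 x0] dist_seg[of 0 "Suc i'" n \<xi> x0 x0] i' \<open>i' < n\<close>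
        by (simp add: u_def v_def)
      then show ?thesis using F step IH by simp
    qed
  qed
qed

text \<open>No cut occurs before the first gate time \<open>T\<close>, and \<open>T\<close> does not
  depend on \<open>n\<close>. Starting the comparison there costs a random constant only.\<close>

lemma cut_sum_le_dist:
  assumes M: "0 \<le> M" and n: "isl (\<xi> n)" and T: "T \<le> n" "isl (\<xi> T)" "\<And>l. l < T \<Longrightarrow> \<not> isl (\<xi> l)"
  shows "cut_sum M (Suc n) \<xi> \<le> dist (seg act \<xi> 0 (Suc T) x0) x0 + dist x0 (seg act \<xi> 0 n x0) + 1"
proof -
  have "cut_sum M (Suc n) \<xi> = (\<Sum>l\<in>{0..<T}. cut_term M \<xi> l (Suc n)) + (\<Sum>l\<in>{T..<Suc n}. cut_term M \<xi> l (Suc n))"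
    unfolding cut_sum_def using T by (simp add: sum.atLeastLessThan_concat atLeast0LessThan[symmetric] del: sum.op_ivl_Suc)
  also have "(\<Sum>l\<in>{0..<T}. cut_term M \<xi> l (Suc n)) = 0"
    using T(3) by (intro sum.neutral) (force simp: cut_term_def cut_def)
  also have "0 + (\<Sum>l\<in>{T..<Suc n}. cut_term M \<xi> l (Suc n)) \<le> dist (seg act \<xi> 0 (Suc T) x0) (seg act \<xi> 0 n x0) + 1"
  proof (cases "T = n")
    case True
    then show ?thesis by (simp add: cut_term_def)
  next
    case False
    then show ?thesis using cut_sum_from_le_dist[OF M, where n = n and i = T] n T by simp
  qed
  finally show ?thesis using dist_triangle[of "seg act \<xi> 0 (Suc T) x0" "seg act \<xi> 0 n x0" x0] by simp
qed

text \<open>The union of the obstructions to \<open>nested_p\<close> and to \<open>nested_m\<close>,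
  so that its absence gives both directions of shielding.\<close>

definition misaligned :: "nat \<Rightarrow> ('x \<Rightarrow> 'x) \<Rightarrow> nat \<Rightarrow> bool" where
  "misaligned j w k \<longleftrightarrow> (w x0 \<in> Dp j \<or> w (s k x0) \<in> Dp j) \<or> (inv w x0 \<in> Dm k \<or> inv w (inv (s j) x0) \<in> Dm k)"

lemma card_misaligned: "card {(j, k). j < N \<and> k < N \<and> misaligned j w k} \<le> 4 * N"
proof -
  have "card {(j, k). j < N \<and> k < N \<and> misaligned j w k} \<le> (N + N) + (N + N)"
    unfolding misaligned_def
    by (intro card_union_pairs card_pairs1[of "\<lambda>j k. w x0 \<in> Dp j"] card_pairs1[of "\<lambda>j k. w (s k x0) \<in> Dp j"]
      card_pairs2[of "\<lambda>j k. inv w x0 \<in> Dm k"] card_pairs2[of "\<lambda>j k. inv w (inv (s j) x0) \<in> Dm k"])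
      (auto intro: uniq_p uniq_m)
  then show ?thesis by simp
qed

text \<open>A later point behind gate \<open>j\<close> also lies behind gate \<open>k\<close>, and
  an earlier point beyond gate \<open>k\<close> also lies beyond gate \<open>j\<close>. So only the
  past of \<open>j\<close> and the future of \<open>k\<close> have to be tested, and these involve
  disjoint sets of letters.\<close>

lemma cut_pair:
  assumes j: "j < N" "\<xi> i = Inl j" and b: "\<xi> (Suc i) = Inr b" and k: "k < N" "\<xi> (Suc (Suc i)) = Inl k"
    and al: "\<not> misaligned j (act (Inr b)) k"
    and past: "\<not> past_bad i j \<xi>" and future: "\<not> future_bad (Suc (Suc i)) n k \<xi>"
  shows "cut \<xi> i n \<and> cut \<xi> (Suc (Suc i)) n"
proof
  define w where "w = act (Inr b)"
  have w: "isometry w" by (simp add: w_def act_iso)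
  have al: "w x0 \<notin> Dp j" "w (s k x0) \<notin> Dp j" "inv w x0 \<notin> Dm k" "inv w (inv (s j) x0) \<notin> Dm k"
    using al by (auto simp: misaligned_def w_def)
  have "\<not> future_bad i n j \<xi>"
  proof
    assume "future_bad i n j \<xi>"
    then obtain l where l: "l < n" "i < l" "isl (\<xi> l)" "seg act \<xi> (Suc i) l x0 \<in> Bp j" by (auto simp: future_bad_def)
    have "l \<noteq> Suc i" using l(3) b by auto
    moreover have "l \<noteq> Suc (Suc i)" using l(4) al(1) sub(1)[of j] b seg_one[of act \<xi> "Suc i"] by (auto simp: w_def)
    ultimately have l3: "Suc (Suc (Suc i)) \<le> l" using l(2) by simp
    then have "seg act \<xi> (Suc i) l = w \<circ> (s k \<circ> seg act \<xi> (Suc (Suc (Suc i))) l)"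
      using seg_comp[of "Suc i" "Suc (Suc i)" l act \<xi>] seg_comp[of "Suc (Suc i)" "Suc (Suc (Suc i))" l act \<xi>] b k(2)
      by (simp add: seg_one w_def act_gate)
    then have "seg act \<xi> (Suc (Suc (Suc i))) l x0 \<in> Bp k"
      using nested_p[OF j(1) k(1) w al(2,3)] l(4) by simp
    then have "future_bad (Suc (Suc i)) n k \<xi>" using l l3 by (auto simp: future_bad_def)
    then show False using future by simp
  qed
  then show "cut \<xi> i n" using j past by (auto simp: cut_def)
  have "\<not> past_bad (Suc (Suc i)) k \<xi>"
  proof
    assume "past_bad (Suc (Suc i)) k \<xi>"
    then obtain l where l: "l < Suc (Suc i)" "isl (\<xi> l)" "inv (seg act \<xi> (Suc l) (Suc (Suc i))) x0 \<in> Bm k"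
      by (auto simp: past_bad_def)
    have "l \<noteq> Suc i" using l(2) b by auto
    moreover have "l \<noteq> i" using l(3) al(3) sub(2)[of k] b seg_one[of act \<xi> "Suc i"] by (auto simp: w_def)
    ultimately have li: "l < i" using l(1) by simp
    define v where "v = seg act \<xi> (Suc l) i"
    have v: "isometry v" unfolding v_def by (rule seg_iso)
    have "seg act \<xi> (Suc l) (Suc (Suc i)) = v \<circ> (s j \<circ> w)"
      using seg_comp[of "Suc l" i "Suc (Suc i)" act \<xi>] seg_comp[of i "Suc i" "Suc (Suc i)" act \<xi>] li b j(2)
      by (simp add: seg_one w_def act_gate v_def)
    then have "inv (seg act \<xi> (Suc l) (Suc (Suc i))) = inv w \<circ> inv (s j) \<circ> inv v"
      by (simp add: inv_comp_isometry isometry_comp v w iso)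
    then have "inv v x0 \<in> Bm j" using nested_m[OF j(1) k(1) w al(1,4)] l(3) by simp
    then have "past_bad i j \<xi>" using l li by (auto simp: past_bad_def v_def)
    then show False using past by simp
  qed
  then show "cut \<xi> (Suc (Suc i)) n" using k future by (auto simp: cut_def)
qed

lemma past_bad_cong: "(\<And>l. l < i \<Longrightarrow> \<xi> l = \<xi>' l) \<Longrightarrow> past_bad i k \<xi> = past_bad i k \<xi>'"
proof -
  assume e: "\<And>l. l < i \<Longrightarrow> \<xi> l = \<xi>' l"
  then have "seg act \<xi> (Suc j) i = seg act \<xi>' (Suc j) i" for j by (intro seg_cong) auto
  then show ?thesis using e unfolding past_bad_def by auto
qed

lemma future_bad_cong: "(\<And>l. l < n \<Longrightarrow> \<xi> l = \<xi>' l) \<Longrightarrow> future_bad i n k \<xi> = future_bad i n k \<xi>'"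
proof -
  assume e: "\<And>l. l < n \<Longrightarrow> \<xi> l = \<xi>' l"
  then have "seg act \<xi> (Suc i) j = seg act \<xi>' (Suc i) j" if "j < n" for j using that by (intro seg_cong) auto
  then show ?thesis using e unfolding future_bad_def by auto
qed

lemma future_bad_hits:
  "future_bad i (Suc i + n) k \<xi> \<longleftrightarrow> hits act x0 n (Bp k) id (\<lambda>m. \<xi> (m + Suc i))"
  unfolding hits_iff
proof
  assume "future_bad i (Suc i + n) k \<xi>"
  then obtain j where "j < Suc i + n" "i < j" "isl (\<xi> j)" "seg act \<xi> (Suc i) j x0 \<in> Bp k" by (auto simp: future_bad_def)
  then show "\<exists>m<n. isl (\<xi> (m + Suc i)) \<and> id (walk (\<lambda>m. act (\<xi> (m + Suc i))) m x0) \<in> Bp k"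
    by (intro exI[of _ "j - Suc i"]) (auto simp: seg_def)
next
  assume "\<exists>m<n. isl (\<xi> (m + Suc i)) \<and> id (walk (\<lambda>m. act (\<xi> (m + Suc i))) m x0) \<in> Bp k"
  then obtain m where "m < n" "isl (\<xi> (m + Suc i))" "walk (\<lambda>m. act (\<xi> (m + Suc i))) m x0 \<in> Bp k" by auto
  then show "future_bad i (Suc i + n) k \<xi>" unfolding future_bad_def
    by (intro exI[of _ "m + Suc i"]) (simp add: seg_def)
qed

lemma cut_term_cong:
  assumes e: "\<And>l. l < n \<Longrightarrow> \<xi> l = \<xi>' l" shows "cut_term M \<xi> i n = cut_term M \<xi>' i n"
proof (cases "Suc (Suc i) < n")
  case True
  have "past_bad l k \<xi> = past_bad l k \<xi>'" if "l \<le> n" for l k using e that by (intro past_bad_cong) auto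
  moreover have "future_bad l n k \<xi> = future_bad l n k \<xi>'" for l k using e by (intro future_bad_cong) auto
  ultimately have "cut \<xi> l n = cut \<xi>' l n" if "l < n" for l using e that by (simp add: cut_def)
  then show ?thesis using True e[of "Suc i"] by (simp add: cut_term_def)
qed (simp add: cut_term_def)

lemma measurable_cut_term [measurable]: "(\<lambda>\<xi>. cut_term M \<xi> i n) \<in> borel_measurable (iid \<kappa>)"
  by (rule measurable_iid_finite[of n], rule cut_term_cong) auto

lemma measurable_past_bad [measurable]: "Measurable.pred (iid \<kappa>) (past_bad i k)"
  by (rule measurable_iid_finite[of i], rule past_bad_cong) auto


text \<open>Given the middle letter \<open>b\<close>, past, gates and future are independent, and a random pair of
  gates fails with probability at most \<open>4/N\<close> for each of past, alignment and future.\<close>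
lemma nn_integral_cut_term:
  assumes M: "0 \<le> M" and i: "Suc (Suc i) < n"
  shows "ennreal (\<eta>\<^sup>2 * (1 - \<eta>) / 2) * (\<integral>\<^sup>+ b. step_len M b \<partial>\<nu>) \<le> (\<integral>\<^sup>+ \<xi>. cut_term M \<xi> i n \<partial>iid \<kappa>)"
proof -
  define r where "r = n - Suc (Suc (Suc i))"
  have n: "n = Suc (Suc (Suc i)) + r" using i by (simp add: r_def)
  define q where "q = ennreal (\<eta> / N)"
  define F where "F = (\<integral>\<^sup>+ b. step_len M b \<partial>\<nu>)"
  have "F \<le> (\<integral>\<^sup>+ b. ennreal (1 + M) \<partial>\<nu>)" unfolding F_def by (intro nn_integral_mono ennreal_leI step_len_bounds)
  then have "F \<le> ennreal (1 + M)" by simp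
  then obtain F' where F': "F = ennreal F'" "0 \<le> F'" by (cases F) (auto simp: top_unique)
  \<comment> \<open>The sequence is cut into an independent past \<open>\<omega>\<close>, the three
    letters at \<open>i\<close>, \<open>Suc i\<close>, \<open>Suc (Suc i)\<close>, and an
    independent future \<open>\<omega>'\<close>.\<close>
  let ?c = "\<lambda>\<omega> a l a' \<omega>'. comb_seq i \<omega> (case_nat a (case_nat l (case_nat a' \<omega>')))"
  define h where "h \<omega> a l a' = (\<integral>\<^sup>+ \<omega>'. ennreal (cut_term M (?c \<omega> a l a' \<omega>') i n) \<partial>iid \<kappa>)" for \<omega> a l a'
  define fb where "fb k = (\<integral>\<^sup>+ \<omega>'. of_bool (hits act x0 r (Bp k) id \<omega>') \<partial>iid \<kappa>)" for k
  define pb where "pb \<omega> = (\<Sum>k<N. of_bool (past_bad i k \<omega>) :: ennreal)" for \<omega>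
  have fin: "(\<lambda>\<omega>. g (\<lambda>m. \<omega> m)) \<in> borel_measurable (iid \<kappa>)"
    if "\<And>\<xi> \<xi>'. (\<And>l. l < n \<Longrightarrow> \<xi> l = \<xi>' l) \<Longrightarrow> g \<xi> = g \<xi>'" for g :: "(nat \<Rightarrow> nat + 'b) \<Rightarrow> ennreal"
    by (rule measurable_iid_finite[of n], rule that) auto
  have m1: "(\<lambda>\<omega>'. ennreal (cut_term M (comb_seq i \<omega> \<omega>') i n)) \<in> borel_measurable (iid \<kappa>)" for \<omega>
    by (intro fin arg_cong[where f = ennreal] cut_term_cong) (auto simp: comb_seq_def)
  have m2: "(\<lambda>\<omega>'. ennreal (cut_term M (comb_seq i \<omega> (case_nat a \<omega>')) i n)) \<in> borel_measurable (iid \<kappa>)" for \<omega> a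
    by (intro fin arg_cong[where f = ennreal] cut_term_cong) (auto simp: comb_seq_def split: nat.split)
  have m3: "(\<lambda>\<omega>'. ennreal (cut_term M (comb_seq i \<omega> (case_nat a (case_nat l \<omega>'))) i n)) \<in> borel_measurable (iid \<kappa>)" for \<omega> a l
    by (intro fin arg_cong[where f = ennreal] cut_term_cong) (auto simp: comb_seq_def split: nat.split)
  have m4: "(\<lambda>\<omega>'. ennreal (cut_term M (?c \<omega> a l a' \<omega>') i n)) \<in> borel_measurable (iid \<kappa>)" for \<omega> a l a'
    by (intro fin arg_cong[where f = ennreal] cut_term_cong) (auto simp: comb_seq_def split: nat.split)
  have gate: "q * (\<Sum>k<N. g (Inl k)) \<le> (\<integral>\<^sup>+ a. g a \<partial>\<kappa>)" for g :: "nat + 'b \<Rightarrow> ennreal"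
  proof -
    have "q * (\<Sum>k<N. g (Inl k)) = ennreal \<eta> * ((\<Sum>k<N. g (Inl k)) / of_nat N)"
      using \<eta> N_pos unfolding q_def
      by (simp add: divide_ennreal[symmetric] ennreal_of_nat_eq_real_of_nat divide_ennreal_def mult.assoc mult.commute mult.left_commute)
    also have "\<dots> \<le> (\<integral>\<^sup>+ a. g a \<partial>\<kappa>)" using \<eta> N_pos by (subst nn_integral_letter_pmf) auto
    finally show ?thesis .
  qed
  have ordinary: "ennreal (1 - \<eta>) * (\<integral>\<^sup>+ b. g (Inr b) \<partial>\<nu>) \<le> (\<integral>\<^sup>+ a. g a \<partial>\<kappa>)" for g :: "nat + 'b \<Rightarrow> ennreal"
    using \<eta> N_pos by (subst nn_integral_letter_pmf) auto
  \<comment> \<open>Union bound for fixed gates \<open>j\<close>, \<open>k\<close> and a fixed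
    middle letter \<open>b\<close>: the term has its full value unless past, future or alignment
    fails.\<close>
  have one: "ennreal (step_len M b) \<le> h \<omega> (Inl j) (Inr b) (Inl k) +
      ennreal (step_len M b) * (of_bool (past_bad i j \<omega>) + fb k + of_bool (misaligned j (act (Inr b)) k))"
    if jk: "j < N" "k < N" for \<omega> b j k
  proof -
    let ?\<xi> = "\<lambda>\<omega>'. ?c \<omega> (Inl j) (Inr b) (Inl k) \<omega>'"
    let ?bad = "\<lambda>\<omega>'. of_bool (past_bad i j \<omega>) + of_bool (hits act x0 r (Bp k) id \<omega>') + of_bool (misaligned j (act (Inr b)) k) :: ennreal"
    have x: "?\<xi> \<omega>' i = Inl j" "?\<xi> \<omega>' (Suc i) = Inr b" "?\<xi> \<omega>' (Suc (Suc i)) = Inl k"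
      "(\<lambda>m. ?\<xi> \<omega>' (m + Suc (Suc (Suc i)))) = \<omega>'" for \<omega>'
      by (auto simp: comb_seq_def Suc_diff_le)
    have p: "past_bad i j (?\<xi> \<omega>') = past_bad i j \<omega>" for \<omega>' by (intro past_bad_cong) (simp add: comb_seq_def)
    have f: "future_bad (Suc (Suc i)) n k (?\<xi> \<omega>') = hits act x0 r (Bp k) id \<omega>'" for \<omega>'
      unfolding n using future_bad_hits[of "Suc (Suc i)" r k "?\<xi> \<omega>'"] x(4)[of \<omega>'] by simp
    have pt: "ennreal (step_len M b) \<le> ennreal (cut_term M (?\<xi> \<omega>') i n) + ennreal (step_len M b) *
      ?bad \<omega>'" for \<omega>'
    proof (cases "past_bad i j \<omega> \<or> hits act x0 r (Bp k) id \<omega>' \<or> misaligned j (act (Inr b)) k")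
      case True
      then have "1 \<le> (of_bool (past_bad i j \<omega>) + of_bool (hits act x0 r (Bp k) id \<omega>') + of_bool (misaligned j (act (Inr b)) k) :: ennreal)"
        by (auto simp: add_increasing add_increasing2)
      then have "ennreal (step_len M b) * 1 \<le> ennreal (step_len M b) *
        ?bad \<omega>'"
        by (intro mult_left_mono) auto
      then show ?thesis by (simp add: add_increasing)
    next
      case False
      then have "cut (?\<xi> \<omega>') i n \<and> cut (?\<xi> \<omega>') (Suc (Suc i)) n"
        using p[of \<omega>'] f[of \<omega>'] by (intro cut_pair[OF jk(1) x(1,2) jk(2) x(3)]) auto
      then have "cut_term M (?\<xi> \<omega>') i n = step_len M b" using i x(2)[of \<omega>'] by (simp add: cut_term_def)
      then show ?thesis by simp
    qed
    have hm: "(\<lambda>\<omega>'. of_bool (hits act x0 r (Bp k) id \<omega>') :: ennreal) \<in> borel_measurable (iid \<kappa>)"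
      unfolding of_bool_def by measurable
    have "ennreal (step_len M b) = (\<integral>\<^sup>+ \<omega>'. ennreal (step_len M b) \<partial>iid \<kappa>)" by simp
    also have "\<dots> \<le> (\<integral>\<^sup>+ \<omega>'. ennreal (cut_term M (?\<xi> \<omega>') i n) + ennreal (step_len M b) *
      ?bad \<omega>' \<partial>iid \<kappa>)"
      by (intro nn_integral_mono pt)
    also have "\<dots> = h \<omega> (Inl j) (Inr b) (Inl k) + ennreal (step_len M b) *
      (of_bool (past_bad i j \<omega>) + fb k + of_bool (misaligned j (act (Inr b)) k))"
      using hm m4[of \<omega> "Inl j" "Inr b" "Inl k"] unfolding h_def fb_def
      by (simp add: nn_integral_add nn_integral_cmult)
    finally show ?thesis .
  qed
  have fb4: "(\<Sum>k<N. fb k) \<le> 4" unfolding fb_def by (rule sum_hits_forward)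
  have mis: "(\<Sum>j<N. \<Sum>k<N. of_bool (misaligned j w k)) \<le> (4 * of_nat N :: ennreal)" for w
  proof -
    have "(\<Sum>j<N. \<Sum>k<N. of_bool (misaligned j w k)) = (\<Sum>(j,k)\<in>{..<N}\<times>{..<N}. if misaligned j w k then 1 else (0::ennreal))"
      by (simp add: sum.cartesian_product of_bool_def)
    also have "\<dots> = (\<Sum>(j,k)\<in>{(j, k). j < N \<and> k < N \<and> misaligned j w k}. 1)"
      by (rule sum.mono_neutral_cong_right) (auto split: if_splits)
    also have "\<dots> = of_nat (card {(j, k). j < N \<and> k < N \<and> misaligned j w k})" by (simp add: split_def)
    also have "\<dots> \<le> of_nat (4 * N)" by (intro of_nat_mono card_misaligned)
    finally show ?thesis by simp
  qed
  define I where "I \<omega> = (\<Sum>j<N. \<integral>\<^sup>+ b. (\<Sum>k<N. h \<omega> (Inl j) (Inr b) (Inl k)) \<partial>\<nu>)" for \<omega>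
  \<comment> \<open>Summing over all pairs, the past costs \<open>N * pb \<omega>\<close>, while
    future and alignment cost at most \<open>4 * N\<close> each, for every value of the middle
    letter.\<close>
  have I: "of_nat N * of_nat N * F \<le> I \<omega> + F * (of_nat N * pb \<omega> + 8 * of_nat N)" for \<omega>
  proof -
    have "of_nat N * of_nat N * ennreal (step_len M b) \<le> (\<Sum>j<N. \<Sum>k<N. h \<omega> (Inl j) (Inr b) (Inl k)) +
        ennreal (step_len M b) * (of_nat N * pb \<omega> + 8 * of_nat N)" for b
    proof -
      let ?f = "ennreal (step_len M b)"
      have "of_nat N * of_nat N * ?f = (\<Sum>j<N. \<Sum>k<N. ?f)" by (simp add: mult.assoc)
      also have "\<dots> \<le> (\<Sum>j<N. \<Sum>k<N. h \<omega> (Inl j) (Inr b) (Inl k) +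
        ?f * (of_bool (past_bad i j \<omega>) + fb k + of_bool (misaligned j (act (Inr b)) k)))"
        by (intro sum_mono one) auto
      also have "\<dots> = (\<Sum>j<N. \<Sum>k<N. h \<omega> (Inl j) (Inr b) (Inl k)) +
        ?f * (of_nat N * pb \<omega> + of_nat N * (\<Sum>k<N. fb k) + (\<Sum>j<N. \<Sum>k<N. of_bool (misaligned j (act (Inr b)) k)))"
        by (simp add: sum.distrib sum_distrib_left[symmetric] pb_def del: sum_of_bool_eq)
      also have "\<dots> \<le> (\<Sum>j<N. \<Sum>k<N. h \<omega> (Inl j) (Inr b) (Inl k)) +
        ?f * (of_nat N * pb \<omega> + of_nat N * 4 + 4 * of_nat N)"
        by (intro add_left_mono mult_left_mono add_mono mis fb4 order_refl) auto
      finally have 1: "of_nat N * of_nat N * ?f \<le> (\<Sum>j<N. \<Sum>k<N. h \<omega> (Inl j) (Inr b) (Inl k)) +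
        ?f * (of_nat N * pb \<omega> + of_nat N * 4 + 4 * of_nat N)" .
      have "of_nat N * 4 + 4 * of_nat N = (8 * of_nat N :: ennreal)" by (simp add: mult.commute distrib_left[symmetric])
      then show ?thesis using 1 unfolding add.assoc by simp
    qed
    then have "(\<integral>\<^sup>+ b. of_nat N * of_nat N * ennreal (step_len M b) \<partial>\<nu>) \<le>
      (\<integral>\<^sup>+ b. (\<Sum>j<N. \<Sum>k<N. h \<omega> (Inl j) (Inr b) (Inl k)) + ennreal (step_len M b) * (of_nat N * pb \<omega> + 8 * of_nat N) \<partial>\<nu>)"
      by (intro nn_integral_mono)
    then show ?thesis by (simp add: nn_integral_add nn_integral_cmult nn_integral_multc nn_integral_sum I_def F_def[symmetric])
  qed
  define J where "J \<omega> = (\<integral>\<^sup>+ \<omega>'. ennreal (cut_term M (comb_seq i \<omega> \<omega>') i n) \<partial>iid \<kappa>)" for \<omega>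
  define c where "c = q * ennreal (1 - \<eta>) * q"
  have J: "c * I \<omega> \<le> J \<omega>" for \<omega>
  proof -
    have "J \<omega> = (\<integral>\<^sup>+ a. \<integral>\<^sup>+ l. \<integral>\<^sup>+ a'. h \<omega> a l a' \<partial>\<kappa> \<partial>\<kappa> \<partial>\<kappa>)"
      unfolding J_def h_def
      by (subst nn_integral_iid_Suc[OF m1], subst nn_integral_iid_Suc[OF m2], subst nn_integral_iid_Suc[OF m3]) simp
    also have "\<dots> \<ge> q * (\<Sum>j<N. \<integral>\<^sup>+ l. \<integral>\<^sup>+ a'. h \<omega> (Inl j) l a' \<partial>\<kappa> \<partial>\<kappa>)" by (rule gate)
    also (xtrans) have "(\<Sum>j<N. \<integral>\<^sup>+ l. \<integral>\<^sup>+ a'. h \<omega> (Inl j) l a' \<partial>\<kappa> \<partial>\<kappa>) \<ge>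
      (\<Sum>j<N. ennreal (1 - \<eta>) * (\<integral>\<^sup>+ b. \<integral>\<^sup>+ a'. h \<omega> (Inl j) (Inr b) a' \<partial>\<kappa> \<partial>\<nu>))"
      by (intro sum_mono ordinary)
    also (xtrans) have "(\<Sum>j<N. ennreal (1 - \<eta>) * (\<integral>\<^sup>+ b. \<integral>\<^sup>+ a'. h \<omega> (Inl j) (Inr b) a' \<partial>\<kappa> \<partial>\<nu>)) \<ge>
      (\<Sum>j<N. ennreal (1 - \<eta>) * (\<integral>\<^sup>+ b. q * (\<Sum>k<N. h \<omega> (Inl j) (Inr b) (Inl k)) \<partial>\<nu>))"
      by (intro sum_mono mult_left_mono nn_integral_mono gate) auto
    finally (xtrans) show ?thesis
      by (simp add: mult_left_mono c_def I_def nn_integral_cmult sum_distrib_left[symmetric] mult.assoc)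
  qed
  have mJ: "J \<in> borel_measurable (iid \<kappa>)" unfolding J_def
    by (rule measurable_nn_integral_comb_seq) measurable
  have mp: "(\<lambda>\<omega>. of_bool (past_bad i k \<omega>) :: ennreal) \<in> borel_measurable (iid \<kappa>)" for k
    unfolding of_bool_def by measurable
  have mpb: "pb \<in> borel_measurable (iid \<kappa>)" unfolding pb_def using mp by measurable
  have pb4: "(\<integral>\<^sup>+ \<omega>. pb \<omega> \<partial>iid \<kappa>) \<le> 4"
    unfolding pb_def using mp sum_past_bad[of i] by (simp add: nn_integral_sum del: sum_of_bool_eq)
  have total: "c * (of_nat N * of_nat N * F) \<le> (\<integral>\<^sup>+ \<xi>. cut_term M \<xi> i n \<partial>iid \<kappa>) + c * (F * (of_nat N * 4 + 8 * of_nat N))"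
  proof -
    have "c * (of_nat N * of_nat N * F) = (\<integral>\<^sup>+ \<omega>. c * (of_nat N * of_nat N * F) \<partial>iid \<kappa>)" by simp
    also have "\<dots> \<le> (\<integral>\<^sup>+ \<omega>. J \<omega> + c * (F * (of_nat N * pb \<omega> + 8 * of_nat N)) \<partial>iid \<kappa>)"
    proof (rule nn_integral_mono)
      fix \<omega>
      have "c * (of_nat N * of_nat N * F) \<le> c * (I \<omega> + F * (of_nat N * pb \<omega> + 8 * of_nat N))"
        using I by (intro mult_left_mono) auto
      also have "\<dots> = c * I \<omega> + c * (F * (of_nat N * pb \<omega> + 8 * of_nat N))" by (simp add: distrib_left)
      finally show "c * (of_nat N * of_nat N * F) \<le> J \<omega> + c * (F * (of_nat N * pb \<omega> + 8 * of_nat N))"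
        using J[of \<omega>] by (meson add_right_mono order.trans)
    qed
    also have "\<dots> = (\<integral>\<^sup>+ \<omega>. J \<omega> \<partial>iid \<kappa>) + c * (F * (of_nat N * (\<integral>\<^sup>+ \<omega>. pb \<omega> \<partial>iid \<kappa>) + 8 * of_nat N))"
      using mJ mpb by (simp add: nn_integral_add nn_integral_cmult)
    also have "\<dots> \<le> (\<integral>\<^sup>+ \<omega>. J \<omega> \<partial>iid \<kappa>) + c * (F * (of_nat N * 4 + 8 * of_nat N))"
      using pb4 by (intro add_left_mono mult_left_mono add_right_mono) auto
    also have "(\<integral>\<^sup>+ \<omega>. J \<omega> \<partial>iid \<kappa>) = (\<integral>\<^sup>+ \<xi>. cut_term M \<xi> i n \<partial>iid \<kappa>)"
      unfolding J_def by (rule nn_integral_iid_split[symmetric]) measurable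
    finally show ?thesis .
  qed
  \<comment> \<open>The failures add up to \<open>12 * N\<close> of the \<open>N * N\<close> pairs,
    at most half of them because \<open>N \<ge> 24\<close>; this is the origin of the factor
    \<open>1 / 2\<close>. The subtraction is carried out in the reals.\<close>
  define c' where "c' = \<eta> / N * (1 - \<eta>) * (\<eta> / N)"
  have c': "c = ennreal c'" "0 \<le> c'" using \<eta> by (auto simp: c_def c'_def q_def ennreal_mult[symmetric])
  define H where "H = (\<integral>\<^sup>+ \<xi>. cut_term M \<xi> i n \<partial>iid \<kappa>)"
  have "ennreal (c' * (real N * real N * F')) \<le> H + ennreal (c' * (F' * (real N * 4 + 8 * real N)))"
    using total c' F' unfolding H_def
    by (simp add: ennreal_mult[symmetric] ennreal_plus[symmetric] ennreal_of_nat_eq_real_of_nat ennreal_numeral[symmetric]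
      del: ennreal_plus ennreal_numeral)
  moreover have "\<eta>\<^sup>2 * (1 - \<eta>) / 2 * F' \<le> c' * (real N * real N * F') - c' * (F' * (real N * 4 + 8 * real N))"
  proof -
    have "real N * real N / 2 \<le> real N * real N - 12 * real N"
      using mult_right_mono[of 24 "real N" "real N"] N by simp
    then have A: "c' * F' * (real N * real N / 2) \<le> c' * F' * (real N * real N - 12 * real N)"
      using c' F' by (intro mult_left_mono) auto
    have B: "\<eta>\<^sup>2 * (1 - \<eta>) / 2 * F' = c' * F' * (real N * real N / 2)"
      using N_pos by (simp add: c'_def power2_eq_square field_simps)
    have "\<eta>\<^sup>2 * (1 - \<eta>) / 2 * F' \<le> c' * F' * (real N * real N - 12 * real N)" unfolding B by (rule A)
    also have "\<dots> = c' * (real N * real N * F') - c' * (F' * (real N * 4 + 8 * real N))" by (simp add: algebra_simps)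
    finally show ?thesis .
  qed
  ultimately have "ennreal (\<eta>\<^sup>2 * (1 - \<eta>) / 2 * F') \<le> H"
  proof (cases H)
    case (real H')
    assume 1: "ennreal (c' * (real N * real N * F')) \<le> H + ennreal (c' * (F' * (real N * 4 + 8 * real N)))"
      and 2: "\<eta>\<^sup>2 * (1 - \<eta>) / 2 * F' \<le> c' * (real N * real N * F') - c' * (F' * (real N * 4 + 8 * real N))"
    have "c' * (real N * real N * F') \<le> H' + c' * (F' * (real N * 4 + 8 * real N))"
      using 1 real c' F' by (simp add: ennreal_plus[symmetric] ennreal_le_iff del: ennreal_plus)
    then show ?thesis using real 2 by (simp add: ennreal_leI)
  qed simp
  moreover have "ennreal (\<eta>\<^sup>2 * (1 - \<eta>) / 2 * F') = ennreal (\<eta>\<^sup>2 * (1 - \<eta>) / 2) * ennreal F'"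
    using \<eta> F' by (intro ennreal_mult) auto
  ultimately show ?thesis unfolding H_def F_def[symmetric] F'(1) by (simp only:)
qed


text \<open>Kingman's theorem gives the cut sums a linear growth rate above \<open>c\<close>, and at
  gate times the cut sum is at most the distance plus a constant. The restriction to gate times is
  then removed, as the event that the distance is too small is determined by the past.\<close>

lemma AE_walk_ge:
  assumes M: "0 \<le> M" and c: "0 \<le> c" "ennreal c < ennreal (\<eta>\<^sup>2 * (1 - \<eta>) / 2) * (\<integral>\<^sup>+ b. step_len M b \<partial>\<nu>)"
  shows "AE \<xi> in iid \<kappa>. eventually (\<lambda>n. c * real n \<le> dist x0 (walk (\<lambda>i. act (\<xi> i)) n x0)) sequentially"
proof -
  interpret prob_space "iid \<kappa>" by (rule prob_space_iid)
  define e where "e = \<eta>\<^sup>2 * (1 - \<eta>) / 2"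
  have e: "0 \<le> e" "e \<le> 1"
  proof -
    have "\<eta>\<^sup>2 * (1 - \<eta>) \<le> 1 * 1" using \<eta> by (intro mult_mono power_le_one) auto
    then show "0 \<le> e" "e \<le> 1" using \<eta> by (auto simp: e_def)
  qed
  have "(\<integral>\<^sup>+ b. step_len M b \<partial>\<nu>) \<le> (\<integral>\<^sup>+ b. ennreal (1 + M) \<partial>\<nu>)"
    by (intro nn_integral_mono ennreal_leI step_len_bounds)
  then have le: "(\<integral>\<^sup>+ b. step_len M b \<partial>\<nu>) \<le> ennreal (1 + M)" by simp
  then obtain F where F: "(\<integral>\<^sup>+ b. step_len M b \<partial>\<nu>) = ennreal F" "0 \<le> F"
    by (cases "\<integral>\<^sup>+ b. step_len M b \<partial>\<nu>") (auto simp: top_unique)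
  have "ennreal F \<le> ennreal (1 + M)" using le unfolding F(1) .
  then have FM: "F \<le> 1 + M" using M by (subst (asm) ennreal_le_iff) auto
  define g where "g = e * F"
  have g: "0 \<le> g" "g \<le> 1 + M"
    using e F FM mult_mono[of e 1 F "1 + M"] by (auto simp: g_def)
  have cg: "c < g" using c e F by (simp add: g_def e_def[symmetric] ennreal_mult[symmetric] ennreal_less_iff)
  \<comment> \<open>The constant \<open>2 * (1 + M)\<close> absorbs the error of almost
    subadditivity; the value at 0 is set separately, since a subadditive process has to vanish
    there.\<close>
  define x where "x n \<xi> = (if n = 0 then 0 else cut_sum M n \<xi> + 2 * (1 + M))" for n \<xi>
  have cs0: "0 \<le> cut_sum M n \<xi>" for n \<xi> unfolding cut_sum_def by (intro sum_nonneg cut_term_bounds(1)[OF M])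
  have mcs [measurable]: "cut_sum M n \<in> borel_measurable (iid \<kappa>)" for n unfolding cut_sum_def[abs_def] by measurable
  interpret S: subadditive \<kappa> x
  proof
    show "x n \<in> borel_measurable (iid \<kappa>)" for n unfolding x_def[abs_def] by measurable
    show "0 \<le> x n \<xi>" for n \<xi> using cs0[of n \<xi>] M by (simp add: x_def)
    show "x (m + n) \<xi> \<le> x m \<xi> + x n (shift m \<xi>)" for m n \<xi>
      using cut_sum_add_le[OF M, of m n \<xi>] by (cases "m = 0 \<or> n = 0") (auto simp: x_def)
    have "(\<integral>\<^sup>+ \<xi>. x 1 \<xi> \<partial>iid \<kappa>) = (\<integral>\<^sup>+ \<xi>. ennreal (2 * (1 + M)) \<partial>iid \<kappa>)"
      by (intro nn_integral_cong) (simp add: x_def cut_sum_def cut_term_def)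
    then show "(\<integral>\<^sup>+ \<xi>. x 1 \<xi> \<partial>iid \<kappa>) < \<infinity>" by simp
  qed (simp add: x_def)
  have "g * n \<le> S.mean n" if n: "1 \<le> n" for n
  proof -
    \<comment> \<open>The two last starting times carry no full pair of gates. The loss
      \<open>2 * g\<close> is covered by \<open>2 * (1 + M)\<close>, so the bound holds for every
      \<open>n\<close>, as the infimum in \<open>rate\<close> demands.\<close>
    have "ennreal (g * (n - 2)) = (\<Sum>i<n-2. ennreal g)" using g by (simp add: ennreal_mult'' ennreal_of_nat_eq_real_of_nat mult.commute)
    also have "\<dots> \<le> (\<Sum>i<n-2. \<integral>\<^sup>+ \<xi>. cut_term M \<xi> i n \<partial>iid \<kappa>)"
    proof (intro sum_mono)
      fix i assume "i \<in> {..<n-2}"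
      then show "ennreal g \<le> (\<integral>\<^sup>+ \<xi>. cut_term M \<xi> i n \<partial>iid \<kappa>)"
        using nn_integral_cut_term[OF M, of i n] e F by (simp add: g_def e_def[symmetric] ennreal_mult)
    qed
    also have "\<dots> \<le> (\<Sum>i<n. \<integral>\<^sup>+ \<xi>. cut_term M \<xi> i n \<partial>iid \<kappa>)" by (intro sum_mono2) auto
    also have "\<dots> = (\<integral>\<^sup>+ \<xi>. cut_sum M n \<xi> \<partial>iid \<kappa>)" unfolding cut_sum_def
      using cut_term_bounds(1)[OF M] by (subst nn_integral_sum[symmetric]) (auto intro!: nn_integral_cong simp: sum_ennreal)
    finally have 1: "ennreal (g * (n - 2)) \<le> (\<integral>\<^sup>+ \<xi>. cut_sum M n \<xi> \<partial>iid \<kappa>)" .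
    have "ennreal (g * n) \<le> ennreal (g * (n - 2) + 2 * (1 + M))"
    proof (rule ennreal_leI)
      have "g * n \<le> g * (real (n - 2) + 2)" using g by (intro mult_left_mono) auto
      then show "g * n \<le> g * (n - 2) + 2 * (1 + M)" using g by (simp add: algebra_simps)
    qed
    also have "\<dots> = ennreal (g * (n - 2)) + ennreal (2 * (1 + M))" using g M by (intro ennreal_plus) auto
    also have "\<dots> \<le> (\<integral>\<^sup>+ \<xi>. cut_sum M n \<xi> \<partial>iid \<kappa>) + (\<integral>\<^sup>+ \<xi>. ennreal (2 * (1 + M)) \<partial>iid \<kappa>)"
      using 1 by (intro add_mono) simp_all
    also have "\<dots> = (\<integral>\<^sup>+ \<xi>. ennreal (cut_sum M n \<xi>) + ennreal (2 * (1 + M)) \<partial>iid \<kappa>)"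
      by (intro nn_integral_add[symmetric]) measurable
    also have "\<dots> = (\<integral>\<^sup>+ \<xi>. x n \<xi> \<partial>iid \<kappa>)"
      using n M cs0 by (intro nn_integral_cong) (simp add: x_def ennreal_plus[symmetric] del: ennreal_plus)
    finally have "ennreal (g * n) \<le> ennreal (S.mean n)" unfolding S.nn_integral_x .
    then show ?thesis using S.mean_nonneg by (subst (asm) ennreal_le_iff) auto
  qed
  then have rate: "g \<le> S.rate" by (rule S.rate_greatest)
  have "AE \<xi> in iid \<kappa>. eventually (\<lambda>n. \<not> dist x0 (walk (\<lambda>i. act (\<xi> i)) n x0) < c * real n) sequentially"
  proof (rule AE_eventually_of_gate_times[where P = "\<lambda>n \<xi>. dist x0 (walk (\<lambda>i. act (\<xi> i)) n x0) < c * real n"])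
    show "0 < \<eta>" "\<eta> \<le> 1" "0 < N" using \<eta> N_pos by auto
    show "(dist x0 (walk (\<lambda>i. act (\<xi> i)) n x0) < c * real n) = (dist x0 (walk (\<lambda>i. act (\<xi>' i)) n x0) < c * real n)"
      if "\<And>i. i < n \<Longrightarrow> \<xi> i = \<xi>' i" for n \<xi> \<xi>'
      using walk_cong[of n "\<lambda>i. act (\<xi> i)" "\<lambda>i. act (\<xi>' i)"] that by simp
    show "AE \<xi> in iid \<kappa>. eventually (\<lambda>n. isl (\<xi> n) \<longrightarrow> \<not> dist x0 (walk (\<lambda>i. act (\<xi> i)) n x0) < c * real n) sequentially"
      using S.kingman
    proof eventually_elim
      case (elim \<xi>)
      show ?case
      proof (cases "\<exists>T. isl (\<xi> T)")
        case False
        then show ?thesis by simp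
      next
        case True
        define T where "T = (LEAST T. isl (\<xi> T))"
        have T: "isl (\<xi> T)" "\<And>l. l < T \<Longrightarrow> \<not> isl (\<xi> l)"
          using LeastI_ex[OF True] not_less_Least by (auto simp: T_def)
        define d where "d = (c + g) / 2"
        have d: "c < d" "d < g" using cg by (auto simp: d_def)
        \<comment> \<open>All errors that do not depend on \<open>n\<close>; the slack
          \<open>d - c\<close> in the slope absorbs them eventually.\<close>
        define C where "C = dist (seg act \<xi> 0 (Suc T) x0) x0 + 1 + 2 * (1 + M)"
        have "eventually (\<lambda>n. d < x n \<xi> / n) sequentially" using order_tendstoD(1)[OF elim, of d] d rate by simp
        then obtain n0 where n0: "\<And>n. n0 \<le> n \<Longrightarrow> d < x n \<xi> / n" unfolding eventually_sequentially by blast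
        obtain q :: nat where q: "C / (d - c) < q" using reals_Archimedean2 by blast
        have "c * real n \<le> dist x0 (walk (\<lambda>i. act (\<xi> i)) n x0)" if n: "max n0 q \<le> n" "isl (\<xi> n)" for n
        proof -
          have "T \<le> n" using T(2) n(2) by (meson not_le)
          have "d * Suc n < x (Suc n) \<xi>" using n0[of "Suc n"] n by (simp add: pos_less_divide_eq)
          also have "\<dots> = cut_sum M (Suc n) \<xi> + 2 * (1 + M)" by (simp add: x_def)
          also have "\<dots> \<le> C + dist x0 (seg act \<xi> 0 n x0)"
            using cut_sum_le_dist[OF M n(2) \<open>T \<le> n\<close> T] by (simp add: C_def)
          finally have 1: "d * Suc n < C + dist x0 (walk (\<lambda>i. act (\<xi> i)) n x0)" by (simp add: seg_0)
          have "C < q * (d - c)" using q d by (simp add: pos_divide_less_eq)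
          also have "\<dots> \<le> n * (d - c)" using n d by (intro mult_right_mono) auto
          finally show ?thesis using 1 d c by (simp add: algebra_simps)
        qed
        then show ?thesis unfolding eventually_sequentially not_less by blast
      qed
    qed
  qed
  then show ?thesis by (simp add: not_less)
qed

end

section \<open>Blocks of letters\<close>

lemma distr_iidI:
  assumes "prob_space M" "prob_space.indep_vars M (\<lambda>_. measure_pmf q) X UNIV"
    and d: "\<And>i. distr M (measure_pmf q) (X i) = measure_pmf q"
  shows "distr M (iid q) (\<lambda>\<omega> i. X i \<omega>) = iid q"
proof -
  interpret prob_space M by (rule assms(1))
  have rv: "random_variable (measure_pmf q) (X i)" for i using assms(2) by (auto simp: indep_vars_def)
  have "distr M (PiM UNIV (\<lambda>_. measure_pmf q)) (\<lambda>x. \<lambda>i\<in>UNIV. X i x) = PiM UNIV (\<lambda>i. distr M (measure_pmf q) (X i))"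
    using assms(2) indep_vars_iff_distr_eq_PiM'[where I = UNIV and M' = "\<lambda>_. measure_pmf q" and X = X] rv by simp
  then show ?thesis by (simp add: d restrict_def)
qed

lemma distr_iid_component: "distr (iid p) (measure_pmf p) (\<lambda>\<xi>. \<xi> i) = measure_pmf p"
  by (rule distr_PiM_component) (auto simp: measure_pmf.prob_space_axioms)

lemma distr_iid_map: "distr (iid p) (iid (map_pmf f p)) (\<lambda>\<xi> i. f (\<xi> i)) = iid (map_pmf f p)"
proof (rule distr_iidI[OF prob_space_iid])
  interpret prob_space "iid p" by (rule prob_space_iid)
  show "indep_vars (\<lambda>_. measure_pmf (map_pmf f p)) (\<lambda>i \<xi>. f (\<xi> i)) UNIV"
    by (rule indep_vars_compose2[OF indep_vars_iid]) simp
  fix i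
  have "distr (iid p) (measure_pmf (map_pmf f p)) (\<lambda>\<xi>. f (\<xi> i)) =
    distr (distr (iid p) (measure_pmf p) (\<lambda>\<xi>. \<xi> i)) (measure_pmf (map_pmf f p)) f"
    by (subst distr_distr) (auto simp: comp_def)
  also have "\<dots> = measure_pmf (map_pmf f p)"
    unfolding distr_iid_component map_pmf_rep_eq by (rule distr_cong) auto
  finally show "distr (iid p) (measure_pmf (map_pmf f p)) (\<lambda>\<xi>. f (\<xi> i)) = measure_pmf (map_pmf f p)" .
qed

lemma measurable_iid_map: "(\<lambda>\<xi> i. f (\<xi> i)) \<in> measurable (iid p) (iid q)"
proof (rule measurable_PiM_single')
  fix i show "(\<lambda>\<xi>. f (\<xi> i)) \<in> measurable (iid p) (measure_pmf q)"
    by (rule measurable_compose[of "\<lambda>\<xi>. \<xi> i" _ "measure_pmf p"]) auto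
qed auto

lemma nn_integral_prefix:
  fixes p :: "'a::countable pmf"
  shows "(\<integral>\<^sup>+ \<xi>. f (map \<xi> [0..<L]) \<partial>iid p) = (\<integral>\<^sup>+ ws. f ws \<partial>replicate_pmf L p)"
proof (induction L arbitrary: f)
  case (Suc L)
  have m: "(\<lambda>\<xi>. f (map \<xi> [0..<Suc L])) \<in> borel_measurable (iid p)"
    by (rule measurable_compose[OF measurable_prefix]) simp
  have "map (case_nat a \<omega>) [0..<Suc L] = a # map \<omega> [0..<L]" for a and \<omega> :: "nat \<Rightarrow> 'a"
    by (simp add: upt_conv_Cons map_Suc_upt[symmetric] comp_def del: upt_Suc)
  then have "(\<integral>\<^sup>+ \<xi>. f (map \<xi> [0..<Suc L]) \<partial>iid p) = (\<integral>\<^sup>+ a. (\<integral>\<^sup>+ \<omega>. f (a # map \<omega> [0..<L]) \<partial>iid p) \<partial>p)"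
    by (subst nn_integral_iid_Suc[OF m]) simp
  also have "\<dots> = (\<integral>\<^sup>+ a. (\<integral>\<^sup>+ ws. f (a # ws) \<partial>replicate_pmf L p) \<partial>p)"
    by (intro nn_integral_cong Suc)
  also have "\<dots> = (\<integral>\<^sup>+ ws. f ws \<partial>replicate_pmf (Suc L) p)"
    by simp
  finally show ?case .
qed simp

definition blocks :: "nat \<Rightarrow> (nat \<Rightarrow> 'a) \<Rightarrow> nat \<Rightarrow> 'a list" where
  "blocks L \<xi> m = map (shift (m * L) \<xi>) [0..<L]"

text \<open>Blocks depend on disjoint index intervals, hence are independent, and shift invariance
  gives each of them the law of the first.\<close>

lemma distr_iid_blocks:
  fixes p :: "'a::countable pmf"
  shows "distr (iid p) (iid (replicate_pmf L p)) (blocks L) = iid (replicate_pmf L p)"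
proof -
  interpret prob_space "iid p" by (rule prob_space_iid)
  let ?q = "replicate_pmf L p"
  have mb: "(\<lambda>\<xi>. blocks L \<xi> m) \<in> measurable (iid p) (measure_pmf ?q)" for m
    unfolding blocks_def using measurable_compose[OF measurable_shift[of "m * L"] measurable_prefix[of L p]] by simp
  have "distr (iid p) (iid ?q) (\<lambda>\<xi> m. blocks L \<xi> m) = iid ?q"
  proof (rule distr_iidI[OF prob_space_iid])
    define K where "K m = {m * L..<m * L + L}" for m
    have "disjoint_family K" unfolding disjoint_family_on_def
    proof (intro ballI impI)
      fix m n :: nat assume "m \<noteq> n"
      then consider "Suc m \<le> n" | "Suc n \<le> m" by linarith
      then show "K m \<inter> K n = {}"
      proof cases
        case 1
        then have "Suc m * L \<le> n * L" by (rule mult_le_mono1)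
        then show ?thesis by (auto simp: K_def)
      next
        case 2
        then have "Suc n * L \<le> m * L" by (rule mult_le_mono1)
        then show ?thesis by (auto simp: K_def)
      qed
    qed
    then have "indep_vars (\<lambda>m. PiM (K m) (\<lambda>_. measure_pmf p)) (\<lambda>m \<omega>. restrict (\<lambda>i. \<omega> i) (K m)) UNIV"
      by (intro indep_vars_restrict[OF indep_vars_iid]) auto
    then have "indep_vars (\<lambda>_. measure_pmf ?q) (\<lambda>m \<omega>. map (\<lambda>i. restrict (\<lambda>i. \<omega> i) (K m) (i + m * L)) [0..<L]) UNIV"
    proof (rule indep_vars_compose2[where Y = "\<lambda>m \<omega>. map (\<lambda>i. \<omega> (i + m * L)) [0..<L]"])
      fix m
      show "(\<lambda>\<omega>. map (\<lambda>i. \<omega> (i + m * L)) [0..<L]) \<in> measurable (PiM (K m) (\<lambda>_. measure_pmf p)) (measure_pmf ?q)"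
      proof -
        \<comment> \<open>On the product over \<open>K m\<close> only coordinates in this interval
          are measurable, so the block is assembled letter by letter for
          \<open>l \<le> L\<close>.\<close>
        have "(\<lambda>\<omega>. map (\<lambda>i. \<omega> (i + m * L)) [0..<l]) \<in> measurable (PiM (K m) (\<lambda>_. measure_pmf p)) (count_space UNIV)" if "l \<le> L" for l
          using that
        proof (induction l)
          case (Suc l)
          have 1: "(\<lambda>\<omega>. \<omega> (l + m * L)) \<in> measurable (PiM (K m) (\<lambda>_. measure_pmf p)) (count_space UNIV)"
            using measurable_component_singleton[of "l + m * L" "K m" "\<lambda>_. measure_pmf p"] Suc.prems by (simp add: K_def)
          have 2: "(\<lambda>\<omega>. map (\<lambda>i. \<omega> (i + m * L)) [0..<l]) \<in> measurable (PiM (K m) (\<lambda>_. measure_pmf p)) (count_space UNIV)"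
            using Suc by simp
          have "(\<lambda>\<omega>. (\<lambda>ws \<omega>. ws @ [\<omega> (l + m * L)]) (map (\<lambda>i. \<omega> (i + m * L)) [0..<l]) \<omega>)
              \<in> measurable (PiM (K m) (\<lambda>_. measure_pmf p)) (count_space UNIV)"
          proof (rule measurable_compose_countable[OF _ 2])
            fix ws :: "'a list"
            show "(\<lambda>\<omega>. ws @ [\<omega> (l + m * L)]) \<in> measurable (PiM (K m) (\<lambda>_. measure_pmf p)) (count_space UNIV)"
              by (rule measurable_compose[OF 1]) simp
          qed
          then show ?case by simp
        qed simp
        then show ?thesis by simp
      qed
    qed
    moreover have "map (\<lambda>i. restrict (\<lambda>i. \<omega> i) (K m) (i + m * L)) [0..<L] = blocks L \<omega> m" for m and \<omega> :: "nat \<Rightarrow> 'a"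
      by (auto simp: blocks_def K_def shift_def)
    ultimately show "indep_vars (\<lambda>_. measure_pmf ?q) (\<lambda>m \<omega>. blocks L \<omega> m) UNIV" by simp
    fix m
    show "distr (iid p) (measure_pmf ?q) (\<lambda>\<xi>. blocks L \<xi> m) = measure_pmf ?q"
    proof (rule measure_eqI)
      fix A assume "A \<in> sets (distr (iid p) (measure_pmf ?q) (\<lambda>\<xi>. blocks L \<xi> m))"
      have m': "(\<lambda>\<xi>. indicator A (map \<xi> [0..<L]) :: ennreal) \<in> borel_measurable (iid p)"
        by (rule measurable_compose[OF measurable_prefix]) simp
      have "emeasure (distr (iid p) (measure_pmf ?q) (\<lambda>\<xi>. blocks L \<xi> m)) A
         = (\<integral>\<^sup>+ ws. indicator A ws \<partial>distr (iid p) (measure_pmf ?q) (\<lambda>\<xi>. blocks L \<xi> m))"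
        by simp
      also have "\<dots> = (\<integral>\<^sup>+ \<xi>. indicator A (blocks L \<xi> m) \<partial>iid p)"
        using mb by (subst nn_integral_distr) auto
      also have "\<dots> = (\<integral>\<^sup>+ \<xi>. indicator A (map \<xi> [0..<L]) \<partial>iid p)"
        unfolding blocks_def by (rule nn_integral_shift[OF m'])
      also have "\<dots> = emeasure (measure_pmf ?q) A" by (simp add: nn_integral_prefix)
      finally show "emeasure (distr (iid p) (measure_pmf ?q) (\<lambda>\<xi>. blocks L \<xi> m)) A = emeasure (measure_pmf ?q) A" .
    qed simp
  qed
  then show ?thesis by simp
qed

lemma measurable_blocks: "blocks L \<in> measurable (iid (p :: 'a::countable pmf)) (iid (replicate_pmf L p))"
proof (rule measurable_PiM_single')
  fix m show "(\<lambda>\<xi>. blocks L \<xi> m) \<in> measurable (iid p) (measure_pmf (replicate_pmf L p))"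
    unfolding blocks_def using measurable_compose[OF measurable_shift[of "m * L"] measurable_prefix[of L p]] by simp
qed auto

text \<open>The second component is the normalised remainder
  \<open>(\<nu>0 - \<eta> \<tau>) / (1 - \<eta>)\<close>.\<close>

lemma pmf_mixture:
  assumes \<eta>: "0 \<le> \<eta>" "\<eta> < 1" and le: "\<And>w. \<eta> * pmf \<tau> w \<le> pmf \<nu>0 w"
  obtains \<nu> where "\<nu>0 = bind_pmf (bernoulli_pmf \<eta>) (\<lambda>f. if f then \<tau> else \<nu>)"
proof -
  define d where "d w = pmf \<nu>0 w - \<eta> * pmf \<tau> w" for w
  have d0: "0 \<le> d w" for w using le by (simp add: d_def)
  have "(\<integral>\<^sup>+ w. ennreal (d w) \<partial>count_space UNIV) + ennreal \<eta> * (\<integral>\<^sup>+ w. ennreal (pmf \<tau> w) \<partial>count_space UNIV)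
      = (\<integral>\<^sup>+ w. ennreal (pmf \<nu>0 w) \<partial>count_space UNIV)"
    using d0 \<eta> by (simp add: nn_integral_cmult[symmetric] nn_integral_add[symmetric] ennreal_mult[symmetric] ennreal_plus[symmetric]
      d_def del: ennreal_plus)
  then have D: "(\<integral>\<^sup>+ w. ennreal (d w) \<partial>count_space UNIV) + ennreal \<eta> = 1" by (simp add: nn_integral_pmf_eq_1)
  have "(1 :: ennreal) = ennreal (1 - \<eta>) + ennreal \<eta>" using \<eta> by (simp add: ennreal_plus[symmetric] del: ennreal_plus)
  with D have "ennreal \<eta> + (\<integral>\<^sup>+ w. ennreal (d w) \<partial>count_space UNIV) = ennreal \<eta> + ennreal (1 - \<eta>)" by (simp add: add.commute)
  then have D: "(\<integral>\<^sup>+ w. ennreal (d w) \<partial>count_space UNIV) = ennreal (1 - \<eta>)" by (simp only: ennreal_add_left_cancel) simp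
  define \<nu> where "\<nu> = embed_pmf (\<lambda>w. d w / (1 - \<eta>))"
  have \<nu>: "pmf \<nu> w = d w / (1 - \<eta>)" for w unfolding \<nu>_def
  proof (rule pmf_embed_pmf)
    show "0 \<le> d w / (1 - \<eta>)" for w using d0 \<eta> by simp
    have "(\<integral>\<^sup>+ w. ennreal (d w / (1 - \<eta>)) \<partial>count_space UNIV) = (\<integral>\<^sup>+ w. ennreal (1 / (1 - \<eta>)) * ennreal (d w) \<partial>count_space UNIV)"
      using d0 \<eta> by (intro nn_integral_cong) (simp add: ennreal_mult[symmetric])
    also have "\<dots> = ennreal (1 / (1 - \<eta>)) * ennreal (1 - \<eta>)" by (simp add: nn_integral_cmult D)
    also have "\<dots> = 1" using \<eta> by (simp add: ennreal_mult[symmetric])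
    finally show "(\<integral>\<^sup>+ w. ennreal (d w / (1 - \<eta>)) \<partial>count_space UNIV) = 1" .
  qed
  have "\<nu>0 = bind_pmf (bernoulli_pmf \<eta>) (\<lambda>f. if f then \<tau> else \<nu>)"
  proof (rule pmf_eqI)
    fix w
    have "pmf (bind_pmf (bernoulli_pmf \<eta>) (\<lambda>f. if f then \<tau> else \<nu>)) w = \<eta> * pmf \<tau> w + (1 - \<eta>) * pmf \<nu> w"
      using \<eta> by (simp add: pmf_bind)
    also have "\<dots> = pmf \<nu>0 w" using \<eta> by (simp add: \<nu> d_def)
    finally show "pmf \<nu>0 w = pmf (bind_pmf (bernoulli_pmf \<eta>) (\<lambda>f. if f then \<tau> else \<nu>)) w" by simp
  qed
  then show thesis using that by blast
qed

lemma letter_pmf_exists: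
  assumes N: "0 < N" and W: "\<And>k. k < N \<Longrightarrow> W k \<in> set_pmf \<nu>0"
  obtains \<eta> \<nu> where "0 < \<eta>" "\<eta> < 1" "\<nu>0 = map_pmf (case_sum W id) (letter_pmf \<eta> N \<nu>)"
proof -
  define \<tau> where "\<tau> = map_pmf W (pmf_of_set {..<N})"
  \<comment> \<open>Half of the least mass of a gate word lies below the mass of each such word and
    strictly below 1. Coinciding words do no harm, as \<open>pmf \<tau> w \<le> 1\<close>.\<close>
  define \<eta> where "\<eta> = Min ((\<lambda>k. pmf \<nu>0 (W k)) ` {..<N}) / 2"
  have ne: "{..<N} \<noteq> {}" using N by (auto simp: lessThan_empty_iff)
  have "0 < Min ((\<lambda>k. pmf \<nu>0 (W k)) ` {..<N})" using ne W by (subst Min_gr_iff) (auto simp: pmf_positive)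
  moreover have "Min ((\<lambda>k. pmf \<nu>0 (W k)) ` {..<N}) \<le> pmf \<nu>0 (W 0)" using N by (intro Min_le) auto
  ultimately have \<eta>: "0 < \<eta>" "\<eta> < 1" using pmf_le_1[of \<nu>0 "W 0"] by (auto simp: \<eta>_def)
  have "\<eta> * pmf \<tau> w \<le> pmf \<nu>0 w" for w
  proof (cases "w \<in> W ` {..<N}")
    case True
    then have "Min ((\<lambda>k. pmf \<nu>0 (W k)) ` {..<N}) \<le> pmf \<nu>0 w" by (intro Min_le) auto
    then have "\<eta> \<le> pmf \<nu>0 w" using \<eta> by (simp add: \<eta>_def)
    then show ?thesis using mult_left_mono[OF pmf_le_1[of \<tau> w], of \<eta>] \<eta> by linarith
  next
    case False
    then have "w \<notin> set_pmf \<tau>" using ne by (auto simp: \<tau>_def)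
    then have "pmf \<tau> w = 0" by (simp add: pmf_eq_0_set_pmf)
    then show ?thesis by simp
  qed
  then obtain \<nu> where "\<nu>0 = bind_pmf (bernoulli_pmf \<eta>) (\<lambda>f. if f then \<tau> else \<nu>)"
    using pmf_mixture[of \<eta> \<tau> \<nu>0] \<eta> by auto
  also have "\<dots> = map_pmf (case_sum W id) (letter_pmf \<eta> N \<nu>)"
    unfolding letter_pmf_def map_bind_pmf \<tau>_def
    by (intro bind_pmf_cong refl) (auto simp: pmf.map_comp comp_def)
  finally show thesis using that \<eta> by blast
qed

section \<open>The random walk\<close>

definition word_act :: "(nat \<Rightarrow> 'x \<Rightarrow> 'x) \<Rightarrow> nat list \<Rightarrow> 'x \<Rightarrow> 'x" where
  "word_act e ws = foldr (\<circ>) (map e ws) id"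

lemma word_act_simps [simp]: "word_act e [] = id" "word_act e (a # ws) = e a \<circ> word_act e ws"
  by (simp_all add: word_act_def)

lemma word_act_append: "word_act e (u @ v) = word_act e u \<circ> word_act e v"
  by (induction u) (simp_all add: comp_assoc)

lemma word_act_power: "word_act e (concat (replicate k u)) = word_act e u ^^ k"
  by (induction k) (simp_all add: word_act_append)

lemma isometry_word_act: "(\<And>i. isometry (e i)) \<Longrightarrow> isometry (word_act e ws)"
  by (induction ws) (simp_all add: isometry_id isometry_comp)

lemma walk_add: "walk f (m + n) = walk f m \<circ> walk (\<lambda>i. f (i + m)) n"
  by (induction n) (simp_all add: comp_assoc add.commute)

lemma word_act_prefix: "word_act e (map \<xi> [0..<n]) = walk (\<lambda>i. e (\<xi> i)) n"
  by (induction n) (simp_all add: word_act_append)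

lemma walk_blocks: "walk (\<lambda>m. word_act e (blocks L \<xi> m)) n = walk (\<lambda>i. e (\<xi> i)) (n * L)"
proof (induction n)
  case (Suc n)
  have "walk (\<lambda>i. e (\<xi> i)) (Suc n * L) = walk (\<lambda>i. e (\<xi> i)) (n * L) \<circ> walk (\<lambda>i. e (\<xi> (i + n * L))) L"
    using walk_add[of "\<lambda>i. e (\<xi> i)" "n * L" L] by (simp add: add.commute)
  then show ?case using Suc by (simp add: blocks_def word_act_prefix shift_def)
qed simp

lemma gen_semigroup_word:
  assumes "g \<in> gen_semigroup (e ` A)"
  obtains ws where "ws \<noteq> []" "set ws \<subseteq> A" "word_act e ws = g"
  using assms
proof (induction arbitrary: thesis rule: gen_semigroup.induct)
  case (base g)
  then obtain i where "i \<in> A" "g = e i" by blast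
  then show ?case using base(2)[of "[i]"] by simp
next
  case (mult a b)
  obtain u where "u \<noteq> []" "set u \<subseteq> A" "word_act e u = a" using mult.IH(1) by blast
  moreover obtain v where "v \<noteq> []" "set v \<subseteq> A" "word_act e v = b" using mult.IH(2) by blast
  ultimately show ?case using mult.prems[of "u @ v"] by (simp add: word_act_append)
qed

text \<open>Fix one word \<open>v\<close> of positive probability for all letters but the first. It
  changes the displacement of the first letter by a bounded amount, so already this part of the
  integral is infinite.\<close>

lemma nn_integral_replicate_infinite:
  fixes e :: "nat \<Rightarrow> 'x::metric_space \<Rightarrow> 'x" and p :: "nat pmf"
  assumes iso: "\<And>i. isometry (e i)" and inf: "(\<integral>\<^sup>+ i. dist x0 (e i x0) \<partial>p) = \<infinity>" and L: "0 < L"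
  shows "(\<integral>\<^sup>+ ws. dist x0 (word_act e ws x0) \<partial>replicate_pmf L p) = \<infinity>"
proof -
  obtain l where l: "L = Suc l" using L by (cases L) auto
  let ?q = "replicate_pmf l p"
  obtain v where v: "v \<in> set_pmf ?q" using set_pmf_not_empty[of ?q] by blast
  let ?F = "\<lambda>ws. \<integral>\<^sup>+ a. ennreal (dist x0 (e a (word_act e ws x0))) \<partial>p"
  have "(\<integral>\<^sup>+ a. dist x0 (e a x0) \<partial>p) \<le> (\<integral>\<^sup>+ a. ennreal (dist x0 (e a (word_act e v x0))) + ennreal (dist x0 (word_act e v x0)) \<partial>p)"
  proof (intro nn_integral_mono)
    fix a
    have "dist x0 (e a x0) \<le> dist x0 (e a (word_act e v x0)) + dist x0 (word_act e v x0)"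
      using dist_triangle[of x0 "e a x0" "e a (word_act e v x0)"] isometryD(2)[OF iso, of a x0 "word_act e v x0"] by (simp add: dist_commute)
    then show "ennreal (dist x0 (e a x0)) \<le> ennreal (dist x0 (e a (word_act e v x0))) + ennreal (dist x0 (word_act e v x0))"
      by (simp add: ennreal_plus[symmetric] ennreal_leI del: ennreal_plus)
  qed
  also have "\<dots> = ?F v + ennreal (dist x0 (word_act e v x0))" by (simp add: nn_integral_add)
  finally have Fv: "?F v = \<infinity>" using inf by (auto simp: top_unique)
  have "\<infinity> = ennreal (pmf ?q v) * ?F v"
    using v Fv by (simp add: ennreal_mult_top set_pmf_iff)
  also have "\<dots> = (\<integral>\<^sup>+ a. ennreal (pmf ?q v) * ennreal (dist x0 (e a (word_act e v x0))) \<partial>p)"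
    by (simp add: nn_integral_cmult)
  also have "\<dots> \<le> (\<integral>\<^sup>+ a. \<integral>\<^sup>+ ws. ennreal (dist x0 (e a (word_act e ws x0))) \<partial>?q \<partial>p)"
  proof (intro nn_integral_mono)
    fix a
    have "ennreal (pmf ?q v) * ennreal (dist x0 (e a (word_act e v x0)))
        = (\<integral>\<^sup>+ ws. ennreal (dist x0 (e a (word_act e v x0))) * indicator {v} ws \<partial>?q)"
      by (subst nn_integral_cmult_indicator) (simp_all add: emeasure_pmf_single mult.commute)
    also have "\<dots> \<le> (\<integral>\<^sup>+ ws. ennreal (dist x0 (e a (word_act e ws x0))) \<partial>?q)"
      by (intro nn_integral_mono) (auto simp: indicator_def)
    finally show "ennreal (pmf ?q v) * ennreal (dist x0 (e a (word_act e v x0)))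
        \<le> (\<integral>\<^sup>+ ws. ennreal (dist x0 (e a (word_act e ws x0))) \<partial>?q)" .
  qed
  also have "\<dots> = (\<integral>\<^sup>+ ws. dist x0 (word_act e ws x0) \<partial>replicate_pmf L p)" unfolding l by simp
  finally show ?thesis by (simp add: top_unique)
qed

text \<open>The gates are words of length \<open>L\<close>, so the estimates concern the walk
  observed at multiples of \<open>L\<close>. Both bounds come from the same gates and differ only in
  the truncation level.\<close>

lemma AE_walk_subsequence_ge:
  fixes x0 :: "'x::metric_space" and e :: "nat \<Rightarrow> 'x \<Rightarrow> 'x" and p :: "nat pmf"
  assumes geo: "geodesic_space TYPE('x)" and iso_e: "\<And>i. isometry (e i)"
    and u: "set u \<subseteq> set_pmf p" "u \<noteq> []" "contracting_isom x0 (word_act e u)"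
    and v: "set v \<subseteq> set_pmf p" "contracting_isom x0 (word_act e v)"
    and ind: "independent_isom x0 (word_act e u) (word_act e v)"
  obtains L c where "0 < L" "0 < c"
    "AE \<xi> in iid p. eventually (\<lambda>n. c * real n \<le> dist x0 (walk (\<lambda>i. e (\<xi> i)) (n * L) x0)) sequentially"
    "\<forall>K\<ge>0. (\<integral>\<^sup>+ i. dist x0 (e i x0) \<partial>p) = \<infinity> \<longrightarrow>
      (AE \<xi> in iid p. eventually (\<lambda>n. K * real n \<le> dist x0 (walk (\<lambda>i. e (\<xi> i)) (n * L) x0)) sequentially)"
proof -
  define N :: nat where "N = 24"
  define a b where "a = word_act e u" and "b = word_act e v"
  have ab: "isometry a" "isometry b" unfolding a_def b_def by (rule isometry_word_act, rule iso_e)+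
  obtain m r :: nat and Bp Bm Dp Dm where r: "0 < r"
    and G: "gates x0 N (\<lambda>k. (b ^^ (m * Suc k)) \<circ> (a ^^ r) \<circ> (b ^^ (m * (N - k)))) Bp Bm Dp Dm"
    by (rule gates_exist[OF geo ab(1) u(3)[folded a_def] ab(2) v(2)[folded b_def] ind[folded a_def b_def], where N = N])
  define s where "s k = (b ^^ (m * Suc k)) \<circ> (a ^^ r) \<circ> (b ^^ (m * (N - k)))" for k
  define W where "W k = concat (replicate (m * Suc k) v) @ concat (replicate r u) @ concat (replicate (m * (N - k)) v)" for k
  define L where "L = m * (N + 1) * length v + r * length u"
  have L: "0 < L" using r u(2) by (simp add: L_def)
  have W_act: "word_act e (W k) = s k" for k
    by (simp add: W_def s_def a_def b_def word_act_append word_act_power comp_assoc del: mult_Suc_right)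
  have len: "length (concat (replicate k ws)) = k * length ws" for k and ws :: "nat list" by (induction k) auto
  have W_len: "length (W k) = L" if "k < N" for k
  proof -
    have "m * Suc k + m * (N - k) = m * (N + 1)" using that by (simp add: distrib_left[symmetric] del: mult_Suc_right)
    then have "m * Suc k * length v + m * (N - k) * length v = m * (N + 1) * length v" by (metis add_mult_distrib)
    then show ?thesis by (simp add: W_def len L_def del: mult_Suc_right)
  qed
  have "W k \<in> set_pmf (replicate_pmf L p)" if "k < N" for k
    using u(1) v(1) W_len[OF that] by (auto simp: set_replicate_pmf W_def lists_eq_set)
  then obtain \<eta> \<nu> where \<eta>: "0 < \<eta>" "\<eta> < 1" and \<nu>: "replicate_pmf L p = map_pmf (case_sum W id) (letter_pmf \<eta> N \<nu>)"
    using letter_pmf_exists[of N W "replicate_pmf L p"] by (auto simp: N_def)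
  define act where "act = (\<lambda>l. word_act e (case_sum W id l))"
  have act_Inr: "act (Inr ws) = word_act e ws" for ws by (simp add: act_def)
  interpret gate_walk x0 N s Bp Bm Dp Dm act \<eta> \<nu>
  proof (intro gate_walk.intro gate_walk_axioms.intro)
    show "gates x0 N s Bp Bm Dp Dm" unfolding s_def by (rule G)
    show "act (Inl k) = s k" for k by (simp add: act_def W_act)
    show "isometry (act l)" for l unfolding act_def by (rule isometry_word_act) (rule iso_e)
  qed (use \<eta> in \<open>auto simp: N_def\<close>)
  \<comment> \<open>Letters are decoded to words, whose law is that of independent blocks of length
    \<open>L\<close>, and blocks are read off the original sequence. Each passage is an image of
    measures.\<close>
  have transfer: "AE \<xi> in iid p. eventually (\<lambda>n. c * real n \<le> dist x0 (walk (\<lambda>i. e (\<xi> i)) (n * L) x0)) sequentially"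
    if c: "0 \<le> M" "0 \<le> c" "ennreal c < ennreal (\<eta>\<^sup>2 * (1 - \<eta>) / 2) * (\<integral>\<^sup>+ b. step_len M b \<partial>\<nu>)" for c M
  proof -
    define Q where "Q \<zeta> \<longleftrightarrow> eventually (\<lambda>n. c * real n \<le> dist x0 (walk (\<lambda>i. word_act e (\<zeta> i)) n x0)) sequentially" for \<zeta>
    have m [measurable]: "(\<lambda>\<zeta>. dist x0 (walk (\<lambda>i. word_act e (\<zeta> i)) n x0)) \<in> borel_measurable (iid (replicate_pmf L p))" for n
      by (rule measurable_iid_finite[of n], rule arg_cong[where f = "\<lambda>w. dist x0 (w x0)"], rule walk_cong) auto
    have Q: "{\<zeta> \<in> space (iid (replicate_pmf L p)). Q \<zeta>} \<in> sets (iid (replicate_pmf L p))"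
      unfolding Q_def eventually_sequentially by measurable
    have 1: "AE \<xi> in iid \<kappa>. Q (\<lambda>i. case_sum W id (\<xi> i))"
      using AE_walk_ge[OF c] unfolding Q_def act_def .
    have "(AE \<zeta> in distr (iid \<kappa>) (iid (replicate_pmf L p)) (\<lambda>\<xi> i. case_sum W id (\<xi> i)). Q \<zeta>) \<longleftrightarrow>
      (AE \<xi> in iid \<kappa>. Q (\<lambda>i. case_sum W id (\<xi> i)))"
      by (rule AE_distr_iff[OF measurable_iid_map Q])
    then have "AE \<zeta> in distr (iid \<kappa>) (iid (replicate_pmf L p)) (\<lambda>\<xi> i. case_sum W id (\<xi> i)). Q \<zeta>"
      using 1 by (rule iffD2)
    then have "AE \<zeta> in iid (replicate_pmf L p). Q \<zeta>"
      using distr_iid_map[of \<kappa> "case_sum W id"] by (simp only: \<nu>[symmetric])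
    then have "AE \<zeta> in distr (iid p) (iid (replicate_pmf L p)) (blocks L). Q \<zeta>" by (simp only: distr_iid_blocks)
    from AE_distrD[OF measurable_blocks this] show ?thesis
      unfolding Q_def walk_blocks .
  qed
  define d where "d = \<eta>\<^sup>2 * (1 - \<eta>) / 2"
  have d: "0 < d" using \<eta> by (simp add: d_def)
  show thesis
  proof (rule that[OF L])
    show "0 < d / 2" using d by simp
    \<comment> \<open>With truncation level 0, only the gain of 1 at each gate is counted; this
      already gives a positive slope.\<close>
    have "(\<integral>\<^sup>+ b. step_len 0 b \<partial>\<nu>) = 1" by (simp add: step_len_def)
    then have "ennreal (d / 2) < ennreal d * (\<integral>\<^sup>+ b. step_len 0 b \<partial>\<nu>)" using d by (simp add: ennreal_less_iff)
    then show "AE \<xi> in iid p. eventually (\<lambda>n. d / 2 * real n \<le> dist x0 (walk (\<lambda>i. e (\<xi> i)) (n * L) x0)) sequentially"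
      using d by (intro transfer[of 0]) (auto simp: d_def)
  next
    show "\<forall>K\<ge>0. (\<integral>\<^sup>+ i. dist x0 (e i x0) \<partial>p) = \<infinity> \<longrightarrow>
      (AE \<xi> in iid p. eventually (\<lambda>n. K * real n \<le> dist x0 (walk (\<lambda>i. e (\<xi> i)) (n * L) x0)) sequentially)"
    proof (intro allI impI)
      fix K :: real assume inf: "(\<integral>\<^sup>+ i. dist x0 (e i x0) \<partial>p) = \<infinity>" and K: "0 \<le> K"
    have N0: "0 < N" by (simp add: N_def)
    have "\<infinity> = (\<integral>\<^sup>+ ws. dist x0 (word_act e ws x0) \<partial>replicate_pmf L p)"
      using nn_integral_replicate_infinite[OF iso_e inf L] by simp
    also have "\<dots> = (\<integral>\<^sup>+ l. dist x0 (act l x0) \<partial>\<kappa>)" by (simp add: \<nu> act_def)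
    also have "\<dots> = ennreal \<eta> * ((\<Sum>k<N. ennreal (dist x0 (act (Inl k) x0))) / of_nat N) +
        ennreal (1 - \<eta>) * (\<integral>\<^sup>+ b. ennreal (dist x0 (act (Inr b) x0)) \<partial>\<nu>)"
      using \<eta> N0 by (intro nn_integral_letter_pmf) auto
    \<comment> \<open>The finitely many gates have finite displacement, so the infinite mean must
      come from the ordinary letters.\<close>
    finally have "(\<integral>\<^sup>+ b. ennreal (dist x0 (act (Inr b) x0)) \<partial>\<nu>) = \<infinity>"
    proof (rule contrapos_pp)
      assume "(\<integral>\<^sup>+ b. ennreal (dist x0 (act (Inr b) x0)) \<partial>\<nu>) \<noteq> \<infinity>"
      moreover have "(\<Sum>k<N. ennreal (dist x0 (act (Inl k) x0))) / of_nat N \<noteq> \<infinity>"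
        using N0 by (simp add: sum_ennreal ennreal_of_nat_eq_real_of_nat divide_ennreal sum_nonneg)
      ultimately show "\<infinity> \<noteq> ennreal \<eta> * ((\<Sum>k<N. ennreal (dist x0 (act (Inl k) x0))) / of_nat N) +
        ennreal (1 - \<eta>) * (\<integral>\<^sup>+ b. ennreal (dist x0 (act (Inr b) x0)) \<partial>\<nu>)"
        by (auto simp: ennreal_mult_eq_top_iff dest!: sym[of top])
    qed
    then have sup: "(SUP i::nat. \<integral>\<^sup>+ b. ennreal (min (dist x0 (act (Inr b) x0)) (real i)) \<partial>\<nu>) = \<infinity>"
      by (subst nn_integral_truncate[symmetric]) auto
    have "ennreal ((K + 1) / d) < (SUP i::nat. \<integral>\<^sup>+ b. ennreal (min (dist x0 (act (Inr b) x0)) (real i)) \<partial>\<nu>)"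
      unfolding sup by simp
    then obtain i :: nat where i: "ennreal ((K + 1) / d) < (\<integral>\<^sup>+ b. ennreal (min (dist x0 (act (Inr b) x0)) (real i)) \<partial>\<nu>)"
      by (auto simp: less_SUP_iff)
    also have "\<dots> \<le> (\<integral>\<^sup>+ b. step_len (real i) b \<partial>\<nu>)"
      by (intro nn_integral_mono ennreal_leI) (auto simp: step_len_def)
    finally have "ennreal d * ennreal ((K + 1) / d) \<le> ennreal d * (\<integral>\<^sup>+ b. step_len (real i) b \<partial>\<nu>)"
      by (intro mult_left_mono) auto
    moreover have "ennreal K < ennreal (K + 1)" using K by (simp add: ennreal_less_iff del: ennreal_plus)
    moreover have "ennreal d * ennreal ((K + 1) / d) = ennreal (K + 1)" using d K by (simp add: ennreal_mult[symmetric] del: ennreal_plus)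
    ultimately have "ennreal K < ennreal d * (\<integral>\<^sup>+ b. step_len (real i) b \<partial>\<nu>)" by simp
    then show "AE \<xi> in iid p. eventually (\<lambda>n. K * real n \<le> dist x0 (walk (\<lambda>i. e (\<xi> i)) (n * L) x0)) sequentially"
      using K by (intro transfer[of "real i"]) (auto simp: d_def)
    qed
  qed
qed

text \<open>Write \<open>m = r + n * L\<close> and treat the first \<open>r < L\<close> letters
  separately: the rest is a walk observed at a multiple of \<open>L\<close>, and the initial piece
  is one of finitely many. Removing the last letters instead would require control of increments
  whose mean is infinite.\<close>

lemma walk_tendsto_infinity:
  fixes f :: "nat \<Rightarrow> 'x::metric_space \<Rightarrow> 'x"
  assumes iso: "\<And>i. isometry (f i)" and L: "0 < L"
    and K: "\<And>r K::nat. eventually (\<lambda>n. real K * real n \<le> dist x0 (walk (\<lambda>i. f (i + r)) (n * L) x0)) sequentially"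
  shows "(\<lambda>n. ereal (dist x0 (walk f n x0) / real n)) \<longlonglongrightarrow> \<infinity>"
  unfolding tendsto_PInfty
proof
  fix B :: real
  obtain b :: nat where b: "B < real b" using reals_Archimedean2 by blast
  \<comment> \<open>The slope \<open>b + 1\<close> per letter exceeds the required slope
    \<open>b\<close>, and the surplus \<open>m\<close> absorbs the constant
    \<open>C\<close>.\<close>
  define k where "k = (b + 1) * L"
  have "\<exists>n0. \<forall>n\<ge>n0. real k * real n \<le> dist x0 (walk (\<lambda>i. f (i + r)) (n * L) x0)" for r
    using K[of k r] unfolding eventually_sequentially .
  then obtain n0 where n0: "\<And>r n. n0 r \<le> n \<Longrightarrow> real k * real n \<le> dist x0 (walk (\<lambda>i. f (i + r)) (n * L) x0)" by metis
  define C where "C = (\<Sum>r<L. dist x0 (walk f r x0)) + real (b + 1) * L"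
  obtain c :: nat where c: "C < real c" using reals_Archimedean2 by blast
  have main: "real b * real m \<le> dist x0 (walk f m x0)" if m: "(\<Sum>r<L. n0 r) * L + L + c \<le> m" for m
  proof -
    define r n where "r = m mod L" and "n = m div L"
    have rL: "r < L" and mrn: "m = r + n * L" using L by (auto simp: r_def n_def)
    have "n0 r \<le> (\<Sum>r<L. n0 r)" using rL by (intro member_le_sum) auto
    also have "\<dots> \<le> n" using m L unfolding n_def by (simp add: less_eq_div_iff_mult_less_eq)
    finally have 1: "real k * real n \<le> dist x0 (walk (\<lambda>i. f (i + r)) (n * L) x0)" by (rule n0)
    have w: "isometry (walk f j)" for j
    proof (induction j)
      case (Suc j)
      show ?case unfolding walk.simps by (intro isometry_comp Suc iso)
    qed (unfold walk.simps, rule isometry_id)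
    have "dist x0 (walk (\<lambda>i. f (i + r)) (n * L) x0) = dist (walk f r x0) (walk f m x0)"
      unfolding mrn walk_add comp_apply by (rule isometryD(2)[OF w, symmetric])
    also have "\<dots> \<le> dist x0 (walk f r x0) + dist x0 (walk f m x0)" by (rule dist_triangle3)
    finally have 2: "dist x0 (walk (\<lambda>i. f (i + r)) (n * L) x0) \<le> dist x0 (walk f r x0) + dist x0 (walk f m x0)" .
    have 3: "dist x0 (walk f r x0) \<le> (\<Sum>r<L. dist x0 (walk f r x0))" using rL by (intro member_le_sum) auto
    have "real k * real n = real (b + 1) * (real m - real r)" by (simp add: k_def mrn algebra_simps)
    moreover have "real (b + 1) * real r \<le> real (b + 1) * L" using rL by (intro mult_left_mono) auto
    ultimately have "real (b + 1) * real m - real (b + 1) * L \<le> real k * real n" by (simp add: right_diff_distrib)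
    then have "real (b + 1) * real m \<le> C + dist x0 (walk f m x0)" using 1 2 3 by (simp add: C_def)
    moreover have "C \<le> real m" using c m by simp
    ultimately show ?thesis by (simp add: algebra_simps)
  qed
  show "eventually (\<lambda>n. ereal B < ereal (dist x0 (walk f n x0) / real n)) sequentially"
    using eventually_ge_at_top[of "(\<Sum>r<L. n0 r) * L + L + c"]
  proof eventually_elim
    case (elim m)
    then have "0 < m" using L by linarith
    then have "real b \<le> dist x0 (walk f m x0) / real m" using main[OF elim] by (simp add: le_divide_eq)
    then show ?case using b by simp
  qed
qed

theorem theorem1p5:
  fixes G :: "('x::metric_space \<Rightarrow> 'x) set" and x0 :: 'x and \<mu> :: "('x \<Rightarrow> 'x) pmf"
  assumes "geodesic_space TYPE('x)"
    and "isometry_group G"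
    and "\<exists>g\<in>G. \<exists>h\<in>G. contracting_isom x0 g \<and> contracting_isom x0 h \<and> independent_isom x0 g h"
    and "set_pmf \<mu> \<subseteq> G"
    and "non_elementary x0 \<mu>"
  shows "\<exists>lam::ereal. 0 < lam \<and>
    (AE \<xi> in PiM (UNIV::nat set) (\<lambda>_. measure_pmf \<mu>).
       (\<lambda>n. ereal (dist x0 (walk \<xi> n x0) / real n)) \<longlonglongrightarrow> lam) \<and>
    (lam < \<infinity> \<longleftrightarrow> (\<integral>\<^sup>+ g. ennreal (dist x0 (g x0)) \<partial>measure_pmf \<mu>) < \<infinity>)"
proof -
  have G: "countable G" "G \<noteq> {}" "\<And>g. g \<in> G \<Longrightarrow> isometry g" using assms(2) by (auto simp: isometry_group_def)
  \<comment> \<open>The type of all maps is uncountable, so the support is encoded by natural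
    numbers through the countable group.\<close>
  define e where "e = from_nat_into G"
  define code where "code = to_nat_on G"
  define p where "p = map_pmf code \<mu>"
  have code: "e (code g) = g" if "g \<in> set_pmf \<mu>" for g
    using that assms(4) G(1) unfolding e_def code_def by (intro from_nat_into_to_nat_on) auto
  have iso: "isometry (e i)" for i unfolding e_def using G by (intro G(3) from_nat_into)
  have "e ` set_pmf p = set_pmf \<mu>" using code by (auto simp: p_def image_image)
  then obtain g h where gh: "g \<in> gen_semigroup (e ` set_pmf p)" "h \<in> gen_semigroup (e ` set_pmf p)"
    "contracting_isom x0 g" "contracting_isom x0 h" "independent_isom x0 g h"
    using assms(5) unfolding non_elementary_def by auto
  obtain u where u: "u \<noteq> []" "set u \<subseteq> set_pmf p" "word_act e u = g" using gen_semigroup_word[OF gh(1)] .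
  obtain v where v: "v \<noteq> []" "set v \<subseteq> set_pmf p" "word_act e v = h" using gen_semigroup_word[OF gh(2)] .
  obtain L c where L: "0 < L" and c: "0 < c"
    and ge: "AE \<xi> in iid p. eventually (\<lambda>n. c * real n \<le> dist x0 (walk (\<lambda>i. e (\<xi> i)) (n * L) x0)) sequentially"
    and ge_inf: "\<forall>K\<ge>0. (\<integral>\<^sup>+ i. dist x0 (e i x0) \<partial>p) = \<infinity> \<longrightarrow>
      (AE \<xi> in iid p. eventually (\<lambda>n. K * real n \<le> dist x0 (walk (\<lambda>i. e (\<xi> i)) (n * L) x0)) sequentially)"
    by (rule AE_walk_subsequence_ge[OF assms(1) iso u(2,1) gh(3)[folded u(3)] v(2) gh(4)[folded v(3)] gh(5)[folded u(3) v(3)]])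
  \<comment> \<open>Decoding inverts the encoding on the support of \<open>\<mu>\<close>, which
    almost surely contains all increments.\<close>
  have decode: "AE \<xi> in iid \<mu>. R \<xi>" if "AE \<xi> in iid p. R (\<lambda>i. e (\<xi> i))" for R
  proof -
    have "AE \<xi> in distr (iid \<mu>) (iid p) (\<lambda>\<xi> i. code (\<xi> i)). R (\<lambda>i. e (\<xi> i))"
      using that distr_iid_map[of \<mu> code] by (simp only: p_def)
    from AE_distrD[OF measurable_iid_map this] have 1: "AE \<xi> in iid \<mu>. R (\<lambda>i. e (code (\<xi> i)))" .
    have "AE \<xi> in iid \<mu>. \<xi> i \<in> set_pmf \<mu>" for i
      by (rule AE_PiM_component[of UNIV "\<lambda>_. measure_pmf \<mu>" i]) (auto simp: AE_measure_pmf measure_pmf.prob_space_axioms)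
    then have "AE \<xi> in iid \<mu>. \<forall>i. \<xi> i \<in> set_pmf \<mu>" by (simp add: AE_all_countable)
    with 1 show ?thesis by eventually_elim (simp add: code)
  qed
  have int: "(\<integral>\<^sup>+ i. ennreal (dist x0 (e i x0)) \<partial>p) = (\<integral>\<^sup>+ g. ennreal (dist x0 (g x0)) \<partial>\<mu>)"
    unfolding p_def nn_integral_map_pmf by (intro nn_integral_cong_AE) (simp add: AE_measure_pmf_iff code)
  show ?thesis
  proof (cases "(\<integral>\<^sup>+ g. ennreal (dist x0 (g x0)) \<partial>\<mu>) < \<infinity>")
    case True
    define x where "x n \<xi> = dist x0 (walk (\<lambda>i. e (\<xi> i)) n x0)" for n \<xi>
    interpret prob_space "iid p" by (rule prob_space_iid)
    interpret subadditive p x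
    proof
      show "x n \<in> borel_measurable (iid p)" for n unfolding x_def
        by (rule measurable_iid_finite[of n], rule arg_cong[where f = "\<lambda>w. dist x0 (w x0)"], rule walk_cong) auto
      show "x (m + n) \<xi> \<le> x m \<xi> + x n (shift m \<xi>)" for m n \<xi>
      proof -
        have "isometry (walk (\<lambda>i. e (\<xi> i)) m)"
          using isometry_seg[of e \<xi> 0 m, OF iso] by (simp add: seg_0)
        then have "x n (shift m \<xi>) = dist (walk (\<lambda>i. e (\<xi> i)) m x0) (walk (\<lambda>i. e (\<xi> i)) (m + n) x0)"
          unfolding walk_add x_def shift_def by (simp add: isometryD(2))
        then show ?thesis unfolding x_def by (simp add: dist_triangle)
      qed
      have "(\<integral>\<^sup>+ \<xi>. x 1 \<xi> \<partial>iid p) = (\<integral>\<^sup>+ \<xi>. ennreal (dist x0 (word_act e (map \<xi> [0..<1]) x0)) \<partial>iid p)"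
        unfolding x_def word_act_prefix ..
      also have "\<dots> = (\<integral>\<^sup>+ i. ennreal (dist x0 (e i x0)) \<partial>p)"
        by (subst nn_integral_prefix) (simp add: replicate_pmf_1)
      finally show "(\<integral>\<^sup>+ \<xi>. x 1 \<xi> \<partial>iid p) < \<infinity>" using True int by simp
    qed (auto simp: x_def)
    \<comment> \<open>The limit along all times equals the limit along multiples of
      \<open>L\<close>, where the lower bound is known. The claim is about constants, hence holds
      outright.\<close>
    have "AE \<xi> in iid p. c / L \<le> rate"
      using kingman ge
    proof eventually_elim
      case (elim \<xi>)
      have "(\<lambda>n. x (n * L) \<xi> / real (n * L)) \<longlonglongrightarrow> rate"
        using LIMSEQ_subseq_LIMSEQ[OF elim(1), of "\<lambda>n. n * L"] L by (simp add: strict_mono_def comp_def)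
      moreover have "eventually (\<lambda>n. c / L \<le> x (n * L) \<xi> / real (n * L)) sequentially"
        using elim(2) eventually_gt_at_top[of 0]
      proof eventually_elim
        case (elim n)
        then show ?case using L by (simp add: x_def field_simps)
      qed
      ultimately show ?case by (rule tendsto_lowerbound) simp
    qed
    then have "c / L \<le> rate" by simp
    moreover have "0 < c / L" using c L by simp
    ultimately have "0 < rate" by linarith
    moreover have "AE \<xi> in iid \<mu>. (\<lambda>n. ereal (dist x0 (walk \<xi> n x0) / real n)) \<longlonglongrightarrow> ereal rate"
      by (rule decode) (use kingman in \<open>simp add: x_def\<close>)
    ultimately show ?thesis using True by (intro exI[of _ "ereal rate"]) simp
  next
    case False
    then have inf: "(\<integral>\<^sup>+ i. ennreal (dist x0 (e i x0)) \<partial>p) = \<infinity>" by (simp add: int not_less top_unique)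
    \<comment> \<open>The bound is needed for all slopes and all starting times simultaneously;
      shift invariance and countability give one null set.\<close>
    have "AE \<xi> in iid p. \<forall>r K::nat. eventually (\<lambda>n. real K * real n \<le> dist x0 (walk (\<lambda>i. e (shift r \<xi> i)) (n * L) x0)) sequentially"
      unfolding AE_all_countable by (intro allI AE_shift ge_inf[rule_format] inf) simp
    then have "AE \<xi> in iid p. (\<lambda>n. ereal (dist x0 (walk (\<lambda>i. e (\<xi> i)) n x0) / real n)) \<longlonglongrightarrow> \<infinity>"
    proof eventually_elim
      case (elim \<xi>)
      then show ?case by (intro walk_tendsto_infinity[OF _ L] iso) (simp add: shift_def)
    qed
    then have "AE \<xi> in iid \<mu>. (\<lambda>n. ereal (dist x0 (walk \<xi> n x0) / real n)) \<longlonglongrightarrow> \<infinity>" by (rule decode)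
    then show ?thesis using False by (intro exI[of _ \<infinity>]) simp
  qed
qed

end
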